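(* Let $\lambda\in P^+$ and let $\boldsymbol{\xi}=(\xi_\alpha)_{\alpha\in R^+}$ be a normalized tuple of positive integers. Then $\mathcal{J}_{\boldsymbol{\xi},\lambda}=\mathcal{I}_{\boldsymbol{\xi},\lambda}\cap\mathbf{U}^-$ is the left ideal of $\mathbf{U}^-$ generated by the elements $$\mathbf{x}_i^-(r,s),\quad 1\le i\le n,\ r\in\mathbb{N},\ s\in\mathbb{Z}_+\ \text{with}\ r+s\ge1+\lambda_i,$$ $$x_\alpha^-\otimes t^k,\quad \alpha\in R^+,\ k\ge\min\{\xi_\beta:\beta\succeq\alpha\}.$$
   Context: $\mathfrak{g}=\mathfrak{sl}_{n+1}(\mathbb{C})=\mathfrak{n}^-\oplus\mathfrak{h}\oplus\mathfrak{n}^+$, with simple roots $\alpha_1,\dots,\alpha_n$, positive roots $R^+$, $Q^+=\sum_i\mathbb{Z}_+\alpha_i$, dominant integral weights $P^+$, simple coroots $h_i$, root vectors $x^{\pm}_\alpha$ of weight $\pm\alpha$, $x_i^{\pm}=x^{\pm}_{\alpha_i}$, $\lambda_i=\lambda(h_i)$; $\mathbb{Z}_+$ denotes the non-negative integers and $\mathbb{N}$ the positive integers. For $\alpha,\beta\in R^+$, $\beta\succeq\alpha$ means $\beta-\alpha\in Q^+$. The tuple $\boldsymbol{\xi}$ is normalized if $\xi_\alpha=\min\{\xi_\beta:\beta\succeq\alpha\}$ for all $\alpha\in R^+$. $\mathfrak{a}[t]=\mathfrak{a}\otimes\mathbb{C}[t]$, $\mathbf{U}=\mathbf{U}(\mathfrak{g}[t])$,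 $\mathbf{U}^-=\mathbf{U}(\mathfrak{n}^-[t])\subseteq\mathbf{U}$ (universal enveloping algebras). $\mathcal{I}_{\boldsymbol{\xi},\lambda}\subseteq\mathbf{U}$ is the left ideal generated by $$\mathfrak{n}^+[t],\quad h_i\otimes t^r,\quad h_i-\lambda_i\cdot1\quad(r\in\mathbb{N},\ 1\le i\le n),\quad (x_i^-\otimes1)^{\lambda_i+1}\ (1\le i\le n),\quad x^-_\alpha\otimes t^{\xi_\alpha}\ (\alpha\in R^+).$$ (The quotient $M_{\boldsymbol{\xi},\lambda}=\mathbf{U}/\mathcal{I}_{\boldsymbol{\xi},\lambda}$ is then isomorphic, as a $\mathbf{U}^-$-module, to $\mathbf{U}^-/\mathcal{J}_{\boldsymbol{\xi},\lambda}$.) With $x^{(b)}=x^b/b!$, for $r,s\in\mathbb{Z}_+$, $$\mathbf{x}_i^-(r,s)=\sum(x_i^-\otimes1)^{(b_0)}(x_i^-\otimes t)^{(b_1)}\cdots(x_i^-\otimes t^s)^{(b_s)},$$ the sum over all tuples $(b_0,\dots,b_s)$ of non-negative integers with $b_0+\cdots+b_s=r$ and $b_1+2b_2+\cdots+sb_s=s$. *)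

theory Defs
  imports
    "HOL-Library.Poly_Mapping"
    "HOL-Computational_Algebra.Polynomial"
    "HOL-Algebra.Algebraic_Closure_Type"
    "Jordan_Normal_Form.Matrix"
begin

subsection \<open>Left ideals\<close>

definition left_ideal :: "'a set \<Rightarrow> ('a, 'b) ring_scheme \<Rightarrow> bool" where
  "left_ideal I R \<longleftrightarrow>
     additive_subgroup I R \<and> (\<forall>a\<in>carrier R. \<forall>x\<in>I. a \<otimes>\<^bsub>R\<^esub> x \<in> I)"

definition gen_left_ideal :: "('a, 'b) ring_scheme \<Rightarrow> 'a set \<Rightarrow> 'a set" where
  "gen_left_ideal R S = \<Inter>{I. left_ideal I R \<and> S \<subseteq> I}"

subsection \<open>Free algebras\<close>

text \<open>The free complex algebra is the monoid algebra of the free monoid. Lists are wrapped in a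
  type of their own so that concatenation can serve as the (non-commutative) addition that the
  convolution product of \<^typ>\<open>'a \<Rightarrow>\<^sub>0 'b\<close> requires.\<close>

datatype 'a free_monoid = Monomial (letters: "'a list")

instantiation free_monoid :: (type) monoid_add
begin

definition zero_free_monoid :: "'a free_monoid" where
  "0 = Monomial []"

definition plus_free_monoid :: "'a free_monoid \<Rightarrow> 'a free_monoid \<Rightarrow> 'a free_monoid" where
  "u + v = Monomial (letters u @ letters v)"

instance
  by standard (simp_all add: zero_free_monoid_def plus_free_monoid_def)

end

type_synonym 'a free_alg = "'a free_monoid \<Rightarrow>\<^sub>0 complex"

definition free_algebra :: "'a set \<Rightarrow> 'a free_alg ring" where
  "free_algebra L =
     ring_of_type_algebra\<lparr>carrier := {p. \<forall>w\<in>Poly_Mapping.keys p. set (letters w) \<subseteq> L}\<rparr>"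

definition gen :: "'a \<Rightarrow> 'a free_alg" where
  "gen x = Poly_Mapping.single (Monomial [x]) 1"

definition scalar :: "complex \<Rightarrow> 'a free_alg" where
  "scalar c = Poly_Mapping.single 0 c"

definition divpow :: "'a free_alg \<Rightarrow> nat \<Rightarrow> 'a free_alg" where
  "divpow p b = scalar (1 / fact b) * p ^ b"

subsection \<open>Universal enveloping algebras\<close>

definition bracket :: "'r::ring mat \<Rightarrow> 'r mat \<Rightarrow> 'r mat" where
  "bracket x y = x * y - y * x"

text \<open>For a complex Lie algebra \<open>L\<close> of matrices over \<open>\<complex>[t]\<close>, the enveloping algebra is the
  quotient of the free algebra on the set \<open>L\<close> by the relations below: the first two families
  cut it down to the tensor algebra of the vector space \<open>L\<close>, the third one identifies the
  commutator with the Lie bracket.\<close>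

definition uea_rels :: "complex poly mat set \<Rightarrow> complex poly mat free_alg set" where
  "uea_rels L =
     {gen (x + y) - gen x - gen y | x y. x \<in> L \<and> y \<in> L} \<union>
     {gen ([:c:] \<cdot>\<^sub>m x) - scalar c * gen x | c x. x \<in> L} \<union>
     {gen x * gen y - gen y * gen x - gen (bracket x y) | x y. x \<in> L \<and> y \<in> L}"

definition uea_ideal :: "complex poly mat set \<Rightarrow> complex poly mat free_alg set" where
  "uea_ideal L = genideal (free_algebra L) (uea_rels L)"

definition uea :: "complex poly mat set \<Rightarrow> complex poly mat free_alg set ring" where
  "uea L = free_algebra L Quot uea_ideal L"

definition uea_class ::
  "complex poly mat set \<Rightarrow> complex poly mat free_alg \<Rightarrow> complex poly mat free_alg set" where
  "uea_class L p = uea_ideal L +>\<^bsub>free_algebra L\<^esub> p"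

text \<open>For a Lie subalgebra \<open>L\<close> of \<open>M\<close>, the subalgebra \<open>U(L)\<close> of \<open>U(M)\<close>, i.e. the image of the
  canonical map \<open>U(L) \<rightarrow> U(M)\<close>. On cosets this map is \<open>p + I\<^sub>L \<mapsto> p + I\<^sub>M\<close>, and
  \<open>p + I\<^sub>M = I\<^sub>M + (p + I\<^sub>L)\<close> because \<open>I\<^sub>L \<subseteq> I\<^sub>M\<close>.\<close>

definition uea_sub ::
  "complex poly mat set \<Rightarrow> complex poly mat set \<Rightarrow> complex poly mat free_alg set ring" where
  "uea_sub L M =
     (uea M)\<lparr>carrier := set_add (free_algebra M) (uea_ideal M) ` carrier (uea L)\<rparr>"

subsection \<open>The Lie algebra \<open>sl\<^sub>n\<^sub>+\<^sub>1\<close>\<close>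

text \<open>Matrix rows and columns are numbered from \<open>0\<close> to \<open>n\<close>, simple roots and simple coroots
  from \<open>1\<close> to \<open>n\<close>.\<close>

definition sl :: "nat \<Rightarrow> complex mat set" where
  "sl n = {A \<in> carrier_mat (Suc n) (Suc n). (\<Sum>i\<le>n. A $$ (i, i)) = 0}"

definition cartan :: "nat \<Rightarrow> complex mat set" where
  "cartan n = {A \<in> sl n. diagonal_mat A}"

definition nil_pos :: "nat \<Rightarrow> complex mat set" where
  "nil_pos n = {A \<in> sl n. \<forall>i\<le>n. \<forall>j\<le>n. A $$ (i, j) \<noteq> 0 \<longrightarrow> i < j}"

definition nil_neg :: "nat \<Rightarrow> complex mat set" where
  "nil_neg n = {A \<in> sl n. \<forall>i\<le>n. \<forall>j\<le>n. A $$ (i, j) \<noteq> 0 \<longrightarrow> j < i}"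

definition coroot :: "nat \<Rightarrow> nat \<Rightarrow> complex mat" where
  "coroot n i = mat (Suc n) (Suc n)
     (\<lambda>(a, b). if a = b \<and> a = i - 1 then 1 else if a = b \<and> a = i then - 1 else 0)"

text \<open>Weights are functionals on \<open>cartan n\<close>. The ones in the root lattice are given by formulas
  that make sense for every matrix; two of them are equal as functions as soon as they agree on
  \<open>cartan n\<close>, since the simple roots are linearly independent there.\<close>

type_synonym weight = "complex mat \<Rightarrow> complex"

definition simple_root :: "nat \<Rightarrow> weight" where
  "simple_root i = (\<lambda>H. H $$ (i - 1, i - 1) - H $$ (i, i))"

definition Qplus :: "nat \<Rightarrow> weight set" where
  "Qplus n = {(\<lambda>H. \<Sum>i = 1..n. of_nat (m i) * simple_root i H) | m :: nat \<Rightarrow> nat. True}"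

definition root_space :: "nat \<Rightarrow> weight \<Rightarrow> complex mat set" where
  "root_space n \<alpha> = {x \<in> sl n. \<forall>H\<in>cartan n. bracket H x = \<alpha> H \<cdot>\<^sub>m x}"

definition pos_roots :: "nat \<Rightarrow> weight set" where
  "pos_roots n =
     {\<alpha> \<in> Qplus n. \<alpha> \<noteq> (\<lambda>H. 0) \<and> root_space n \<alpha> \<noteq> {0\<^sub>m (Suc n) (Suc n)}}"

definition root_ge :: "nat \<Rightarrow> weight \<Rightarrow> weight \<Rightarrow> bool" where
  "root_ge n \<beta> \<alpha> \<longleftrightarrow> (\<lambda>H. \<beta> H - \<alpha> H) \<in> Qplus n"

text \<open>\<open>xm \<alpha>\<close> plays the role of \<open>x\<^sup>-\<^sub>\<alpha>\<close>: an arbitrary choice of root vectors, with no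
  normalization of the scalars.\<close>

definition neg_root_vectors :: "nat \<Rightarrow> (weight \<Rightarrow> complex mat) \<Rightarrow> bool" where
  "neg_root_vectors n xm \<longleftrightarrow>
     (\<forall>\<alpha>\<in>pos_roots n. xm \<alpha> \<in> root_space n (\<lambda>H. - \<alpha> H) \<and> xm \<alpha> \<noteq> 0\<^sub>m (Suc n) (Suc n))"

definition dominant_integral :: "nat \<Rightarrow> weight \<Rightarrow> bool" where
  "dominant_integral n \<Lambda> \<longleftrightarrow>
     (\<forall>H\<in>cartan n. \<forall>K\<in>cartan n. \<Lambda> (H + K) = \<Lambda> H + \<Lambda> K) \<and>
     (\<forall>c. \<forall>H\<in>cartan n. \<Lambda> (c \<cdot>\<^sub>m H) = c * \<Lambda> H) \<and>
     (\<forall>i\<in>{1..n}. \<Lambda> (coroot n i) \<in> \<nat>)"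

text \<open>The number \<open>\<Lambda>\<^sub>i = \<Lambda>(h\<^sub>i)\<close> as a natural number, for dominant integral \<open>\<Lambda>\<close>.\<close>

definition coord :: "nat \<Rightarrow> weight \<Rightarrow> nat \<Rightarrow> nat" where
  "coord n \<Lambda> i = (THE l. \<Lambda> (coroot n i) = of_nat l)"

definition xi_min :: "nat \<Rightarrow> (weight \<Rightarrow> nat) \<Rightarrow> weight \<Rightarrow> nat" where
  "xi_min n \<xi> \<alpha> = Min {\<xi> \<beta> | \<beta>. \<beta> \<in> pos_roots n \<and> root_ge n \<beta> \<alpha>}"

definition normalized :: "nat \<Rightarrow> (weight \<Rightarrow> nat) \<Rightarrow> bool" where
  "normalized n \<xi> \<longleftrightarrow> (\<forall>\<alpha>\<in>pos_roots n. \<xi> \<alpha> = xi_min n \<xi> \<alpha>)"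

subsection \<open>The current algebra and its enveloping algebra\<close>

text \<open>For a subspace \<open>V\<close> of matrices, \<open>V \<otimes> \<complex>[t]\<close> is realized as the space of matrices over
  \<open>\<complex>[t]\<close> all of whose \<open>t\<^sup>k\<close>-coefficients lie in \<open>V\<close>.\<close>

definition current :: "complex mat set \<Rightarrow> complex poly mat set" where
  "current V = {A. \<forall>k. map_mat (\<lambda>p. coeff p k) A \<in> V}"

definition tens :: "complex mat \<Rightarrow> nat \<Rightarrow> complex poly mat" where
  "tens x k = map_mat (\<lambda>c. monom c k) x"

definition UU :: "nat \<Rightarrow> complex poly mat free_alg set ring" where
  "UU n = uea (current (sl n))"

definition Uminus :: "nat \<Rightarrow> complex poly mat free_alg set ring" where
  "Uminus n = uea_sub (current (nil_neg n)) (current (sl n))"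

text \<open>Elements of the enveloping algebra are written as images of noncommutative polynomials
  in the generators.\<close>

definition in_U :: "nat \<Rightarrow> complex poly mat free_alg \<Rightarrow> complex poly mat free_alg set" where
  "in_U n p = uea_class (current (sl n)) p"

definition I_ideal ::
  "nat \<Rightarrow> (weight \<Rightarrow> complex mat) \<Rightarrow> (weight \<Rightarrow> nat) \<Rightarrow> weight \<Rightarrow> complex poly mat free_alg set set"
  where
  "I_ideal n xm \<xi> \<Lambda> = gen_left_ideal (UU n)
     (in_U n `
       ({gen x | x. x \<in> current (nil_pos n)} \<union>
        {gen (tens (coroot n i) r) | i r. i \<in> {1..n} \<and> 1 \<le> r} \<union>
        {gen (tens (coroot n i) 0) - scalar (\<Lambda> (coroot n i)) | i. i \<in> {1..n}} \<union>
        {gen (tens (xm (simple_root i)) 0) ^ (coord n \<Lambda> i + 1) | i. i \<in> {1..n}} \<union>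
        {gen (tens (xm \<alpha>) (\<xi> \<alpha>)) | \<alpha>. \<alpha> \<in> pos_roots n}))"

definition J_ideal ::
  "nat \<Rightarrow> (weight \<Rightarrow> complex mat) \<Rightarrow> (weight \<Rightarrow> nat) \<Rightarrow> weight \<Rightarrow> complex poly mat free_alg set set"
  where
  "J_ideal n xm \<xi> \<Lambda> = I_ideal n xm \<xi> \<Lambda> \<inter> carrier (Uminus n)"

text \<open>For \<open>x = x\<^sub>i\<^sup>-\<close>, \<open>in_U n (garland x r s)\<close> is the element \<open>\<^bold>x\<^sub>i\<^sup>-(r, s)\<close>.
  A tuple \<open>(b\<^sub>0, \<dots>, b\<^sub>s)\<close> is a list of length \<open>s + 1\<close>.\<close>

definition garland_tuples :: "nat \<Rightarrow> nat \<Rightarrow> nat list set" where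
  "garland_tuples r s =
     {b. length b = s + 1 \<and> (\<Sum>k\<le>s. b ! k) = r \<and> (\<Sum>k\<le>s. k * b ! k) = s}"

lemma finite_garland_tuples: "finite (garland_tuples r s)"
proof (rule finite_subset)
  show "garland_tuples r s \<subseteq> {b. set b \<subseteq> {..r} \<and> length b = s + 1}"
  proof safe
    fix b x assume b: "b \<in> garland_tuples r s" and "x \<in> set b"
    then obtain k where "k < length b" and x: "x = b ! k"
      by (metis in_set_conv_nth)
    then have k: "k \<le> s" using b by (simp add: garland_tuples_def)
    have "b ! k \<le> (\<Sum>k\<le>s. b ! k)"
      by (rule member_le_sum) (simp_all add: k)
    then show "x \<le> r" using b x by (simp add: garland_tuples_def)
  qed (simp add: garland_tuples_def)
  show "finite {b. set b \<subseteq> {..r} \<and> length b = s + 1}"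
    by (rule finite_lists_length_eq) simp
qed

definition garland :: "complex mat \<Rightarrow> nat \<Rightarrow> nat \<Rightarrow> complex poly mat free_alg" where
  "garland x r s =
     (\<Sum>b\<in>garland_tuples r s. prod_list (map (\<lambda>k. divpow (gen (tens x k)) (b ! k)) [0..<s + 1]))"

end

theory Submission
  imports Defs
begin

text \<open>Let \<open>K\<close> be the left ideal of \<open>U = U(\<gg>[t])\<close> generated by \<open>\<nn>\<^sup>+[t]\<close>, by the \<open>h \<otimes> t\<^sup>r\<close> with
  \<open>r \<ge> 1\<close> and by the \<open>h - \<Lambda>(h)\<close>, so that \<open>U / K\<close> is a module of Verma type, with cyclic vector \<open>v\<close>.
  Let \<open>I\<close> be the left ideal of \<open>U\<close> in the statement, which contains \<open>K\<close>, let \<open>U\<^sup>-\<close> be the enveloping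
  algebra of \<open>\<nn>\<^sup>-[t]\<close>, and let \<open>N\<close> be the left ideal of \<open>U\<^sup>-\<close> generated by the proposed elements.
  Three facts give \<open>I \<inter> U\<^sup>- = N\<close>.

  First, \<open>K \<inter> U\<^sup>- = 0\<close> (\<open>verma_ideal_Int_lower\<close>): the recursion
  \<open>A \<cdot> (x w) = x (A \<cdot> w) + [A, x] \<cdot> w\<close>, \<open>A \<cdot> 1 = A\<^sup>- + \<Lambda>(A\<^sup>0)\<close>, where \<open>A\<^sup>-\<close> is the lower triangular part of
  \<open>A\<close> and \<open>A\<^sup>0\<close> the constant term of its diagonal, makes \<open>U\<^sup>-\<close> itself a \<open>\<gg>[t]\<close>-module on which \<open>K\<close>
  annihilates \<open>1\<close> and \<open>p \<cdot> 1 = p\<close> for \<open>p\<close> in \<open>U\<^sup>-\<close>.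

  Second, \<open>N v\<close> is stable under \<open>\<gg>[t]\<close>, that is, \<open>N + K\<close> is a left ideal of \<open>U\<close>
  (\<open>lower_ideal_stable\<close>). It contains the generators of \<open>I\<close>, so \<open>I \<subseteq> N + K\<close>; and an element of
  \<open>I \<inter> U\<^sup>-\<close> differs from an element of \<open>N\<close> by one of \<open>K \<inter> U\<^sup>- = 0\<close>. Stability has to be tested only on
  generators. On a root vector \<open>x\<^sup>-\<^sub>\<alpha> \<otimes> t\<^sup>k\<close> a positive root vector produces, apart from terms
  that annihilate \<open>v\<close>, root vectors for roots below \<open>\<alpha>\<close>, with exponent at least \<open>k\<close>, and these are in \<open>N\<close>
  because \<open>\<xi>\<close> is normalized. On the
  garland \<open>x(r, s)\<close> only \<open>h \<otimes> t\<^sup>m\<close> and \<open>x\<^sub>i\<^sup>+ \<otimes> t\<^sup>m\<close> matter, the other positive root vectors being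
  in the nilradical of a parabolic subalgebra that contains \<open>x\<^sub>i\<^sup>-\<close>. With
  \<open>X(z) = \<Sum> (x\<^sub>i\<^sup>- \<otimes> t\<^sup>j) z\<^sup>j\<close>, the element \<open>x(r, s)\<close> is the coefficient of \<open>z\<^sup>s\<close> in \<open>X(z)\<^sup>r / r!\<close>, and
  commutators in \<open>\<ss>\<ll>\<^sub>2[t]\<close> give, for the operator \<open>x\<^sub>i\<^sup>+ \<otimes> t\<^sup>m\<close> on \<open>x(r + 1, s) v\<close>, the value
  \<open>[m = 0] \<Lambda>\<^sub>i x(r, s) v - (s + m - (m - 1) r) x(r, s + m) v
  - \<Sum>\<^sub>j\<^sub><\<^sub>m (m - 1 - j) (x\<^sub>i\<^sup>- \<otimes> t\<^sup>j) x(r - 1, s + m - j) v\<close>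
  (\<open>raise_garland_eval\<close>). If \<open>(r + 1) + s \<ge> 1 + \<Lambda>\<^sub>i\<close>, then the two arguments of
  each garland on the right that has a nonzero coefficient add up to at least \<open>1 + \<Lambda>\<^sub>i\<close> again: the term
  with \<open>j = m - 1\<close> is absent, and for \<open>m = 0\<close> and \<open>r + s = \<Lambda>\<^sub>i\<close> the coefficients \<open>\<Lambda>\<^sub>i\<close> and \<open>s + r\<close> of
  \<open>x(r, s)\<close> cancel.

  Third, \<open>N \<subseteq> I\<close> (\<open>lower_ideal_subset\<close>). For \<open>m = 1\<close> the formula above is
  \<open>(x\<^sub>i\<^sup>+ \<otimes> t) x(r + 1, s) v = - (s + 1) x(r, s + 1) v\<close>, so all garlands with \<open>r + s \<ge> 1 + \<Lambda>\<^sub>i\<close> arise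
  from the divided powers \<open>x(r + s, 0)\<close> of \<open>x\<^sub>i\<^sup>- \<otimes> 1\<close>; and brackets with \<open>h \<otimes> t\<^sup>m\<close> raise the exponent of
  \<open>x\<^sup>-\<^sub>\<alpha> \<otimes> t\<^bsup>\<xi>(\<alpha>)\<^esup>\<close>.

  All computations take place in free algebras, modulo left ideals that contain the defining
  relations of \<open>U\<close>; the lemma \<open>gen_left_ideal_uea_image\<close> translates to left ideals of \<open>U\<close> and \<open>U\<^sup>-\<close>.\<close>

section \<open>The free algebra\<close>

abbreviation alg :: "'a set \<Rightarrow> 'a free_alg set" where
  "alg L \<equiv> carrier (free_algebra L)"

definition word :: "'a list \<Rightarrow> 'a free_alg" where
  "word w = Poly_Mapping.single (Monomial w) 1"

lemma scalar_simps:
  "scalar 0 = 0" "scalar 1 = 1" "scalar (a + b) = scalar a + scalar b"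
  "scalar (a * b) = scalar a * scalar b" "scalar (- a) = - scalar a"
  "scalar (a - b) = scalar a - scalar b"
  by (simp_all add: scalar_def single_add mult_single single_uminus single_diff)

lemma scalar_of_nat: "scalar (of_nat k) = of_nat k"
  by (simp add: scalar_def)

lemma scalar_mult_single: "scalar c * Poly_Mapping.single w d = Poly_Mapping.single w (c * d)"
  by (simp add: scalar_def mult_single)

lemma word_Nil: "word [] = 1"
  by (simp add: word_def zero_free_monoid_def[symmetric])

lemma word_Cons: "word (x # w) = gen x * word w"
  by (simp add: word_def gen_def mult_single plus_free_monoid_def)

lemma poly_mapping_sum_single:
  "p = (\<Sum>w\<in>Poly_Mapping.keys p. Poly_Mapping.single w (Poly_Mapping.lookup p w))"
  by (rule poly_mapping_eqI)
     (auto simp: lookup_sum lookup_single when_def if_distrib sum.delta in_keys_iff cong: if_cong)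

lemma sum_words:
  "p = (\<Sum>w\<in>Poly_Mapping.keys p. scalar (Poly_Mapping.lookup p w) * word (letters w))"
  by (subst (1) poly_mapping_sum_single[of p]) (simp add: word_def scalar_mult_single)

lemma scalar_commute: "scalar c * p = p * scalar c"
proof -
  have "scalar c * p = (\<Sum>w\<in>Poly_Mapping.keys p. scalar c * Poly_Mapping.single w (Poly_Mapping.lookup p w))"
    by (subst (1) poly_mapping_sum_single[of p]) (simp add: sum_distrib_left)
  also have "\<dots> = (\<Sum>w\<in>Poly_Mapping.keys p. Poly_Mapping.single w (Poly_Mapping.lookup p w) * scalar c)"
    by (simp add: scalar_def mult_single mult.commute)
  also have "\<dots> = p * scalar c"
    by (subst (3) poly_mapping_sum_single[of p]) (simp add: sum_distrib_right)
  finally show ?thesis .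
qed

lemma scalar_left_commute: "p * (scalar c * q) = scalar c * (p * q)"
  by (metis mult.assoc scalar_commute)

lemma alg_iff: "p \<in> alg L \<longleftrightarrow> (\<forall>w\<in>Poly_Mapping.keys p. set (letters w) \<subseteq> L)"
  by (simp add: free_algebra_def)

lemma free_algebra_simps [simp]:
  "p \<otimes>\<^bsub>free_algebra L\<^esub> q = p * q" "p \<oplus>\<^bsub>free_algebra L\<^esub> q = p + q"
  "\<one>\<^bsub>free_algebra L\<^esub> = 1" "\<zero>\<^bsub>free_algebra L\<^esub> = 0"
  by (simp_all add: free_algebra_def ring_of_type_algebra_def)

lemma alg_0 [simp]: "0 \<in> alg L" and alg_1 [simp]: "1 \<in> alg L"
  and alg_scalar [simp]: "scalar c \<in> alg L"
  by (auto simp: alg_iff zero_free_monoid_def scalar_def split: if_splits)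

lemma alg_gen [simp]: "x \<in> L \<Longrightarrow> gen x \<in> alg L"
  by (auto simp: alg_iff gen_def)

lemma alg_add [simp]: "p \<in> alg L \<Longrightarrow> q \<in> alg L \<Longrightarrow> p + q \<in> alg L"
  unfolding alg_iff using keys_add[of p q] by blast

lemma alg_mult [simp]:
  assumes "p \<in> alg L" "q \<in> alg L" shows "p * q \<in> alg L"
  unfolding alg_iff
proof
  fix w assume "w \<in> Poly_Mapping.keys (p * q)"
  then obtain u v where "w = u + v" "u \<in> Poly_Mapping.keys p" "v \<in> Poly_Mapping.keys q"
    using keys_mult[of p q] by blast
  then show "set (letters w) \<subseteq> L" using assms by (auto simp: alg_iff plus_free_monoid_def)
qed

lemma alg_uminus [simp]: "p \<in> alg L \<Longrightarrow> - p \<in> alg L"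
  using alg_mult[OF alg_scalar[of "-1"], of p L] by (simp add: scalar_simps)

lemma alg_diff [simp]: "p \<in> alg L \<Longrightarrow> q \<in> alg L \<Longrightarrow> p - q \<in> alg L"
  using alg_add[of p L "- q"] by simp

lemma alg_sum: "(\<And>i. i \<in> I \<Longrightarrow> f i \<in> alg L) \<Longrightarrow> sum f I \<in> alg L"
  by (induction I rule: infinite_finite_induct) auto

lemma alg_power [simp]: "p \<in> alg L \<Longrightarrow> p ^ k \<in> alg L"
  by (induction k) auto

lemma alg_divpow [simp]: "p \<in> alg L \<Longrightarrow> divpow p k \<in> alg L"
  by (simp add: divpow_def)

lemma alg_mono: "L \<subseteq> M \<Longrightarrow> p \<in> alg L \<Longrightarrow> p \<in> alg M"
  unfolding alg_iff by blast

lemma alg_word [simp]: "set w \<subseteq> L \<Longrightarrow> word w \<in> alg L"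
  by (induction w) (auto simp: word_Nil word_Cons)

lemma alg_induct_words [consumes 1, case_names word add scalar]:
  assumes p: "p \<in> alg L"
    and word: "\<And>w. set w \<subseteq> L \<Longrightarrow> P (word w)"
    and add: "\<And>p q. p \<in> alg L \<Longrightarrow> q \<in> alg L \<Longrightarrow> P p \<Longrightarrow> P q \<Longrightarrow> P (p + q)"
    and scalar: "\<And>c p. p \<in> alg L \<Longrightarrow> P p \<Longrightarrow> P (scalar c * p)"
  shows "P p"
proof -
  have 0: "P 0" using scalar[of 1 0] word[of "[]"] by (simp add: word_Nil scalar_simps)
  have "I \<subseteq> Poly_Mapping.keys p \<Longrightarrow>
    (\<Sum>w\<in>I. scalar (Poly_Mapping.lookup p w) * word (letters w)) \<in> alg L \<and>
    P (\<Sum>w\<in>I. scalar (Poly_Mapping.lookup p w) * word (letters w))" for I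
  proof (induction I rule: infinite_finite_induct)
    case (insert w I)
    have w: "set (letters w) \<subseteq> L" using insert p by (auto simp: alg_iff)
    show ?case using insert w by (auto intro!: add scalar word)
  qed (auto intro: 0)
  from this[of "Poly_Mapping.keys p"] show ?thesis by (simp flip: sum_words)
qed

text \<open>Building words from the left, one letter at a time, is the form of induction that fits left ideals
  and actions, where a letter is moved past the first factor.\<close>

lemma alg_induct [consumes 1, case_names one add scalar gen]:
  assumes p: "p \<in> alg L"
    and one: "P 1"
    and add: "\<And>p q. p \<in> alg L \<Longrightarrow> q \<in> alg L \<Longrightarrow> P p \<Longrightarrow> P q \<Longrightarrow> P (p + q)"
    and scalar: "\<And>c p. p \<in> alg L \<Longrightarrow> P p \<Longrightarrow> P (scalar c * p)"
    and gen: "\<And>x p. x \<in> L \<Longrightarrow> p \<in> alg L \<Longrightarrow> P p \<Longrightarrow> P (gen x * p)"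
  shows "P p"
  using p
proof (induction rule: alg_induct_words)
  case (word w)
  then show ?case by (induction w) (auto simp: word_Nil word_Cons intro: one gen)
qed (auto intro: add scalar)

definition linear_extension :: "('a list \<Rightarrow> 'b free_alg) \<Rightarrow> 'a free_alg \<Rightarrow> 'b free_alg" where
  "linear_extension f p = (\<Sum>w\<in>Poly_Mapping.keys p. scalar (Poly_Mapping.lookup p w) * f (letters w))"

lemma linear_extension_superset:
  assumes "finite I" "Poly_Mapping.keys p \<subseteq> I"
  shows "linear_extension f p = (\<Sum>w\<in>I. scalar (Poly_Mapping.lookup p w) * f (letters w))"
  unfolding linear_extension_def
  by (rule sum.mono_neutral_left) (use assms in \<open>auto simp: in_keys_iff scalar_simps\<close>)

lemma linear_extension_add: "linear_extension f (p + q) = linear_extension f p + linear_extension f q"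
proof -
  let ?I = "Poly_Mapping.keys p \<union> Poly_Mapping.keys q"
  show ?thesis
    using keys_add[of p q]
    by (simp add: linear_extension_superset[of ?I] lookup_add scalar_simps distrib_right sum.distrib)
qed

lemma lookup_scalar_mult: "Poly_Mapping.lookup (scalar c * p) w = c * Poly_Mapping.lookup p w"
  unfolding scalar_def
  by (simp add: mult_map_scale_conv_mult[symmetric] Poly_Mapping.map.rep_eq when_def)

lemma linear_extension_scalar: "linear_extension f (scalar c * p) = scalar c * linear_extension f p"
proof -
  have "Poly_Mapping.keys (scalar c * p) \<subseteq> Poly_Mapping.keys p"
    by (auto simp: in_keys_iff lookup_scalar_mult)
  then show ?thesis
    by (simp add: linear_extension_superset[of "Poly_Mapping.keys p"] lookup_scalar_mult scalar_simps
        sum_distrib_left mult.assoc)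
qed

lemma linear_extension_word: "linear_extension f (word w) = f w"
  by (simp add: linear_extension_def word_def scalar_simps)

lemma linear_extension_uminus: "linear_extension f (- p) = - linear_extension f p"
  using linear_extension_scalar[of f "-1" p] by (simp add: scalar_simps)

lemma linear_extension_diff: "linear_extension f (p - q) = linear_extension f p - linear_extension f q"
  using linear_extension_add[of f p "- q"] by (simp add: linear_extension_uminus)

section \<open>The ideal of relations of an enveloping algebra\<close>

lemma ring_free_algebra: "ring (free_algebra L)"
proof (rule ringI)
  show "abelian_group (free_algebra L)"
  proof (rule abelian_groupI)
    fix x assume "x \<in> alg L"
    then show "\<exists>y\<in>alg L. y \<oplus>\<^bsub>free_algebra L\<^esub> x = \<zero>\<^bsub>free_algebra L\<^esub>"
      by (intro bexI[of _ "- x"]) auto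
  qed (auto simp: algebra_simps)
  show "Group.monoid (free_algebra L)"
    by (rule Group.monoidI) (auto simp: mult.assoc)
qed (auto simp: algebra_simps)

lemma a_inv_free_algebra: "x \<in> alg L \<Longrightarrow> \<ominus>\<^bsub>free_algebra L\<^esub> x = - x"
proof -
  interpret ring "free_algebra L" by (rule ring_free_algebra)
  assume "x \<in> alg L"
  then show ?thesis using minus_equality[of "-x" x] by simp
qed

text \<open>Negatives are multiples by the scalar \<open>-1\<close>, so closure under them follows from closure under
  multiplication.\<close>

lemma ideal_free_algebra_iff: "ideal I (free_algebra L) \<longleftrightarrow>
  I \<subseteq> alg L \<and> 0 \<in> I \<and> (\<forall>p\<in>I. \<forall>q\<in>I. p + q \<in> I) \<and>
  (\<forall>p\<in>I. \<forall>u\<in>alg L. u * p \<in> I \<and> p * u \<in> I)" (is "?A \<longleftrightarrow> ?B")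
proof
  assume ?A
  interpret ideal I "free_algebra L" by fact
  have "0 \<in> I" using additive_subgroup.zero_closed[OF is_additive_subgroup] by simp
  moreover have "p + q \<in> I" if "p \<in> I" "q \<in> I" for p q
    using additive_subgroup.a_closed[OF is_additive_subgroup that] by simp
  moreover have "u * p \<in> I \<and> p * u \<in> I" if "p \<in> I" "u \<in> alg L" for p u
    using I_l_closed[OF that] I_r_closed[OF that] by simp
  ultimately show ?B using a_subset by blast
next
  assume B: ?B
  show ?A
  proof (rule idealI[OF ring_free_algebra])
    interpret ring "free_algebra L" by (rule ring_free_algebra)
    show "subgroup I (add_monoid (free_algebra L))"
    proof
      fix x assume x: "x \<in> I"
      then have "inv\<^bsub>add_monoid (free_algebra L)\<^esub> x = - x"
        using B a_inv_free_algebra[of x L] by (auto simp: a_inv_def)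
      moreover have "scalar (-1) * x \<in> I" using B x by (meson alg_scalar)
      ultimately show "inv\<^bsub>add_monoid (free_algebra L)\<^esub> x \<in> I"
        by (simp add: scalar_simps)
    qed (use B in auto)
  qed (use B in auto)
qed

lemma uea_rels_alg:
  assumes "\<And>x y. x \<in> L \<Longrightarrow> y \<in> L \<Longrightarrow> x + y \<in> L" "\<And>c x. x \<in> L \<Longrightarrow> [:c:] \<cdot>\<^sub>m x \<in> L"
    "\<And>x y. x \<in> L \<Longrightarrow> y \<in> L \<Longrightarrow> bracket x y \<in> L"
  shows "uea_rels L \<subseteq> alg L"
proof
  fix p assume "p \<in> uea_rels L"
  then consider x y where "p = gen (x + y) - gen x - gen y" "x \<in> L" "y \<in> L"
    | c x where "p = gen ([:c:] \<cdot>\<^sub>m x) - scalar c * gen x" "x \<in> L"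
    | x y where "p = gen x * gen y - gen y * gen x - gen (bracket x y)" "x \<in> L" "y \<in> L"
    unfolding uea_rels_def by blast
  then show "p \<in> alg L" using assms by cases simp_all
qed

text \<open>Closure of \<open>L\<close> puts the relations \<open>uea_rels L\<close> into the free algebra on \<open>L\<close>, so that they generate an
  ideal there.\<close>

locale lie_algebra_set =
  fixes L :: "complex poly mat set"
  assumes L_add: "\<And>x y. x \<in> L \<Longrightarrow> y \<in> L \<Longrightarrow> x + y \<in> L"
    and L_smult: "\<And>c x. x \<in> L \<Longrightarrow> [:c:] \<cdot>\<^sub>m x \<in> L"
    and L_bracket: "\<And>x y. x \<in> L \<Longrightarrow> y \<in> L \<Longrightarrow> bracket x y \<in> L"
begin

lemma rels_subset: "uea_rels L \<subseteq> alg L"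
  by (rule uea_rels_alg) (fact L_add L_smult L_bracket)+

lemma uea_ideal_ideal: "ideal (uea_ideal L) (free_algebra L)"
  unfolding uea_ideal_def using ring.genideal_ideal[OF ring_free_algebra rels_subset] .

lemma uea_ideal_alg: "p \<in> uea_ideal L \<Longrightarrow> p \<in> alg L"
  and uea_ideal_0: "0 \<in> uea_ideal L"
  and uea_ideal_add: "p \<in> uea_ideal L \<Longrightarrow> q \<in> uea_ideal L \<Longrightarrow> p + q \<in> uea_ideal L"
  and uea_ideal_left: "u \<in> alg L \<Longrightarrow> p \<in> uea_ideal L \<Longrightarrow> u * p \<in> uea_ideal L"
  and uea_ideal_right: "p \<in> uea_ideal L \<Longrightarrow> u \<in> alg L \<Longrightarrow> p * u \<in> uea_ideal L"
proof -
  note I = uea_ideal_ideal[unfolded ideal_free_algebra_iff]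
  show "p \<in> uea_ideal L \<Longrightarrow> p \<in> alg L" and "0 \<in> uea_ideal L" using I by auto
  show "p \<in> uea_ideal L \<Longrightarrow> q \<in> uea_ideal L \<Longrightarrow> p + q \<in> uea_ideal L"
    and "u \<in> alg L \<Longrightarrow> p \<in> uea_ideal L \<Longrightarrow> u * p \<in> uea_ideal L"
    and "p \<in> uea_ideal L \<Longrightarrow> u \<in> alg L \<Longrightarrow> p * u \<in> uea_ideal L" using I by simp_all
qed

lemma uea_ideal_uminus: "p \<in> uea_ideal L \<Longrightarrow> - p \<in> uea_ideal L"
  using uea_ideal_left[OF alg_scalar[of "-1"], of p] by (simp add: scalar_simps)

lemma uea_ideal_diff: "p \<in> uea_ideal L \<Longrightarrow> q \<in> uea_ideal L \<Longrightarrow> p - q \<in> uea_ideal L"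
  using uea_ideal_add[of p "-q"] uea_ideal_uminus[of q] by simp

lemma uea_ideal_rels: "p \<in> uea_rels L \<Longrightarrow> p \<in> uea_ideal L"
  unfolding uea_ideal_def using ring.genideal_self[OF ring_free_algebra rels_subset] by blast

lemma uea_rel_add: "x \<in> L \<Longrightarrow> y \<in> L \<Longrightarrow> gen (x + y) - gen x - gen y \<in> uea_ideal L"
  and uea_rel_smult: "x \<in> L \<Longrightarrow> gen ([:c:] \<cdot>\<^sub>m x) - scalar c * gen x \<in> uea_ideal L"
  and uea_rel_bracket: "x \<in> L \<Longrightarrow> y \<in> L \<Longrightarrow>
    gen x * gen y - gen y * gen x - gen (bracket x y) \<in> uea_ideal L"
  by (rule uea_ideal_rels; unfold uea_rels_def; blast)+

lemma uea_ideal_subset: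
  assumes "ideal Q (free_algebra L)"
    and "\<And>x y. x \<in> L \<Longrightarrow> y \<in> L \<Longrightarrow> gen (x + y) - gen x - gen y \<in> Q"
    and "\<And>c x. x \<in> L \<Longrightarrow> gen ([:c:] \<cdot>\<^sub>m x) - scalar c * gen x \<in> Q"
    and "\<And>x y. x \<in> L \<Longrightarrow> y \<in> L \<Longrightarrow> gen x * gen y - gen y * gen x - gen (bracket x y) \<in> Q"
  shows "uea_ideal L \<subseteq> Q"
  unfolding uea_ideal_def
  by (rule ring.genideal_minimal[OF ring_free_algebra assms(1)])
     (use assms in \<open>auto simp: uea_rels_def\<close>)

lemma uea_ideal_induct [consumes 1, case_names zero add left right rel_add rel_smult rel_bracket]:
  assumes p: "p \<in> uea_ideal L"
    and zero: "P 0"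
    and add: "\<And>p q. p \<in> uea_ideal L \<Longrightarrow> q \<in> uea_ideal L \<Longrightarrow> P p \<Longrightarrow> P q \<Longrightarrow> P (p + q)"
    and left: "\<And>u p. u \<in> alg L \<Longrightarrow> p \<in> uea_ideal L \<Longrightarrow> P p \<Longrightarrow> P (u * p)"
    and right: "\<And>u p. u \<in> alg L \<Longrightarrow> p \<in> uea_ideal L \<Longrightarrow> P p \<Longrightarrow> P (p * u)"
    and rel_add: "\<And>x y. x \<in> L \<Longrightarrow> y \<in> L \<Longrightarrow> P (gen (x + y) - gen x - gen y)"
    and rel_smult: "\<And>c x. x \<in> L \<Longrightarrow> P (gen ([:c:] \<cdot>\<^sub>m x) - scalar c * gen x)"
    and rel_bracket: "\<And>x y. x \<in> L \<Longrightarrow> y \<in> L \<Longrightarrow>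
      P (gen x * gen y - gen y * gen x - gen (bracket x y))"
  shows "P p"
proof -
  let ?Q = "{p \<in> uea_ideal L. P p}"
  have "ideal ?Q (free_algebra L)"
    unfolding ideal_free_algebra_iff
    using uea_ideal_alg uea_ideal_0 uea_ideal_add uea_ideal_left uea_ideal_right zero add left right
    by auto
  then have "uea_ideal L \<subseteq> ?Q"
    by (rule uea_ideal_subset) (auto intro: uea_rel_add uea_rel_smult uea_rel_bracket rel_add rel_smult rel_bracket)
  with p show ?thesis by blast
qed

end

lemma uea_ideal_mono:
  assumes "lie_algebra_set L" "lie_algebra_set M" "L \<subseteq> M"
  shows "uea_ideal L \<subseteq> uea_ideal M"
proof
  fix p assume "p \<in> uea_ideal L"
  interpret L: lie_algebra_set L by fact
  interpret M: lie_algebra_set M by fact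
  show "p \<in> uea_ideal M"
    using \<open>p \<in> uea_ideal L\<close>
  proof (induction rule: L.uea_ideal_induct)
    case (left u p) then show ?case by (auto intro: M.uea_ideal_left alg_mono[OF assms(3)])
  next
    case (right u p) then show ?case by (auto intro: M.uea_ideal_right alg_mono[OF assms(3)])
  qed (use assms(3) in \<open>auto intro: M.uea_ideal_0 M.uea_ideal_add M.uea_rel_add M.uea_rel_smult
       M.uea_rel_bracket\<close>)
qed

section \<open>Left ideals of an enveloping algebra\<close>

text \<open>The left submodule spanned by \<open>W\<close> in the ambient ring over a set \<open>B\<close> of multipliers, in a form that
  comes with an induction rule. Taking \<open>B\<close> to be the free algebra on a smaller alphabet gives the left ideals
  of \<open>U\<^sup>-\<close>.\<close>

inductive_set left_span :: "'r::ring_1 set \<Rightarrow> 'r set \<Rightarrow> 'r set" for B W where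
  zero: "0 \<in> left_span B W"
| base: "w \<in> W \<Longrightarrow> w \<in> left_span B W"
| add: "p \<in> left_span B W \<Longrightarrow> q \<in> left_span B W \<Longrightarrow> p + q \<in> left_span B W"
| mult: "u \<in> B \<Longrightarrow> p \<in> left_span B W \<Longrightarrow> u * p \<in> left_span B W"

lemma left_span_alg: "W \<subseteq> alg L \<Longrightarrow> p \<in> left_span (alg L) W \<Longrightarrow> p \<in> alg L"
  by (rotate_tac, induction rule: left_span.induct) auto

lemma left_span_scalar: "p \<in> left_span (alg L) W \<Longrightarrow> scalar c * p \<in> left_span (alg L) W"
  by (rule left_span.mult) auto

lemma left_span_uminus: "p \<in> left_span (alg L) W \<Longrightarrow> - p \<in> left_span (alg L) W"
  using left_span_scalar[of p L W "-1"] by (simp add: scalar_simps)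

lemma left_span_diff:
  "p \<in> left_span (alg L) W \<Longrightarrow> q \<in> left_span (alg L) W \<Longrightarrow> p - q \<in> left_span (alg L) W"
  using left_span.add[of p _ _ "-q"] left_span_uminus[of q] by simp

text \<open>The image of \<open>U(L)\<close> in \<open>U(M)\<close>, described by classes of elements of the free algebra on \<open>L\<close>; both
  \<open>U(M)\<close> and its subalgebra \<open>uea_sub L M\<close> are of this form, so that their left ideals can be treated
  together.\<close>

definition uea_image ::
  "complex poly mat set \<Rightarrow> complex poly mat set \<Rightarrow> complex poly mat free_alg set ring" where
  "uea_image L M = (uea M)\<lparr>carrier := uea_class M ` alg L\<rparr>"

lemma coset_free_algebra: "I +>\<^bsub>free_algebra L\<^esub> p = (\<lambda>i. i + p) ` I"
  by (auto simp: a_r_coset_def r_coset_def)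

lemma carrier_uea: "carrier (uea L) = uea_class L ` alg L"
  by (auto simp: uea_def uea_class_def FactRing_def A_RCOSETS_defs a_r_coset_def)

lemma uea_eq_uea_image: "uea M = uea_image M M"
  unfolding uea_image_def carrier_uea[symmetric] by simp

locale lie_subalgebra_set = M: lie_algebra_set M + L: lie_algebra_set L
  for M L :: "complex poly mat set" +
  assumes L_M: "L \<subseteq> M"
begin

lemma uea_sub_eq_uea_image: "uea_sub L M = uea_image L M"
proof -
  have "set_add (free_algebra M) (uea_ideal M) (uea_class L p) = uea_class M p" for p
  proof -
    have "uea_ideal M <+>\<^bsub>free_algebra M\<^esub> ((\<lambda>i. i + p) ` uea_ideal L) = (\<lambda>i. i + p) ` uea_ideal M"
      (is "?A = ?B")
    proof
      have IL: "i \<in> uea_ideal L \<Longrightarrow> i \<in> uea_ideal M" for i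
        using uea_ideal_mono[OF L.lie_algebra_set_axioms M.lie_algebra_set_axioms L_M] by blast
      show "?A \<subseteq> ?B"
      proof
        fix x assume "x \<in> ?A"
        then obtain i j where "i \<in> uea_ideal M" "j \<in> uea_ideal L" "x = i + (j + p)"
          by (auto simp: set_add_def set_mult_def)
        then show "x \<in> ?B" using M.uea_ideal_add[OF _ IL] by (auto simp: add.assoc[symmetric])
      qed
      show "?B \<subseteq> ?A"
        using L.uea_ideal_0 by (force simp: set_add_def set_mult_def)
    qed
    then show ?thesis by (simp add: uea_class_def coset_free_algebra)
  qed
  then show ?thesis
    by (simp add: uea_sub_def uea_image_def carrier_uea image_image)
qed

lemma uea_class_hom:
  assumes "p \<in> alg M" "q \<in> alg M"
  shows "uea_class M p \<oplus>\<^bsub>uea_image L M\<^esub> uea_class M q = uea_class M (p + q)"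
    "uea_class M p \<otimes>\<^bsub>uea_image L M\<^esub> uea_class M q = uea_class M (p * q)"
proof -
  note hom = ideal.rcos_ring_hom[OF M.uea_ideal_ideal]
  show "uea_class M p \<oplus>\<^bsub>uea_image L M\<^esub> uea_class M q = uea_class M (p + q)"
    "uea_class M p \<otimes>\<^bsub>uea_image L M\<^esub> uea_class M q = uea_class M (p * q)"
    using ring_hom_add[OF hom, of p q] ring_hom_mult[OF hom, of p q] assms
    by (simp_all add: uea_class_def uea_image_def uea_def)
qed

lemma uea_class_zero: "\<zero>\<^bsub>uea_image L M\<^esub> = uea_class M 0"
  by (simp add: uea_image_def uea_def FactRing_def uea_class_def coset_free_algebra)

lemma uea_class_eq_iff: "uea_class M p = uea_class M q \<longleftrightarrow> p - q \<in> uea_ideal M"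
proof
  assume "uea_class M p = uea_class M q"
  moreover have "p \<in> uea_class M p" using M.uea_ideal_0
    by (force simp: uea_class_def coset_free_algebra)
  ultimately show "p - q \<in> uea_ideal M" by (auto simp: uea_class_def coset_free_algebra)
next
  assume *: "p - q \<in> uea_ideal M"
  have "x + p \<in> (\<lambda>i. i + q) ` uea_ideal M" if "x \<in> uea_ideal M" for x
    by (rule image_eqI[of _ _ "x + (p - q)"]) (use * that M.uea_ideal_add in auto)
  moreover have "x + q \<in> (\<lambda>i. i + p) ` uea_ideal M" if "x \<in> uea_ideal M" for x
    by (rule image_eqI[of _ _ "x - (p - q)"]) (use * that M.uea_ideal_diff in auto)
  ultimately show "uea_class M p = uea_class M q"
    by (auto simp: uea_class_def coset_free_algebra)
qed

lemma alg_LM: "p \<in> alg L \<Longrightarrow> p \<in> alg M"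
  using alg_mono[OF L_M] .

lemma left_ideal_closed:
  assumes I: "left_ideal I (uea_image L M)"
  shows "I \<subseteq> uea_class M ` alg L" "uea_class M 0 \<in> I"
    and "p \<in> alg L \<Longrightarrow> q \<in> alg L \<Longrightarrow> uea_class M p \<in> I \<Longrightarrow> uea_class M q \<in> I \<Longrightarrow>
      uea_class M (p + q) \<in> I"
    and "u \<in> alg L \<Longrightarrow> p \<in> alg L \<Longrightarrow> uea_class M p \<in> I \<Longrightarrow> uea_class M (u * p) \<in> I"
proof -
  interpret additive_subgroup I "uea_image L M"
    using I by (simp add: left_ideal_def)
  show "I \<subseteq> uea_class M ` alg L" using a_subset by (simp add: uea_image_def)
  show "uea_class M 0 \<in> I" using zero_closed by (simp add: uea_class_zero)
  show "uea_class M (p + q) \<in> I" if "p \<in> alg L" "q \<in> alg L" "uea_class M p \<in> I" "uea_class M q \<in> I"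
    using a_closed[OF that(3,4)] that(1,2) by (simp add: uea_class_hom alg_LM)
  show "uea_class M (u * p) \<in> I" if "u \<in> alg L" "p \<in> alg L" "uea_class M p \<in> I"
  proof -
    have "uea_class M u \<in> carrier (uea_image L M)" using that by (simp add: uea_image_def)
    with I that have "uea_class M u \<otimes>\<^bsub>uea_image L M\<^esub> uea_class M p \<in> I"
      by (simp add: left_ideal_def)
    with that show ?thesis by (simp add: uea_class_hom alg_LM)
  qed
qed

lemma left_idealI:
  assumes "P \<subseteq> alg L" "0 \<in> P" "\<And>p q. p \<in> P \<Longrightarrow> q \<in> P \<Longrightarrow> p + q \<in> P"
    "\<And>u p. u \<in> alg L \<Longrightarrow> p \<in> P \<Longrightarrow> u * p \<in> P"
  shows "left_ideal (uea_class M ` P) (uea_image L M)"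
proof -
  let ?U = "uea_image L M"
  have PM: "p \<in> P \<Longrightarrow> p \<in> alg L" "p \<in> P \<Longrightarrow> p \<in> alg M" for p using assms(1) alg_LM by auto
  have "subgroup (uea_class M ` P) (add_monoid ?U)"
  proof
    show "uea_class M ` P \<subseteq> carrier (add_monoid ?U)"
      using assms(1) by (auto simp: uea_image_def)
    fix x assume "x \<in> uea_class M ` P"
    then obtain p where p: "p \<in> P" "x = uea_class M p" by blast
    have "scalar (-1) * p \<in> P" using assms(4) p by simp
    then have mp: "- p \<in> P" by (simp add: scalar_simps)
    have "inv\<^bsub>add_monoid ?U\<^esub> x = uea_class M (- p)"
      unfolding m_inv_def
    proof (rule the_equality)
      show "uea_class M (- p) \<in> carrier (add_monoid ?U) \<and>
        x \<otimes>\<^bsub>add_monoid ?U\<^esub> uea_class M (- p) = \<one>\<^bsub>add_monoid ?U\<^esub> \<and>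
        uea_class M (- p) \<otimes>\<^bsub>add_monoid ?U\<^esub> x = \<one>\<^bsub>add_monoid ?U\<^esub>"
        using p mp PM by (simp add: uea_class_hom uea_class_zero) (simp add: uea_image_def)
    next
      fix y assume y: "y \<in> carrier (add_monoid ?U) \<and>
        x \<otimes>\<^bsub>add_monoid ?U\<^esub> y = \<one>\<^bsub>add_monoid ?U\<^esub> \<and> y \<otimes>\<^bsub>add_monoid ?U\<^esub> x = \<one>\<^bsub>add_monoid ?U\<^esub>"
      then obtain q where q: "q \<in> alg L" "y = uea_class M q" by (auto simp: uea_image_def)
      with y p PM have "uea_class M (q + p) = uea_class M 0"
        by (simp add: uea_class_hom uea_class_zero alg_LM)
      then show "y = uea_class M (- p)" by (simp add: q uea_class_eq_iff)
    qed
    then show "inv\<^bsub>add_monoid ?U\<^esub> x \<in> uea_class M ` P" using mp by simp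
  next
    fix x y assume "x \<in> uea_class M ` P" "y \<in> uea_class M ` P"
    then show "x \<otimes>\<^bsub>add_monoid ?U\<^esub> y \<in> uea_class M ` P"
      using PM assms(3) by (auto simp: uea_class_hom)
  next
    show "\<one>\<^bsub>add_monoid ?U\<^esub> \<in> uea_class M ` P" using assms(2) by (simp add: uea_class_zero)
  qed
  moreover have "\<forall>a\<in>carrier ?U. \<forall>x\<in>uea_class M ` P. a \<otimes>\<^bsub>?U\<^esub> x \<in> uea_class M ` P"
  proof (intro ballI)
    fix a x assume "a \<in> carrier ?U" "x \<in> uea_class M ` P"
    then obtain u p where "u \<in> alg L" "p \<in> P" "a = uea_class M u" "x = uea_class M p"
      by (auto simp: uea_image_def)
    then show "a \<otimes>\<^bsub>?U\<^esub> x \<in> uea_class M ` P"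
      using PM assms(4) by (simp add: uea_class_hom alg_LM)
  qed
  ultimately show ?thesis by (simp add: left_ideal_def additive_subgroup_def)
qed

lemma uea_class_gen_left_ideal_iff:
  assumes W: "W \<subseteq> alg L" and p: "p \<in> alg L"
  shows "uea_class M p \<in> gen_left_ideal (uea_image L M) (uea_class M ` W) \<longleftrightarrow>
    p \<in> left_span (alg L) (W \<union> (uea_ideal M \<inter> alg L))" (is "?lhs \<longleftrightarrow> ?rhs")
proof
  let ?S = "left_span (alg L) (W \<union> (uea_ideal M \<inter> alg L))"
  have W': "W \<union> (uea_ideal M \<inter> alg L) \<subseteq> alg L" using W by blast
  assume ?lhs
  moreover have "left_ideal (uea_class M ` ?S) (uea_image L M)"
    using left_span_alg[OF W'] by (intro left_idealI) (auto intro: left_span.intros)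
  moreover have "uea_class M ` W \<subseteq> uea_class M ` ?S" by (auto intro: left_span.base)
  ultimately have "uea_class M p \<in> uea_class M ` ?S" unfolding gen_left_ideal_def by blast
  then obtain q where q: "q \<in> ?S" "p - q \<in> uea_ideal M" by (auto simp: uea_class_eq_iff)
  then have "p - q \<in> ?S" using p left_span_alg[OF W' q(1)] by (auto intro: left_span.base)
  with left_span.add[OF this q(1)] show ?rhs by simp
next
  assume ?rhs
  then have "uea_class M p \<in> I" if I: "left_ideal I (uea_image L M)" "uea_class M ` W \<subseteq> I" for I
  proof -
    from \<open>?rhs\<close> have "p \<in> alg L \<and> uea_class M p \<in> I"
    proof (induction rule: left_span.induct)
      case (base w)
      then consider "w \<in> W" | "w \<in> uea_ideal M" "w \<in> alg L" by blast
      then show ?case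
      proof cases
        case 2
        then have "uea_class M w = uea_class M 0" by (simp add: uea_class_eq_iff)
        with 2 left_ideal_closed(2)[OF I(1)] show ?thesis by simp
      qed (use W I in auto)
    qed (use left_ideal_closed[OF I(1)] in auto)
    then show ?thesis by blast
  qed
  then show ?lhs unfolding gen_left_ideal_def by blast
qed

text \<open>Left ideals of the image of \<open>U(L)\<close> in \<open>U(M)\<close> correspond to left ideals of the free algebra on \<open>L\<close>
  that contain all elements with class zero in \<open>U(M)\<close>.\<close>

lemma gen_left_ideal_uea_image:
  assumes W: "W \<subseteq> alg L"
  shows "gen_left_ideal (uea_image L M) (uea_class M ` W) =
    uea_class M ` left_span (alg L) (W \<union> (uea_ideal M \<inter> alg L))" (is "?G = uea_class M ` ?S")
proof -
  have "left_ideal (uea_class M ` alg L) (uea_image L M)" by (rule left_idealI) auto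
  then have "?G \<subseteq> uea_class M ` alg L" using W unfolding gen_left_ideal_def by blast
  moreover have "?S \<subseteq> alg L" using left_span_alg[of "W \<union> (uea_ideal M \<inter> alg L)" L] W by blast
  ultimately show ?thesis using uea_class_gen_left_ideal_iff[OF W] by blast
qed

end

section \<open>The recursion for garland elements\<close>

text \<open>Integer degrees make the recursions below free of side conditions: there are no tuples for negative
  \<open>r\<close> or \<open>s\<close>. The length \<open>l\<close> is independent of \<open>s\<close> to allow induction over it.\<close>

definition weighted_tuples :: "nat \<Rightarrow> int \<Rightarrow> int \<Rightarrow> nat list set" where
  "weighted_tuples l r s =
     {b. length b = l \<and> (\<Sum>k<l. int (b ! k)) = r \<and> (\<Sum>k<l. int k * int (b ! k)) = s}"

definition partial_garland :: "(nat \<Rightarrow> 'a free_alg) \<Rightarrow> nat \<Rightarrow> int \<Rightarrow> int \<Rightarrow> 'a free_alg" where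
  "partial_garland x l r s =
     (\<Sum>b\<in>weighted_tuples l r s. prod_list (map (\<lambda>k. divpow (x k) (b ! k)) [0..<l]))"

lemma garland_eq_partial:
  "garland y r s = partial_garland (\<lambda>k. gen (tens y k)) (Suc s) (int r) (int s)"
proof -
  have "garland_tuples r s = weighted_tuples (Suc s) (int r) (int s)"
    unfolding garland_tuples_def weighted_tuples_def
  proof (rule Collect_cong)
    fix b :: "nat list"
    have "(\<Sum>k<Suc s. int (b ! k)) = int r \<longleftrightarrow> (\<Sum>k\<le>s. b ! k) = r"
      unfolding lessThan_Suc_atMost of_nat_sum[symmetric] by (rule of_nat_eq_iff)
    moreover have "(\<Sum>k<Suc s. int k * int (b ! k)) = int s \<longleftrightarrow> (\<Sum>k\<le>s. k * b ! k) = s"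
      unfolding lessThan_Suc_atMost of_nat_mult[symmetric] of_nat_sum[symmetric]
      by (rule of_nat_eq_iff)
    ultimately show "(length b = s + 1 \<and> (\<Sum>k\<le>s. b ! k) = r \<and> (\<Sum>k\<le>s. k * b ! k) = s) \<longleftrightarrow>
      (length b = Suc s \<and> (\<Sum>k<Suc s. int (b ! k)) = int r \<and>
       (\<Sum>k<Suc s. int k * int (b ! k)) = int s)" by simp
  qed
  then show ?thesis by (simp add: garland_def partial_garland_def)
qed

lemma weighted_tuples_neg:
  assumes "r < 0 \<or> s < 0"
  shows "weighted_tuples l r s = {}"
proof (rule equals0I)
  fix b assume "b \<in> weighted_tuples l r s"
  then have "(\<Sum>k<l. int (b ! k)) = r" "(\<Sum>k<l. int k * int (b ! k)) = s"
    by (auto simp: weighted_tuples_def)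
  moreover have "0 \<le> (\<Sum>k<l. int (b ! k))" "0 \<le> (\<Sum>k<l. int k * int (b ! k))"
    by (simp_all add: sum_nonneg)
  ultimately show False using assms by linarith
qed

lemma finite_weighted_tuples: "finite (weighted_tuples l r s)"
proof (rule finite_subset)
  show "weighted_tuples l r s \<subseteq> {b. set b \<subseteq> {..nat r} \<and> length b = l}"
  proof (safe)
    fix b x assume b: "b \<in> weighted_tuples l r s" and "x \<in> set b"
    then obtain k where k: "k < length b" and x: "x = b ! k" by (metis in_set_conv_nth)
    have "int (b ! k) \<le> (\<Sum>k<length b. int (b ! k))"
      by (rule member_le_sum) (use k in auto)
    then show "x \<le> nat r" using b x by (simp add: weighted_tuples_def)
  qed (simp add: weighted_tuples_def)
  show "finite {b. set b \<subseteq> {..nat r} \<and> length b = l}"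
    by (rule finite_lists_length_eq) simp
qed

lemma partial_garland_neg: "r < 0 \<or> s < 0 \<Longrightarrow> partial_garland x l r s = 0"
  unfolding partial_garland_def by (subst weighted_tuples_neg) auto

lemma partial_garland_0: "partial_garland x 0 r s = (if r = 0 \<and> s = 0 then 1 else 0)"
  by (auto simp: partial_garland_def weighted_tuples_def)

lemma weighted_tuples_Suc:
  assumes "r \<le> int M"
  shows "weighted_tuples (Suc l) r s =
    (\<lambda>(c, b). b @ [c]) ` (SIGMA c:{..M}. weighted_tuples l (r - int c) (s - int l * int c))"
proof (intro equalityI subsetI)
  fix b assume b: "b \<in> weighted_tuples (Suc l) r s"
  then have len: "length b = Suc l" by (simp add: weighted_tuples_def)
  then have eq: "b = butlast b @ [b ! l]"
    by (metis append_butlast_last_id diff_Suc_1 last_conv_nth length_0_conv nat.simps(3))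
  have nth: "k < l \<Longrightarrow> butlast b ! k = b ! k" for k using len by (simp add: nth_butlast)
  have sums: "(\<Sum>k<l. int (b ! k)) = r - int (b ! l)"
    "(\<Sum>k<l. int k * int (b ! k)) = s - int l * int (b ! l)"
    using b by (simp_all add: weighted_tuples_def)
  have "0 \<le> (\<Sum>k<l. int (b ! k))" by (rule sum_nonneg) simp
  with sums assms have "b ! l \<le> M" by simp
  then have "(b ! l, butlast b) \<in>
    (SIGMA c:{..M}. weighted_tuples l (r - int c) (s - int l * int c))"
    using len sums by (simp add: weighted_tuples_def nth)
  then show "b \<in> (\<lambda>(c, b). b @ [c]) `
    (SIGMA c:{..M}. weighted_tuples l (r - int c) (s - int l * int c))"
    by (rule rev_image_eqI) (use eq in simp)
qed (auto simp: weighted_tuples_def nth_append)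

text \<open>The last entry \<open>c\<close> of a tuple is split off; any bound \<open>M \<ge> r\<close> on it may be used.\<close>

lemma partial_garland_Suc:
  assumes "r \<le> int M"
  shows "partial_garland x (Suc l) r s =
    (\<Sum>c\<le>M. partial_garland x l (r - int c) (s - int l * int c) * divpow (x l) c)"
proof -
  have inj: "inj_on (\<lambda>(c, b). b @ [c]) A" for A :: "(nat \<times> nat list) set"
    by (auto simp: inj_on_def)
  have pl: "prod_list (map (\<lambda>k. divpow (x k) ((b @ [c]) ! k)) [0..<Suc l]) =
      prod_list (map (\<lambda>k. divpow (x k) (b ! k)) [0..<l]) * divpow (x l) c"
    if "b \<in> weighted_tuples l r' s'" for b c r' s'
  proof -
    have "length b = l" using that by (simp add: weighted_tuples_def)
    then have "map (\<lambda>k. divpow (x k) ((b @ [c]) ! k)) [0..<l] =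
      map (\<lambda>k. divpow (x k) (b ! k)) [0..<l]" by (auto simp: nth_append)
    moreover have "(b @ [c]) ! l = c" using \<open>length b = l\<close> by (metis nth_append_length)
    moreover have "[0..<Suc l] = [0..<l] @ [l]" by simp
    ultimately show ?thesis by (simp only: map_append prod_list.append) simp
  qed
  have "partial_garland x (Suc l) r s =
    (\<Sum>(c, b)\<in>(SIGMA c:{..M}. weighted_tuples l (r - int c) (s - int l * int c)).
       prod_list (map (\<lambda>k. divpow (x k) ((b @ [c]) ! k)) [0..<Suc l]))"
    unfolding partial_garland_def weighted_tuples_Suc[OF assms] sum.reindex[OF inj]
    by (simp add: case_prod_unfold comp_def)
  also have "\<dots> = (\<Sum>(c, b)\<in>(SIGMA c:{..M}. weighted_tuples l (r - int c) (s - int l * int c)).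
       prod_list (map (\<lambda>k. divpow (x k) (b ! k)) [0..<l]) * divpow (x l) c)"
    by (rule sum.cong) (auto simp: pl simp del: upt_Suc)
  also have "\<dots> = (\<Sum>c\<le>M. partial_garland x l (r - int c) (s - int l * int c) * divpow (x l) c)"
    by (subst sum.Sigma[symmetric])
       (auto simp: finite_weighted_tuples partial_garland_def sum_distrib_right)
  finally show ?thesis .
qed

lemma divpow_0: "divpow p 0 = 1"
  by (simp add: divpow_def scalar_simps)

lemma divpow_Suc: "of_nat (Suc b) * divpow p (Suc b) = p * divpow p b"
proof -
  have "of_nat (Suc b) * divpow p (Suc b) =
    (of_nat (Suc b) * scalar (1 / fact (Suc b))) * (p * p ^ b)"
    by (simp only: divpow_def power_Suc mult.assoc)
  also have "of_nat (Suc b) * scalar (1 / fact (Suc b)) = scalar (1 / fact b)"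
    unfolding scalar_of_nat[symmetric] scalar_simps(4)[symmetric]
    by (simp add: fact_Suc del: of_nat_Suc)
  finally show ?thesis by (simp only: divpow_def scalar_left_commute)
qed

text \<open>An entry in a position greater than \<open>s\<close> would exceed the weight \<open>s\<close>, so it is zero.\<close>

lemma partial_garland_stable:
  assumes "s < int l"
  shows "partial_garland x (l + d) r s = partial_garland x l r s"
proof (induction d)
  case (Suc d)
  have "partial_garland x (Suc (l + d)) r s =
    (\<Sum>c\<le>nat r. partial_garland x (l + d) (r - int c) (s - int (l + d) * int c) * divpow (x (l + d)) c)"
    by (rule partial_garland_Suc) simp
  also have "\<dots> = (\<Sum>c\<in>{0}. partial_garland x (l + d) (r - int c) (s - int (l + d) * int c) * divpow (x (l + d)) c)"
  proof (rule sum.mono_neutral_right)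
    show "\<forall>c\<in>{..nat r} - {0}. partial_garland x (l + d) (r - int c) (s - int (l + d) * int c) * divpow (x (l + d)) c = 0"
    proof
      fix c assume "c \<in> {..nat r} - {0}"
      then have "int (l + d) * 1 \<le> int (l + d) * int c" by (intro mult_left_mono) auto
      then show "partial_garland x (l + d) (r - int c) (s - int (l + d) * int c) * divpow (x (l + d)) c = 0"
        using assms by (subst partial_garland_neg) auto
    qed
  qed auto
  finally show ?case using Suc by (simp add: divpow_0)
qed simp

lemma partial_garland_zero_deg: "partial_garland x l 0 s = (if s = 0 then 1 else 0)"
proof (induction l arbitrary: s)
  case (Suc l)
  have "partial_garland x (Suc l) 0 s =
    (\<Sum>c\<le>0. partial_garland x l (0 - int c) (s - int l * int c) * divpow (x l) c)"
    by (rule partial_garland_Suc) simp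
  then show ?case using Suc by (simp add: divpow_0)
qed (simp add: partial_garland_0)

lemma partial_garland_alg:
  assumes "\<And>k. x k \<in> alg L"
  shows "partial_garland x l r s \<in> alg L"
proof -
  have "prod_list (map (\<lambda>k. divpow (x k) (b ! k)) ks) \<in> alg L" for b ks
    by (induction ks) (simp_all add: assms)
  then show ?thesis unfolding partial_garland_def by (intro alg_sum) auto
qed

context lie_algebra_set
begin

lemma uea_ideal_sum: "(\<And>i. i \<in> I \<Longrightarrow> f i \<in> uea_ideal L) \<Longrightarrow> sum f I \<in> uea_ideal L"
  by (induction I rule: infinite_finite_induct) (auto intro: uea_ideal_0 uea_ideal_add)

context
  fixes x :: "nat \<Rightarrow> complex poly mat free_alg"
  assumes x: "\<And>k. x k \<in> alg L"
    and comm: "\<And>j k. x j * x k - x k * x j \<in> uea_ideal L"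
begin

lemma commute_mult:
  assumes "p \<in> alg L" "q \<in> alg L"
    "p * x k - x k * p \<in> uea_ideal L" "q * x k - x k * q \<in> uea_ideal L"
  shows "(p * q) * x k - x k * (p * q) \<in> uea_ideal L"
proof -
  have "(p * q) * x k - x k * (p * q) = p * (q * x k - x k * q) + (p * x k - x k * p) * q"
    by (simp add: algebra_simps)
  then show ?thesis using assms by (auto intro: uea_ideal_add uea_ideal_left uea_ideal_right)
qed

lemma commute_divpow: "divpow (x j) b * x k - x k * divpow (x j) b \<in> uea_ideal L"
proof -
  have "x j ^ b * x k - x k * x j ^ b \<in> uea_ideal L"
  proof (induction b)
    case (Suc b)
    then show ?case using commute_mult[of "x j" "x j ^ b" k] x comm by simp
  qed (simp add: uea_ideal_0)
  then have "scalar (1 / fact b) * (x j ^ b * x k - x k * x j ^ b) \<in> uea_ideal L"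
    by (intro uea_ideal_left) auto
  then show ?thesis
    by (simp add: divpow_def right_diff_distrib scalar_left_commute mult.assoc)
qed

lemma commute_partial_garland:
  "partial_garland x l r s * x k - x k * partial_garland x l r s \<in> uea_ideal L"
proof -
  have p: "prod_list (map (\<lambda>k. divpow (x k) (b ! k)) ks) \<in> alg L \<and>
    prod_list (map (\<lambda>k. divpow (x k) (b ! k)) ks) * x k -
     x k * prod_list (map (\<lambda>k. divpow (x k) (b ! k)) ks) \<in> uea_ideal L" for b ks
  proof (induction ks)
    case (Cons j ks)
    then show ?case using commute_mult[OF _ _ commute_divpow, of j "b ! j"] x by auto
  qed (simp add: uea_ideal_0)
  show ?thesis
    unfolding partial_garland_def sum_distrib_left sum_distrib_right sum_subtractf[symmetric]
    by (rule uea_ideal_sum) (use p in blast)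
qed

text \<open>The exponential generating series \<open>X(z)\<^sup>(\<^sup>r\<^sup>)\<close> with \<open>X(z) = \<Sum> x\<^sub>j z\<^sup>j\<close>.\<close>

text \<open>In generating functions this is \<open>r X\<^sup>r / r! = X \<cdot> X\<^bsup>r-1\<^esup> / (r-1)!\<close> with \<open>X = \<Sum>\<^sub>j\<^sub><\<^sub>l x\<^sub>j z\<^sup>j\<close>. In the induction
  on the number of variables, \<open>r = (r - c) + c\<close> is distributed over the tuples with last entry \<open>c\<close>: the
  induction hypothesis applies to \<open>r - c\<close>, and \<open>c\<close> lowers the last divided power by one.\<close>

lemma partial_garland_rec:
  "of_int r * partial_garland x l r s -
   (\<Sum>j<l. x j * partial_garland x l (r - 1) (s - int j)) \<in> uea_ideal L"
proof (induction l arbitrary: r s)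
  case 0
  then show ?case by (simp add: partial_garland_0 uea_ideal_0)
next
  case (Suc l)
  define g where "g = partial_garland x l"
  define D where "D c = divpow (x l) c" for c
  have gA: "g r s \<in> alg L" for r s unfolding g_def by (rule partial_garland_alg) (rule x)
  have DA: "D c \<in> alg L" for c unfolding D_def using x by simp
  \<comment> \<open>One more than needed for \<open>r\<close>, so that the sum with the factor \<open>c\<close> can be shifted down by one.\<close>
  define M where "M = Suc (nat r)"
  have e1: "partial_garland x (Suc l) r s = (\<Sum>c\<le>M. g (r - int c) (s - int l * int c) * D c)" for s
    unfolding g_def D_def by (rule partial_garland_Suc) (simp add: M_def)
  have e2: "partial_garland x (Suc l) (r - 1) s =
      (\<Sum>c\<le>M. g (r - int c - 1) (s - int l * int c) * D c)" for s
    unfolding g_def D_def by (subst partial_garland_Suc[of _ M]) (auto simp: M_def algebra_simps)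
  have e3: "partial_garland x (Suc l) (r - 1) s =
      (\<Sum>c\<le>nat r. g (r - 1 - int c) (s - int l * int c) * D c)" for s
    unfolding g_def D_def by (rule partial_garland_Suc) simp
  define A where "A = (\<Sum>c\<le>M. of_int (r - int c) * g (r - int c) (s - int l * int c) * D c)"
  define B where "B = (\<Sum>c\<le>M. of_int (int c) * g (r - int c) (s - int l * int c) * D c)"
  have split: "of_int r * partial_garland x (Suc l) r s = A + B"
    unfolding A_def B_def e1 sum_distrib_left sum.distrib[symmetric]
    by (rule sum.cong) (simp_all add: algebra_simps)
  have A: "A - (\<Sum>j<l. x j * partial_garland x (Suc l) (r - 1) (s - int j)) \<in> uea_ideal L"
  proof -
    have "(\<Sum>j<l. x j * partial_garland x (Suc l) (r - 1) (s - int j)) =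
      (\<Sum>c\<le>M. (\<Sum>j<l. x j * g (r - int c - 1) (s - int l * int c - int j)) * D c)"
      unfolding e2 sum_distrib_left sum_distrib_right
      by (subst sum.swap) (simp add: algebra_simps)
    then have "A - (\<Sum>j<l. x j * partial_garland x (Suc l) (r - 1) (s - int j)) =
      (\<Sum>c\<le>M. (of_int (r - int c) * g (r - int c) (s - int l * int c) -
        (\<Sum>j<l. x j * g (r - int c - 1) (s - int l * int c - int j))) * D c)"
      by (simp add: A_def sum_subtractf left_diff_distrib)
    also have "\<dots> \<in> uea_ideal L"
      unfolding g_def by (intro uea_ideal_sum uea_ideal_right DA Suc)
    finally show ?thesis .
  qed
  have B: "B - x l * partial_garland x (Suc l) (r - 1) (s - int l) \<in> uea_ideal L"
  proof -
    have "B = (\<Sum>c\<le>nat r. g (r - 1 - int c) (s - int l - int l * int c) * x l * D c)"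
    proof -
      have "B = (\<Sum>c\<le>nat r. of_nat (Suc c) * g (r - int (Suc c)) (s - int l * int (Suc c)) * D (Suc c))"
        unfolding B_def M_def sum.atMost_Suc_shift by simp
      also have "\<dots> = (\<Sum>c\<le>nat r. g (r - 1 - int c) (s - int l - int l * int c) * x l * D c)"
      proof (rule sum.cong[OF refl])
        fix c
        have "of_nat (Suc c) * g (r - int (Suc c)) (s - int l * int (Suc c)) * D (Suc c) =
          g (r - int (Suc c)) (s - int l * int (Suc c)) * (of_nat (Suc c) * D (Suc c))"
          by (subst mult_of_nat_commute) (simp only: mult.assoc)
        also have "of_nat (Suc c) * D (Suc c) = x l * D c" unfolding D_def by (rule divpow_Suc)
        finally show "of_nat (Suc c) * g (r - int (Suc c)) (s - int l * int (Suc c)) * D (Suc c) =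
          g (r - 1 - int c) (s - int l - int l * int c) * x l * D c"
          by (simp add: algebra_simps)
      qed
      finally show ?thesis .
    qed
    then have "B - x l * partial_garland x (Suc l) (r - 1) (s - int l) =
      (\<Sum>c\<le>nat r. (g (r - 1 - int c) (s - int l - int l * int c) * x l -
         x l * g (r - 1 - int c) (s - int l - int l * int c)) * D c)"
      by (simp add: e3 sum_distrib_left sum_subtractf left_diff_distrib mult.assoc)
    also have "\<dots> \<in> uea_ideal L"
      unfolding g_def by (intro uea_ideal_sum uea_ideal_right DA commute_partial_garland)
    finally show ?thesis .
  qed
  show ?case using uea_ideal_add[OF A B] by (simp add: split algebra_simps)
qed

lemma garland_rec:
  "of_nat (Suc r) * partial_garland x (Suc s) (int (Suc r)) (int s) -
   (\<Sum>j\<le>s. x j * partial_garland x (Suc (s - j)) (int r) (int (s - j))) \<in> uea_ideal L"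
proof -
  have "partial_garland x (Suc s) (int (Suc r) - 1) (int s - int j) =
      partial_garland x (Suc (s - j)) (int r) (int (s - j))" if "j \<in> {..<Suc s}" for j
    using partial_garland_stable[of "int (s - j)" "Suc (s - j)" x j "int r"] that
    by (simp add: of_nat_diff)
  then have "(\<Sum>j<Suc s. x j * partial_garland x (Suc s) (int (Suc r) - 1) (int s - int j)) =
     (\<Sum>j\<le>s. x j * partial_garland x (Suc (s - j)) (int r) (int (s - j)))"
    unfolding lessThan_Suc_atMost[symmetric] by (intro sum.cong) auto
  then show ?thesis using partial_garland_rec[of "int (Suc r)" "Suc s" "int s"] by simp
qed

end

end

section \<open>Cartan and raising elements acting on garlands\<close>

lemma sum_triangle_swap:
  fixes f :: "nat \<Rightarrow> nat \<Rightarrow> 'a::comm_monoid_add"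
  shows "(\<Sum>j\<le>s. \<Sum>l\<le>s - j. f j l) = (\<Sum>l\<le>s. \<Sum>j\<le>s - l. f j l)"
  unfolding sum.Sigma[OF finite_atMost ballI[OF finite_atMost]]
  by (rule sum.reindex_bij_witness[of _ "\<lambda>(l, j). (j, l)" "\<lambda>(j, l). (l, j)"]) auto

text \<open>The pairs \<open>(j, l)\<close> on the diagonal \<open>l + j = k\<close> number \<open>k + 1\<close>.\<close>

lemma sum_triangle_diagonals:
  fixes f :: "nat \<Rightarrow> 'a::ring_1"
  shows "(\<Sum>j\<le>s. \<Sum>l\<le>s - j. f (l + j)) = (\<Sum>k\<le>s. of_nat (Suc k) * f k)"
proof (induction s)
  case (Suc s)
  have "(\<Sum>j\<le>Suc s. \<Sum>l\<le>Suc s - j. f (l + j)) = (\<Sum>j\<le>s. \<Sum>l\<le>Suc (s - j). f (l + j)) + f (Suc s)"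
    by (simp add: Suc_diff_le)
  also have "\<dots> = (\<Sum>j\<le>s. \<Sum>l\<le>s - j. f (l + j)) + (\<Sum>j\<le>s. f (Suc s)) + f (Suc s)"
    by (simp add: sum.distrib)
  also have "\<dots> = (\<Sum>k\<le>Suc s. of_nat (Suc k) * f k)"
    using Suc by (simp add: algebra_simps sum.distrib)
  finally show ?case .
qed simp

text \<open>Congruences modulo a subgroup \<open>K\<close> stand for equations between vectors of the quotient module; \<open>G r s\<close> are
  the coefficients of \<open>X(z)\<^sup>r / r!\<close> applied to the cyclic vector, characterized by their recursion.\<close>

locale garland_module =
  fixes K :: "'a::ring_1 set" and x :: "nat \<Rightarrow> 'a" and G :: "nat \<Rightarrow> nat \<Rightarrow> 'a"
  assumes K_zero: "0 \<in> K" and K_add: "p \<in> K \<Longrightarrow> q \<in> K \<Longrightarrow> p + q \<in> K"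
    and K_uminus: "p \<in> K \<Longrightarrow> - p \<in> K"
    and K_x: "p \<in> K \<Longrightarrow> x j * p \<in> K"
    and K_cancel: "of_nat (Suc r) * p \<in> K \<Longrightarrow> p \<in> K"
    and G_zero: "G 0 s = (if s = 0 then 1 else 0)"
    and G_Suc: "of_nat (Suc r) * G (Suc r) s - (\<Sum>j\<le>s. x j * G r (s - j)) \<in> K"
    and x_comm: "x j * (x k * G r s) - x k * (x j * G r s) \<in> K"
begin

definition cong (infix "\<approx>" 50) where "p \<approx> q \<longleftrightarrow> p - q \<in> K"

lemma cong_refl [simp]: "p \<approx> p"
  by (simp add: cong_def K_zero)

lemma cong_sym: "p \<approx> q \<Longrightarrow> q \<approx> p"
  using K_uminus[of "p - q"] by (simp add: cong_def)

lemma cong_trans [trans]: "p \<approx> q \<Longrightarrow> q \<approx> r \<Longrightarrow> p \<approx> r"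
  using K_add[of "p - q" "q - r"] by (simp add: cong_def)

lemma cong_eq_trans [trans]: "p \<approx> q \<Longrightarrow> q = r \<Longrightarrow> p \<approx> r"
  and eq_cong_trans [trans]: "p = q \<Longrightarrow> q \<approx> r \<Longrightarrow> p \<approx> r"
  by simp_all

lemma cong_add: "p \<approx> p' \<Longrightarrow> q \<approx> q' \<Longrightarrow> p + q \<approx> p' + q'"
  using K_add[of "p - p'" "q - q'"] by (simp add: cong_def algebra_simps)

lemma cong_uminus: "p \<approx> p' \<Longrightarrow> - p \<approx> - p'"
  using K_uminus[of "p - p'"] by (simp add: cong_def algebra_simps)

lemma cong_diff: "p \<approx> p' \<Longrightarrow> q \<approx> q' \<Longrightarrow> p - q \<approx> p' - q'"
  using cong_add[of p p' "-q" "-q'"] cong_uminus[of q q'] by simp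

lemma cong_sum: "(\<And>i. i \<in> I \<Longrightarrow> f i \<approx> g i) \<Longrightarrow> sum f I \<approx> sum g I"
  by (induction I rule: infinite_finite_induct) (auto intro: cong_add)

lemma cong_x: "p \<approx> q \<Longrightarrow> x j * p \<approx> x j * q"
  using K_x[of "p - q" j] by (simp add: cong_def right_diff_distrib)

lemma cong_of_nat: "p \<approx> q \<Longrightarrow> of_nat m * p \<approx> of_nat m * q"
  by (induction m) (auto simp: distrib_right intro: cong_add)

lemma cong_of_int: "p \<approx> q \<Longrightarrow> of_int m * p \<approx> of_int m * q"
  by (cases m rule: int_cases2) (auto intro: cong_of_nat cong_uminus)

lemma cong_cancel: "of_nat (Suc r) * p \<approx> of_nat (Suc r) * q \<Longrightarrow> p \<approx> q"
  using K_cancel[of r "p - q"] by (simp add: cong_def right_diff_distrib)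

lemma of_int_left_commute: "p * (of_int m * q) = of_int m * (p * q)"
  by (subst mult.assoc[symmetric], subst mult_of_int_commute[symmetric], rule mult.assoc)

lemma of_nat_left_commute: "p * (of_nat m * q) = of_nat m * (p * q)"
  by (subst mult.assoc[symmetric], subst mult_of_nat_commute[symmetric], rule mult.assoc)

text \<open>The value zero for \<open>r = 0\<close> is the convention \<open>X(z)\<^sup>k / k! = 0\<close> for \<open>k = -1\<close>. The element
  \<open>shifted c m r s\<close> is the coefficient of \<open>z\<^sup>s\<close> in \<open>(\<Sum>\<^sub>l c\<^sub>l x\<^sub>m\<^sub>+\<^sub>l z\<^sup>l) X(z)\<^bsup>r-1\<^esup> / (r-1)!\<close>. Commutators with \<open>h \<otimes> t\<^sup>m\<close>
  and \<open>x\<^sup>+ \<otimes> t\<^sup>m\<close> have this form, with \<open>c\<^sub>l = 1\<close> and \<open>c\<^sub>l = l + 1\<close>.\<close>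

definition Gpred :: "nat \<Rightarrow> nat \<Rightarrow> 'a" where
  "Gpred r s = (if r = 0 then 0 else G (r - 1) s)"

definition shifted :: "(nat \<Rightarrow> int) \<Rightarrow> nat \<Rightarrow> nat \<Rightarrow> nat \<Rightarrow> 'a" where
  "shifted c m r s = (\<Sum>l\<le>s. of_int (c l) * (x (l + m) * Gpred r (s - l)))"

lemma Gpred_simps [simp]: "Gpred 0 s = 0" "Gpred (Suc r) s = G r s"
  by (simp_all add: Gpred_def)

lemma shifted_0 [simp]: "shifted c m 0 s = 0"
  by (simp add: shifted_def)

text \<open>The recursion in the form that includes \<open>r = 0\<close>, where both sides vanish.\<close>

lemma garland_rec: "(\<Sum>j\<le>s. x j * Gpred r (s - j)) \<approx> of_nat r * G r s"
  using cong_sym G_Suc by (cases r) (auto simp: cong_def[symmetric])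

text \<open>Multiplication of the generating function by \<open>X(z)\<close>: since the \<open>x\<^sub>j\<close> commute, \<open>X(z)\<close> can be absorbed into
  the power, which the recursion then raises.\<close>

lemma convolve_shifted:
  "(\<Sum>j\<le>s. x j * shifted c m r (s - j)) \<approx> of_nat r * shifted c m (Suc r) s"
proof -
  have "(\<Sum>j\<le>s. x j * shifted c m r (s - j)) =
    (\<Sum>j\<le>s. \<Sum>l\<le>s - j. of_int (c l) * (x j * (x (l + m) * Gpred r (s - j - l))))"
    by (simp add: shifted_def sum_distrib_left of_int_left_commute)
  also have "\<dots> \<approx> (\<Sum>j\<le>s. \<Sum>l\<le>s - j. of_int (c l) * (x (l + m) * (x j * Gpred r (s - j - l))))"
    by (intro cong_sum cong_of_int) (use x_comm in \<open>auto simp: cong_def Gpred_def K_zero\<close>)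
  also have "\<dots> = (\<Sum>l\<le>s. of_int (c l) * (x (l + m) * (\<Sum>j\<le>s - l. x j * Gpred r (s - l - j))))"
    by (subst sum_triangle_swap) (simp add: sum_distrib_left add.commute)
  also have "\<dots> \<approx> (\<Sum>l\<le>s. of_int (c l) * (x (l + m) * (of_nat r * G r (s - l))))"
    by (intro cong_sum cong_of_int cong_x garland_rec)
  also have "\<dots> = of_nat r * shifted c m (Suc r) s"
    by (simp add: shifted_def sum_distrib_left of_nat_left_commute)
  finally show ?thesis .
qed

lemma shifted_const: "shifted (\<lambda>_. 1) 0 r s \<approx> of_nat r * G r s"
  using garland_rec[where r = r and s = s] by (simp add: shifted_def)

text \<open>The Euler operator: \<open>z X' X\<^bsup>r-1\<^esup> / (r-1)!\<close> is \<open>z d/dz\<close> of \<open>X\<^sup>r / r!\<close>.\<close>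

lemma shifted_id: "shifted int 0 r s \<approx> of_nat s * G r s"
proof (induction r arbitrary: s)
  case (Suc r)
  have "of_nat (Suc r) * (of_nat s * G (Suc r) s) = of_nat s * (of_nat (Suc r) * G (Suc r) s)"
    by (rule of_nat_left_commute)
  also have "\<dots> \<approx> of_nat s * (\<Sum>j\<le>s. x j * G r (s - j))"
    using cong_sym[OF garland_rec[where r = "Suc r" and s = s]] by (intro cong_of_nat) simp
  also have "\<dots> = (\<Sum>j\<le>s. of_nat j * (x j * G r (s - j)) + x j * (of_nat (s - j) * G r (s - j)))"
  proof -
    have "of_nat s * (x j * G r (s - j)) =
      of_nat j * (x j * G r (s - j)) + x j * (of_nat (s - j) * G r (s - j))" if "j \<le> s" for j
    proof -
      have "of_nat s = of_nat j + (of_nat (s - j) :: 'a)" using that by (simp flip: of_nat_add)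
      then show ?thesis by (simp add: distrib_right of_nat_left_commute)
    qed
    then show ?thesis by (simp add: sum_distrib_left)
  qed
  also have "\<dots> \<approx> (\<Sum>j\<le>s. of_nat j * (x j * G r (s - j)) + x j * shifted int 0 r (s - j))"
    by (intro cong_sum cong_add cong_refl cong_x cong_sym[OF Suc])
  also have "\<dots> = shifted int 0 (Suc r) s + (\<Sum>j\<le>s. x j * shifted int 0 r (s - j))"
    by (simp add: sum.distrib shifted_def)
  also have "\<dots> \<approx> shifted int 0 (Suc r) s + of_nat r * shifted int 0 (Suc r) s"
    by (intro cong_add cong_refl convolve_shifted)
  also have "\<dots> = of_nat (Suc r) * shifted int 0 (Suc r) s" by (simp add: distrib_right)
  finally show ?case by (rule cong_sym[OF cong_cancel])
qed (simp add: G_zero)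

text \<open>Here \<open>\<Sum>\<^sub>l c\<^sub>l x\<^sub>m\<^sub>+\<^sub>l z\<^sup>l\<close> is \<open>z\<^sup>-\<^sup>m\<close> times the difference of the full series \<open>\<Sum>\<^sub>j c'\<^sub>j x\<^sub>j z\<^sup>j\<close> and its terms with
  \<open>j < m\<close>; the latter are the correction terms.\<close>

lemma shifted_unshift:
  assumes "\<And>l. c l = c' (l + m)"
  shows "shifted c m r s =
    shifted c' 0 r (s + m) - (\<Sum>j<m. of_int (c' j) * (x j * Gpred r (s + m - j)))"
proof -
  let ?f = "\<lambda>j. of_int (c' j) * (x j * Gpred r (s + m - j))"
  have "sum ?f {..s + m} = sum ?f {..<m} + sum ?f {m..s + m}"
    by (subst sum.union_disjoint[symmetric]) (auto intro: sum.cong)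
  also have "sum ?f {m..s + m} = shifted c m r s"
    unfolding shifted_def
    by (rule sum.reindex_bij_witness[of _ "\<lambda>l. l + m" "\<lambda>j. j - m"]) (auto simp: assms)
  finally show ?thesis by (simp add: shifted_def)
qed

text \<open>The element \<open>h = H \<otimes> t\<^sup>m\<close> acts as a derivation that sends \<open>x\<^sub>j\<close> to \<open>- \<kappa> x\<^sub>j\<^sub>+\<^sub>m\<close>, and by \<open>\<mu>\<close> on the cyclic
  vector. The derivative of \<open>X\<^sup>r / r!\<close> is the image of \<open>X\<close> times \<open>X\<^bsup>r-1\<^esup> / (r-1)!\<close>.\<close>

lemma cartan_garland:
  assumes K_h: "\<And>p. p \<in> K \<Longrightarrow> h * p \<in> K"
    and h_x: "\<And>j r s. h * (x j * G r s) - x j * (h * G r s) + \<kappa> * (x (j + m) * G r s) \<in> K"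
    and h_1: "h - \<mu> \<in> K"
    and central: "\<And>p. p * \<kappa> = \<kappa> * p" "\<And>p. p * \<mu> = \<mu> * p"
    and K_central: "\<And>p. p \<in> K \<Longrightarrow> \<kappa> * p \<in> K" "\<And>p. p \<in> K \<Longrightarrow> \<mu> * p \<in> K"
  shows "h * G r s \<approx> \<mu> * G r s - \<kappa> * shifted (\<lambda>_. 1) m r s"
proof (induction r arbitrary: s)
  case 0
  show ?case using h_1 by (simp add: G_zero cong_def K_zero)
next
  case (Suc r)
  have h: "p \<approx> q \<Longrightarrow> h * p \<approx> h * q"
    and \<kappa>: "p \<approx> q \<Longrightarrow> \<kappa> * p \<approx> \<kappa> * q" and \<mu>: "p \<approx> q \<Longrightarrow> \<mu> * p \<approx> \<mu> * q" for p q
    using K_h[of "p - q"] K_central[of "p - q"] by (simp_all add: cong_def right_diff_distrib)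
  have commute: "p * (\<kappa> * q) = \<kappa> * (p * q)" "p * (\<mu> * q) = \<mu> * (p * q)" for p q
    by (simp_all only: mult.assoc[symmetric] central)
  let ?S = "shifted (\<lambda>_. 1) m"
  have "of_nat (Suc r) * (h * G (Suc r) s) = h * (of_nat (Suc r) * G (Suc r) s)"
    by (rule of_nat_left_commute[symmetric])
  also have "\<dots> \<approx> h * (\<Sum>j\<le>s. x j * G r (s - j))"
    using cong_sym[OF garland_rec[where r = "Suc r" and s = s]] by (intro h) simp
  also have "\<dots> = (\<Sum>j\<le>s. h * (x j * G r (s - j)))" by (simp add: sum_distrib_left)
  also have "\<dots> \<approx> (\<Sum>j\<le>s. x j * (h * G r (s - j)) - \<kappa> * (x (j + m) * G r (s - j)))"
    by (intro cong_sum) (use h_x in \<open>simp add: cong_def algebra_simps\<close>)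
  also have "\<dots> \<approx> (\<Sum>j\<le>s. x j * (\<mu> * G r (s - j) - \<kappa> * ?S r (s - j))
      - \<kappa> * (x (j + m) * G r (s - j)))"
    by (intro cong_sum cong_diff cong_refl cong_x Suc)
  also have "\<dots> = \<mu> * (\<Sum>j\<le>s. x j * G r (s - j)) -
      \<kappa> * (\<Sum>j\<le>s. x j * ?S r (s - j)) - \<kappa> * ?S (Suc r) s"
    by (simp add: shifted_def[of "\<lambda>_. 1" m "Suc r"] right_diff_distrib commute
        sum_subtractf sum_distrib_left)
  also have "\<dots> \<approx> \<mu> * (of_nat (Suc r) * G (Suc r) s) -
      \<kappa> * (of_nat r * ?S (Suc r) s) - \<kappa> * ?S (Suc r) s"
    using garland_rec[where r = "Suc r" and s = s]
    by (intro cong_diff \<mu> \<kappa> cong_refl convolve_shifted) simp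
  also have "\<dots> = of_nat (Suc r) * (\<mu> * G (Suc r) s - \<kappa> * ?S (Suc r) s)"
    unfolding of_nat_left_commute by (simp add: algebra_simps)
  finally show ?case by (rule cong_cancel)
qed

text \<open>Moving \<open>e = x\<^sup>+ \<otimes> t\<^sup>m\<close> through \<open>X\<^bsup>r+1\<^esup> / (r+1)!\<close> leaves \<open>[e, X] = \<Sum>\<^sub>j h\<^sub>j\<^sub>+\<^sub>m z\<^sup>j\<close>, which has to be moved further to the
  right; \<open>[[e, X], X] = - 2 \<Sum>\<^sub>k (k + 1) x\<^sub>k\<^sub>+\<^sub>m z\<^sup>k\<close> accounts for the coefficients \<open>l + 1\<close>.\<close>

lemma raise_garland:
  assumes K_e: "\<And>p. p \<in> K \<Longrightarrow> e * p \<in> K" and e_1: "e \<in> K"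
    and e_x: "\<And>j r s. e * (x j * G r s) - x j * (e * G r s) - h (j + m) * G r s \<in> K"
    and h_G: "\<And>m r s. h m * G r s \<approx>
      of_int (if m = 0 then \<mu> else 0) * G r s - 2 * shifted (\<lambda>_. 1) m r s"
  shows "e * G (Suc r) s \<approx>
    of_int (if m = 0 then \<mu> else 0) * G r s - shifted (\<lambda>l. int l + 1) m r s"
proof -
  define \<nu> where "\<nu> = (if m = 0 then \<mu> else 0)"
  let ?S = "shifted (\<lambda>l. int l + 1) m"
  have e: "p \<approx> q \<Longrightarrow> e * p \<approx> e * q" for p q
    using K_e[of "p - q"] by (simp add: cong_def right_diff_distrib)
  have h_sum: "(\<Sum>j\<le>s. h (j + m) * G r (s - j)) \<approx> of_int \<nu> * G r s - 2 * ?S r s" for r s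
  proof -
    have "(\<Sum>j\<le>s. h (j + m) * G r (s - j)) \<approx> (\<Sum>j\<le>s. of_int (if j + m = 0 then \<mu> else 0) * G r (s - j)
        - 2 * shifted (\<lambda>_. 1) (j + m) r (s - j))"
      by (intro cong_sum h_G)
    also have "\<dots> = (\<Sum>j\<le>s. of_int (if j + m = 0 then \<mu> else 0) * G r (s - j))
        - 2 * (\<Sum>j\<le>s. shifted (\<lambda>_. 1) (j + m) r (s - j))"
      by (simp add: sum_subtractf sum_distrib_left)
    also have "\<dots> = of_int \<nu> * G r s - 2 * ?S r s"
    proof -
      have "(\<Sum>j\<le>s. of_int (if j + m = 0 then \<mu> else 0) * G r (s - j)) =
          (\<Sum>j\<le>s. if j = 0 then of_int \<nu> * G r s else 0)"
        by (rule sum.cong) (auto simp: \<nu>_def)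
      moreover have "(\<Sum>j\<le>s. shifted (\<lambda>_. 1) (j + m) r (s - j)) =
          (\<Sum>j\<le>s. \<Sum>l\<le>s - j. x ((l + j) + m) * Gpred r (s - (l + j)))"
        unfolding shifted_def by (intro sum.cong) (simp_all add: ac_simps)
      moreover have "\<dots> = ?S r s"
        by (subst sum_triangle_diagonals[where f = "\<lambda>k. x (k + m) * Gpred r (s - k)"])
           (simp add: shifted_def add.commute)
      ultimately show ?thesis by simp
    qed
    finally show ?thesis .
  qed
  have step: "of_nat (Suc r) * (e * G (Suc r) s) \<approx>
    (\<Sum>j\<le>s. x j * (e * G r (s - j))) + (of_int \<nu> * G r s - 2 * ?S r s)" for r s
  proof -
    have "of_nat (Suc r) * (e * G (Suc r) s) = e * (of_nat (Suc r) * G (Suc r) s)"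
      by (rule of_nat_left_commute[symmetric])
    also have "\<dots> \<approx> e * (\<Sum>j\<le>s. x j * G r (s - j))"
      using cong_sym[OF garland_rec[where r = "Suc r" and s = s]] by (intro e) simp
    also have "\<dots> = (\<Sum>j\<le>s. e * (x j * G r (s - j)))" by (simp add: sum_distrib_left)
    also have "\<dots> \<approx> (\<Sum>j\<le>s. x j * (e * G r (s - j)) + h (j + m) * G r (s - j))"
      by (intro cong_sum) (use e_x in \<open>simp add: cong_def algebra_simps\<close>)
    also have "\<dots> = (\<Sum>j\<le>s. x j * (e * G r (s - j))) + (\<Sum>j\<le>s. h (j + m) * G r (s - j))"
      by (simp add: sum.distrib)
    also have "\<dots> \<approx> (\<Sum>j\<le>s. x j * (e * G r (s - j))) + (of_int \<nu> * G r s - 2 * ?S r s)"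
      by (intro cong_add cong_refl h_sum)
    finally show ?thesis .
  qed
  show ?thesis
    unfolding \<nu>_def[symmetric]
  proof (induction r arbitrary: s)
    case 0
    have "e * G 0 (s - j) \<approx> 0" for j using e_1 by (simp add: G_zero cong_def K_zero)
    then have "x j * (e * G 0 (s - j)) \<approx> x j * 0" for j by (intro cong_x)
    then have "(\<Sum>j\<le>s. x j * (e * G 0 (s - j))) \<approx> (\<Sum>j\<le>s. 0)" by (intro cong_sum) simp
    then have "(\<Sum>j\<le>s. x j * (e * G 0 (s - j))) + (of_int \<nu> * G 0 s - 2 * ?S 0 s)
        \<approx> 0 + (of_int \<nu> * G 0 s - 2 * ?S 0 s)"
      by (intro cong_add cong_refl) simp
    from cong_trans[OF step this] show ?case by simp
  next
    case (Suc r)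
    note step
    also have "(\<Sum>j\<le>s. x j * (e * G (Suc r) (s - j))) + (of_int \<nu> * G (Suc r) s - 2 * ?S (Suc r) s)
      \<approx> (\<Sum>j\<le>s. x j * (of_int \<nu> * G r (s - j) - ?S r (s - j))) + (of_int \<nu> * G (Suc r) s - 2 * ?S (Suc r) s)"
      by (intro cong_add cong_refl cong_sum cong_x Suc)
    also have "\<dots> = (of_int \<nu> * (\<Sum>j\<le>s. x j * G r (s - j)) - (\<Sum>j\<le>s. x j * ?S r (s - j))) +
        (of_int \<nu> * G (Suc r) s - 2 * ?S (Suc r) s)"
      by (simp add: right_diff_distrib of_int_left_commute sum_subtractf sum_distrib_left)
    also have "\<dots> \<approx> (of_int \<nu> * (of_nat (Suc r) * G (Suc r) s) - of_nat r * ?S (Suc r) s) +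
        (of_int \<nu> * G (Suc r) s - 2 * ?S (Suc r) s)"
      using garland_rec[where r = "Suc r" and s = s]
      by (intro cong_add cong_diff cong_of_int cong_refl convolve_shifted) simp
    also have "\<dots> = of_nat (Suc (Suc r)) * (of_int \<nu> * G (Suc r) s - ?S (Suc r) s)"
    proof -
      have *: "of_int a * (of_nat b * p) = of_nat b * (of_int a * p)" for a b and p :: 'a
        by (rule of_nat_left_commute)
      show ?thesis unfolding * by (simp add: algebra_simps mult_2)
    qed
    finally show ?case by (rule cong_cancel)
  qed
qed

lemma shifted_one_eval:
  "shifted (\<lambda>_. 1) m r s \<approx> of_nat r * G r (s + m) - (\<Sum>j<m. x j * Gpred r (s + m - j))"
  by (subst shifted_unshift[where c' = "\<lambda>_. 1"]) (auto intro: cong_diff shifted_const)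

text \<open>The coefficient \<open>l + 1\<close> at \<open>j = l + m\<close> is \<open>j + (1 - m)\<close>, a combination of the two previous cases. It
  vanishes at \<open>j = m - 1\<close>, which is what removes the one correction term of too small degree.\<close>

lemma shifted_Suc_eval:
  "shifted (\<lambda>l. int l + 1) m r s \<approx> of_int (int (s + m) + (1 - int m) * int r) * G r (s + m)
     - (\<Sum>j<m. of_int (int j + 1 - int m) * (x j * Gpred r (s + m - j)))"
proof -
  have "shifted (\<lambda>j. int j + 1 - int m) 0 r (s + m) =
    shifted int 0 r (s + m) + of_int (1 - int m) * shifted (\<lambda>_. 1) 0 r (s + m)"
    unfolding shifted_def sum_distrib_left sum.distrib[symmetric]
    by (rule sum.cong) (simp_all add: algebra_simps)
  also have "\<dots> \<approx> of_nat (s + m) * G r (s + m) + of_int (1 - int m) * (of_nat r * G r (s + m))"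
    by (intro cong_add cong_of_int shifted_id shifted_const)
  also have "\<dots> = of_int (int (s + m) + (1 - int m) * int r) * G r (s + m)"
    by (simp add: algebra_simps)
  finally show ?thesis
    by (subst shifted_unshift[where c' = "\<lambda>j. int j + 1 - int m"]) (auto intro: cong_diff)
qed

end

section \<open>Current matrices and their brackets\<close>

abbreviation gl :: "nat \<Rightarrow> 'a mat set" where
  "gl n \<equiv> carrier_mat (Suc n) (Suc n)"

lemma current_sl_iff:
  "A \<in> current (sl n) \<longleftrightarrow> A \<in> gl n \<and> (\<Sum>i\<le>n. A $$ (i, i)) = 0"
proof -
  have "(\<forall>k. (\<Sum>i\<le>n. map_mat (\<lambda>p. coeff p k) A $$ (i, i)) = 0) \<longleftrightarrow> (\<Sum>i\<le>n. A $$ (i, i)) = 0"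
    if "A \<in> gl n"
  proof -
    have "(\<Sum>i\<le>n. map_mat (\<lambda>p. coeff p k) A $$ (i, i)) = coeff (\<Sum>i\<le>n. A $$ (i, i)) k" for k
      unfolding coeff_sum by (rule sum.cong) (use that in auto)
    then show ?thesis by (simp add: poly_eq_iff)
  qed
  then show ?thesis by (auto simp: current_def sl_def)
qed

lemma current_nil_neg_iff:
  "A \<in> current (nil_neg n) \<longleftrightarrow> A \<in> gl n \<and> (\<forall>i\<le>n. \<forall>j\<le>n. i \<le> j \<longrightarrow> A $$ (i, j) = 0)" (is "?l \<longleftrightarrow> ?r")
proof
  assume A: ?l
  then have g: "A \<in> gl n" by (auto simp: current_def nil_neg_def sl_def)
  have "coeff (A $$ (i, j)) k = 0" if "i \<le> j" "j \<le> n" for i j k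
  proof -
    have "map_mat (\<lambda>p. coeff p k) A \<in> nil_neg n" using A by (simp add: current_def)
    then have "map_mat (\<lambda>p. coeff p k) A $$ (i, j) = 0" using that unfolding nil_neg_def by (simp del: index_map_mat) (meson le_trans not_le)
    then show ?thesis using g that by simp
  qed
  with g show ?r by (simp add: poly_eq_iff)
next
  assume ?r
  then show ?l by (auto simp: current_def nil_neg_def sl_def) (metis coeff_0 not_less)
qed

lemma current_nil_pos_iff:
  "A \<in> current (nil_pos n) \<longleftrightarrow> A \<in> gl n \<and> (\<forall>i\<le>n. \<forall>j\<le>n. j \<le> i \<longrightarrow> A $$ (i, j) = 0)" (is "?l \<longleftrightarrow> ?r")
proof
  assume A: ?l
  then have g: "A \<in> gl n" by (auto simp: current_def nil_pos_def sl_def)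
  have "coeff (A $$ (i, j)) k = 0" if "j \<le> i" "i \<le> n" for i j k
  proof -
    have "map_mat (\<lambda>p. coeff p k) A \<in> nil_pos n" using A by (simp add: current_def)
    then have "map_mat (\<lambda>p. coeff p k) A $$ (i, j) = 0" using that unfolding nil_pos_def by (simp del: index_map_mat) (meson le_trans not_le)
    then show ?thesis using g that by simp
  qed
  with g show ?r by (simp add: poly_eq_iff)
next
  assume ?r
  then show ?l by (auto simp: current_def nil_pos_def sl_def) (metis coeff_0 not_less)
qed

lemma current_subset_gl: "A \<in> current (sl n) \<Longrightarrow> A \<in> gl n"
  "A \<in> current (nil_neg n) \<Longrightarrow> A \<in> gl n" "A \<in> current (nil_pos n) \<Longrightarrow> A \<in> gl n"
  by (simp_all add: current_sl_iff current_nil_neg_iff current_nil_pos_iff)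

lemma current_nil_subset: "A \<in> current (nil_neg n) \<Longrightarrow> A \<in> current (sl n)"
  "A \<in> current (nil_pos n) \<Longrightarrow> A \<in> current (sl n)"
  by (simp_all add: current_sl_iff current_nil_neg_iff current_nil_pos_iff)

lemma gl_eqI:
  "A \<in> gl n \<Longrightarrow> B \<in> gl n \<Longrightarrow> (\<And>i j. i \<le> n \<Longrightarrow> j \<le> n \<Longrightarrow> A $$ (i, j) = B $$ (i, j)) \<Longrightarrow> A = B"
  by (rule eq_matI) auto

lemma index_mult_gl:
  assumes "A \<in> gl n" "B \<in> gl n" "i \<le> n" "j \<le> n"
  shows "(A * B) $$ (i, j) = (\<Sum>k\<le>n. A $$ (i, k) * B $$ (k, j))"
  using assms
  by (auto simp: scalar_prod_def atLeast0LessThan lessThan_Suc_atMost intro!: sum.cong)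

lemma bracket_gl [simp]: "A \<in> gl n \<Longrightarrow> B \<in> gl n \<Longrightarrow> bracket A B \<in> gl n"
  unfolding bracket_def by (intro minus_carrier_mat mult_carrier_mat)

lemma dim_bracket [simp]:
  "dim_row (bracket A B) = dim_row B" "dim_col (bracket A B) = dim_col A"
  by (simp_all add: bracket_def)

lemma index_bracket:
  assumes "A \<in> gl n" "B \<in> gl n" "i \<le> n" "j \<le> n"
  shows "bracket A B $$ (i, j) = (\<Sum>k\<le>n. A $$ (i, k) * B $$ (k, j) - B $$ (i, k) * A $$ (k, j))"
proof -
  have "B * A \<in> gl n" using assms mult_carrier_mat by blast
  then have "bracket A B $$ (i, j) = (A * B) $$ (i, j) - (B * A) $$ (i, j)"
    unfolding bracket_def using assms by (subst index_minus_mat) auto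
  then show ?thesis using assms by (simp add: index_mult_gl sum_subtractf del: index_mult_mat)
qed

lemma bracket_add_right:
  "A \<in> gl n \<Longrightarrow> B \<in> gl n \<Longrightarrow> C \<in> gl n \<Longrightarrow> bracket A (B + C) = bracket A B + bracket A C"
  by (rule gl_eqI[of _ n])
     (auto simp: index_bracket[of _ n] sum.distrib[symmetric] algebra_simps intro!: sum.cong)

lemma bracket_add_left:
  "A \<in> gl n \<Longrightarrow> B \<in> gl n \<Longrightarrow> C \<in> gl n \<Longrightarrow> bracket (A + B) C = bracket A C + bracket B C"
  by (rule gl_eqI[of _ n])
     (auto simp: index_bracket[of _ n] sum.distrib[symmetric] algebra_simps intro!: sum.cong)

lemma bracket_smult_right:
  fixes A :: "'r::comm_ring_1 mat"
  shows "A \<in> gl n \<Longrightarrow> B \<in> gl n \<Longrightarrow> bracket A (c \<cdot>\<^sub>m B) = c \<cdot>\<^sub>m bracket A B"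
  by (rule gl_eqI[of _ n])
     (auto simp: index_bracket[of _ n] sum_distrib_left algebra_simps intro!: sum.cong)

lemma bracket_smult_left:
  fixes A :: "'r::comm_ring_1 mat"
  shows "A \<in> gl n \<Longrightarrow> B \<in> gl n \<Longrightarrow> bracket (c \<cdot>\<^sub>m A) B = c \<cdot>\<^sub>m bracket A B"
  by (rule gl_eqI[of _ n])
     (auto simp: index_bracket[of _ n] sum_distrib_left algebra_simps intro!: sum.cong)

lemma bracket_Jacobi:
  fixes A :: "'r::ring mat"
  assumes A: "A \<in> gl n" and B: "B \<in> gl n" and C: "C \<in> gl n"
  shows "bracket (bracket A B) C = bracket (bracket A C) B + bracket A (bracket B C)"
proof -
  have m: "U * V \<in> gl n" if "U \<in> gl n" "V \<in> gl n" for U V :: "'r mat"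
    using that by (rule mult_carrier_mat)
  have *: "bracket (bracket U V) W = (U * (V * W) - V * (U * W)) - (W * (U * V) - W * (V * U))"
    if "U \<in> gl n" "V \<in> gl n" "W \<in> gl n" for U V W :: "'r mat"
    unfolding bracket_def using that m
    by (simp add: minus_mult_distrib_mat[of _ "Suc n" "Suc n"] mult_minus_distrib_mat[of _ "Suc n" "Suc n" _ "Suc n"] assoc_mult_mat[of _ "Suc n" "Suc n" _ "Suc n" _ "Suc n"])
  have **: "bracket U (bracket V W) = (U * (V * W) - U * (W * V)) - (V * (W * U) - W * (V * U))"
    if "U \<in> gl n" "V \<in> gl n" "W \<in> gl n" for U V W :: "'r mat"
    unfolding bracket_def using that m
    by (simp add: minus_mult_distrib_mat[of _ "Suc n" "Suc n"] mult_minus_distrib_mat[of _ "Suc n" "Suc n" _ "Suc n"] assoc_mult_mat[of _ "Suc n" "Suc n" _ "Suc n" _ "Suc n"])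
  show ?thesis
    unfolding *[OF A B C] *[OF A C B] **[OF A B C]
    by (rule gl_eqI[of _ n]) (use m A B C in \<open>auto simp del: index_mult_mat(1)\<close>)
qed

lemma trace_bracket:
  fixes A :: "'r::comm_ring mat"
  assumes "A \<in> gl n" "B \<in> gl n"
  shows "(\<Sum>i\<le>n. bracket A B $$ (i, i)) = 0"
proof -
  have "(\<Sum>i\<le>n. bracket A B $$ (i, i)) =
    (\<Sum>i\<le>n. \<Sum>k\<le>n. A $$ (i, k) * B $$ (k, i)) - (\<Sum>i\<le>n. \<Sum>k\<le>n. B $$ (i, k) * A $$ (k, i))"
    using assms by (simp add: index_bracket sum_subtractf)
  also have "(\<Sum>i\<le>n. \<Sum>k\<le>n. B $$ (i, k) * A $$ (k, i)) = (\<Sum>i\<le>n. \<Sum>k\<le>n. A $$ (i, k) * B $$ (k, i))"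
    by (subst sum.swap) (simp add: mult.commute)
  finally show ?thesis by simp
qed

lemma current_sl_bracket:
  "A \<in> current (sl n) \<Longrightarrow> B \<in> current (sl n) \<Longrightarrow> bracket A B \<in> current (sl n)"
  by (simp add: current_sl_iff trace_bracket)

lemma current_nil_neg_bracket:
  assumes "A \<in> current (nil_neg n)" "B \<in> current (nil_neg n)"
  shows "bracket A B \<in> current (nil_neg n)"
proof -
  have "A $$ (i, k) * B $$ (k, j) - B $$ (i, k) * A $$ (k, j) = 0"
    if "i \<le> j" "i \<le> n" "j \<le> n" "k \<le> n" for i j k
    using that assms by (cases "i \<le> k") (auto simp: current_nil_neg_iff)
  then show ?thesis using assms
    by (auto simp: current_nil_neg_iff index_bracket intro!: sum.neutral)
qed

lemma lie_algebra_sl: "lie_algebra_set (current (sl n))"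
proof
  fix c :: complex and x y
  assume x: "x \<in> current (sl n)"
  then have "(\<Sum>i\<le>n. ([:c:] \<cdot>\<^sub>m x) $$ (i, i)) = [:c:] * (\<Sum>i\<le>n. x $$ (i, i))"
    unfolding sum_distrib_left current_sl_iff by (intro sum.cong) auto
  with x show "[:c:] \<cdot>\<^sub>m x \<in> current (sl n)" by (simp add: current_sl_iff)
  assume y: "y \<in> current (sl n)"
  have "(\<Sum>i\<le>n. (x + y) $$ (i, i)) = (\<Sum>i\<le>n. x $$ (i, i)) + (\<Sum>i\<le>n. y $$ (i, i))"
    unfolding sum.distrib[symmetric] using x y by (intro sum.cong) (auto simp: current_sl_iff)
  with x y show "x + y \<in> current (sl n)" by (simp add: current_sl_iff)
  show "bracket x y \<in> current (sl n)" using x y by (rule current_sl_bracket)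
qed

lemma lie_algebra_nil_neg: "lie_algebra_set (current (nil_neg n))"
proof
  fix c :: complex and x y
  assume x: "x \<in> current (nil_neg n)"
  then show "[:c:] \<cdot>\<^sub>m x \<in> current (nil_neg n)" by (auto simp: current_nil_neg_iff)
  assume y: "y \<in> current (nil_neg n)"
  with x show "x + y \<in> current (nil_neg n)" by (auto simp: current_nil_neg_iff)
  show "bracket x y \<in> current (nil_neg n)" using x y by (rule current_nil_neg_bracket)
qed

interpretation sl: lie_algebra_set "current (sl n)" for n by (rule lie_algebra_sl)
interpretation nm: lie_algebra_set "current (nil_neg n)" for n by (rule lie_algebra_nil_neg)
interpretation slnm: lie_subalgebra_set "current (sl n)" "current (nil_neg n)" for n
  by unfold_locales (auto intro: current_nil_subset)
interpretation slsl: lie_subalgebra_set "current (sl n)" "current (sl n)" for n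
  by unfold_locales auto

section \<open>Triangular parts of a matrix\<close>

definition entries_where :: "nat \<Rightarrow> (nat \<Rightarrow> nat \<Rightarrow> bool) \<Rightarrow> 'a::zero mat \<Rightarrow> 'a mat" where
  "entries_where n P A = mat (Suc n) (Suc n) (\<lambda>(i, j). if P i j then A $$ (i, j) else 0)"

abbreviation "lower n \<equiv> entries_where n (\<lambda>i j. j < i)"
abbreviation "upper n \<equiv> entries_where n (\<lambda>i j. i < j)"
abbreviation "diag n \<equiv> entries_where n (\<lambda>i j. i = j)"

lemma entries_where_gl [simp]: "entries_where n P A \<in> gl n"
  by (simp add: entries_where_def)

lemma dim_entries_where [simp]:
  "dim_row (entries_where n P A) = Suc n" "dim_col (entries_where n P A) = Suc n"
  by (simp_all add: entries_where_def)

lemma index_entries_where [simp]: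
  "i \<le> n \<Longrightarrow> j \<le> n \<Longrightarrow> entries_where n P A $$ (i, j) = (if P i j then A $$ (i, j) else 0)"
  by (simp add: entries_where_def)

lemma entries_where_add:
  "A \<in> gl n \<Longrightarrow> B \<in> gl n \<Longrightarrow> entries_where n P (A + B) = entries_where n P A + entries_where n P (B :: 'a::monoid_add mat)"
  by (rule gl_eqI[of _ n]) auto

lemma entries_where_smult:
  "A \<in> gl n \<Longrightarrow> entries_where n P (c \<cdot>\<^sub>m A) = c \<cdot>\<^sub>m entries_where n P (A :: 'a::mult_zero mat)"
  by (rule gl_eqI[of _ n]) auto

lemma lower_nil_neg: "lower n A \<in> current (nil_neg n)"
  by (auto simp: current_nil_neg_iff)

lemma upper_nil_pos: "upper n A \<in> current (nil_pos n)"
  by (auto simp: current_nil_pos_iff)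

lemma diag_sl: "A \<in> current (sl n) \<Longrightarrow> diag n A \<in> current (sl n)"
  by (simp add: current_sl_iff)

lemma triangular_sum:
  "A \<in> gl n \<Longrightarrow> A = lower n A + (diag n A + upper n (A :: 'a::comm_monoid_add mat))"
  by (rule gl_eqI[of _ n]) auto

lemma lower_nil_neg_id: "A \<in> current (nil_neg n) \<Longrightarrow> lower n A = A"
  by (rule gl_eqI[of _ n]) (auto simp: current_nil_neg_iff)

text \<open>Write each matrix as its strictly lower part and an upper triangular rest. On or below the diagonal
  the bracket of the two rests is zero: below it because products of upper triangular matrices are upper
  triangular, on it because their diagonals commute.\<close>

lemma index_bracket_split:
  fixes A B :: "'r::comm_ring_1 mat"
  assumes A: "A \<in> gl n" and B: "B \<in> gl n" and ij: "i \<le> n" "j \<le> n" "j \<le> i"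
  shows "bracket A B $$ (i, j) =
    bracket A (lower n B) $$ (i, j) - bracket B (lower n A) $$ (i, j) - bracket (lower n A) (lower n B) $$ (i, j)"
proof -
  define u where "u V k l = (if l < k then 0 else V $$ (k, l))" for V :: "'r mat" and k l
  have "(\<Sum>k\<le>n. u A i k * u B k j - u B i k * u A k j) = 0"
  proof (rule sum.neutral, intro ballI)
    fix k assume "k \<in> {..n}"
    show "u A i k * u B k j - u B i k * u A k j = 0"
      using ij by (cases "k = i") (auto simp: u_def)
  qed
  moreover have "bracket A B $$ (i, j) - (bracket A (lower n B) $$ (i, j) -
      bracket B (lower n A) $$ (i, j) - bracket (lower n A) (lower n B) $$ (i, j)) =
      (\<Sum>k\<le>n. u A i k * u B k j - u B i k * u A k j)"
    using assms unfolding index_bracket[OF A B ij(1,2)] index_bracket[OF A entries_where_gl ij(1,2)]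
      index_bracket[OF B entries_where_gl ij(1,2)]
      index_bracket[OF entries_where_gl entries_where_gl ij(1,2)] sum_subtractf[symmetric]
    by (intro sum.cong) (auto simp: u_def algebra_simps)
  ultimately show ?thesis by simp
qed

text \<open>This identity, together with the one for the diagonal below, is the commutation relation of the
  action at the cyclic vector.\<close>

lemma lower_bracket:
  fixes A B :: "'r::comm_ring_1 mat"
  assumes A: "A \<in> gl n" and B: "B \<in> gl n"
  shows "lower n (bracket A B) + bracket (lower n A) (lower n B) + lower n (bracket B (lower n A)) =
    lower n (bracket A (lower n B))"
proof (rule gl_eqI[of _ n])
  fix i j assume ij: "i \<le> n" "j \<le> n"
  show "(lower n (bracket A B) + bracket (lower n A) (lower n B) + lower n (bracket B (lower n A))) $$ (i, j) =
    lower n (bracket A (lower n B)) $$ (i, j)"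
  proof (cases "j < i")
    case True
    then show ?thesis using index_bracket_split[OF A B ij] ij A B by simp
  next
    case False
    have "lower n A $$ (i, k) * lower n B $$ (k, j) - lower n B $$ (i, k) * lower n A $$ (k, j) = 0"
      if "k \<le> n" for k using False that ij by auto
    then have "bracket (lower n A) (lower n B) $$ (i, j) = 0"
      using ij by (simp add: index_bracket[OF entries_where_gl entries_where_gl] del: index_entries_where)
    then show ?thesis using False ij by simp
  qed
qed (use A B in auto)

lemma diag_bracket:
  fixes A B :: "'r::comm_ring_1 mat"
  assumes A: "A \<in> gl n" and B: "B \<in> gl n"
  shows "diag n (bracket A B) + diag n (bracket B (lower n A)) = diag n (bracket A (lower n B))"
proof (rule gl_eqI[of _ n])
  fix i j assume ij: "i \<le> n" "j \<le> n"
  show "(diag n (bracket A B) + diag n (bracket B (lower n A))) $$ (i, j) =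
    diag n (bracket A (lower n B)) $$ (i, j)"
  proof (cases "j = i")
    case True
    have "lower n A $$ (i, k) * lower n B $$ (k, j) - lower n B $$ (i, k) * lower n A $$ (k, j) = 0"
      if "k \<le> n" for k using True that ij by auto
    then have "bracket (lower n A) (lower n B) $$ (i, j) = 0"
      using ij by (simp add: index_bracket[OF entries_where_gl entries_where_gl] del: index_entries_where)
    then show ?thesis using True index_bracket_split[OF A B ij] ij A B by simp
  next
    case False
    then show ?thesis using ij by simp
  qed
qed (use A B in auto)

section \<open>The Verma action on the negative part\<close>

text \<open>The character of the Borel subalgebra: \<open>\<Lambda>\<close> on the \<open>t\<^sup>0\<close>-part of the diagonal.\<close>

definition diag_value :: "nat \<Rightarrow> weight \<Rightarrow> complex poly mat \<Rightarrow> complex" where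
  "diag_value n \<Lambda> A = \<Lambda> (map_mat (\<lambda>p. coeff p 0) (diag n A))"

text \<open>The only possible action of \<open>A\<close> on \<open>x\<^sub>1 \<cdots> x\<^sub>k v\<close> in a module with highest weight vector \<open>v\<close>. For
  \<open>A\<close> in \<open>\<nn>\<^sup>-[t]\<close> it is left multiplication, but only modulo the relations; treating all \<open>A\<close> alike keeps the
  recursion free of case distinctions.\<close>

fun act_word :: "nat \<Rightarrow> weight \<Rightarrow> complex poly mat \<Rightarrow> complex poly mat list \<Rightarrow> complex poly mat free_alg" where
  "act_word n \<Lambda> A [] = gen (lower n A) + scalar (diag_value n \<Lambda> A)"
| "act_word n \<Lambda> A (x # w) = gen x * act_word n \<Lambda> A w + act_word n \<Lambda> (bracket A x) w"

locale linear_weight =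
  fixes n :: nat and \<Lambda> :: weight
  assumes \<Lambda>_add: "\<And>H K. H \<in> cartan n \<Longrightarrow> K \<in> cartan n \<Longrightarrow> \<Lambda> (H + K) = \<Lambda> H + \<Lambda> K"
    and \<Lambda>_smult: "\<And>c H. H \<in> cartan n \<Longrightarrow> \<Lambda> (c \<cdot>\<^sub>m H) = c * \<Lambda> H"
begin

abbreviation "\<gg> \<equiv> current (sl n)"
abbreviation "\<nn> \<equiv> current (nil_neg n)"
abbreviation "top_value \<equiv> diag_value n \<Lambda>"

lemmas \<gg>_gl = current_subset_gl(1)[of _ n] and \<nn>_\<gg> = current_nil_subset(1)[of _ n]

lemma coeff_diag_cartan:
  assumes "A \<in> \<gg>"
  shows "map_mat (\<lambda>p. coeff p 0) (diag n A) \<in> cartan n"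
proof -
  have "map_mat (\<lambda>p. coeff p 0) (diag n A) \<in> sl n"
    using diag_sl[OF assms] by (simp add: current_def)
  then show ?thesis by (auto simp: cartan_def diagonal_mat_def)
qed

lemma diag_value_add:
  assumes "A \<in> \<gg>" "B \<in> \<gg>"
  shows "top_value (A + B) = top_value A + top_value B"
proof -
  have "map_mat (\<lambda>p. coeff p 0) (diag n (A + B)) =
    map_mat (\<lambda>p. coeff p 0) (diag n A) + map_mat (\<lambda>p. coeff p 0) (diag n B)"
    using assms[THEN \<gg>_gl] by (intro gl_eqI[of _ n]) auto
  then show ?thesis using assms by (simp add: diag_value_def \<Lambda>_add coeff_diag_cartan)
qed

lemma diag_value_smult:
  assumes "A \<in> \<gg>"
  shows "top_value ([:c:] \<cdot>\<^sub>m A) = c * top_value A"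
proof -
  have "map_mat (\<lambda>p. coeff p 0) (diag n ([:c:] \<cdot>\<^sub>m A)) = c \<cdot>\<^sub>m map_mat (\<lambda>p. coeff p 0) (diag n A)"
    using assms[THEN \<gg>_gl] by (intro gl_eqI[of _ n]) auto
  then show ?thesis using assms by (simp add: diag_value_def \<Lambda>_smult coeff_diag_cartan)
qed

lemma diag_value_cong: "diag n A = diag n B \<Longrightarrow> top_value A = top_value B"
  by (simp add: diag_value_def)

lemma diag_value_nilpotent:
  assumes "A \<in> gl n" "\<And>i. i \<le> n \<Longrightarrow> A $$ (i, i) = 0"
  shows "top_value A = 0"
proof -
  have 0: "0\<^sub>m (Suc n) (Suc n) \<in> \<gg>" by (simp add: current_sl_iff)
  have "diag n A = diag n (0\<^sub>m (Suc n) (Suc n))"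
    using assms by (intro gl_eqI[of _ n]) auto
  moreover have "top_value ([:0:] \<cdot>\<^sub>m 0\<^sub>m (Suc n) (Suc n)) = 0" using diag_value_smult[OF 0, of 0] by simp
  moreover have "[:0:] \<cdot>\<^sub>m 0\<^sub>m (Suc n) (Suc n) = (0\<^sub>m (Suc n) (Suc n) :: complex poly mat)" by auto
  ultimately show ?thesis by (metis diag_value_cong)
qed

lemma diag_value_\<nn>: "A \<in> \<nn> \<Longrightarrow> top_value A = 0"
  by (rule diag_value_nilpotent) (auto simp: current_nil_neg_iff)

lemma diag_value_bracket:
  assumes "A \<in> \<gg>" "B \<in> \<gg>"
  shows "top_value (bracket A B) + top_value (bracket B (lower n A)) = top_value (bracket A (lower n B))"
proof -
  have l: "lower n A \<in> \<gg>" "lower n B \<in> \<gg>" using lower_nil_neg \<nn>_\<gg> by blast+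
  have "top_value (bracket A B) + top_value (bracket B (lower n A)) = top_value (bracket A B + bracket B (lower n A))"
    using assms l by (simp add: diag_value_add current_sl_bracket)
  also have "\<dots> = top_value (bracket A (lower n B))"
    using diag_bracket[OF assms[THEN \<gg>_gl]] assms[THEN \<gg>_gl]
    by (intro diag_value_cong) (simp add: entries_where_add)
  finally show ?thesis .
qed

definition act :: "complex poly mat \<Rightarrow> complex poly mat free_alg \<Rightarrow> complex poly mat free_alg" where
  "act A = linear_extension (act_word n \<Lambda> A)"

lemma act_add: "act A (p + q) = act A p + act A q"
  and act_scalar: "act A (scalar c * p) = scalar c * act A p"
  and act_diff: "act A (p - q) = act A p - act A q"
  by (simp_all add: act_def linear_extension_add linear_extension_scalar linear_extension_diff)

lemma act_one: "act A 1 = gen (lower n A) + scalar (top_value A)"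
  by (simp add: act_def linear_extension_word flip: word_Nil)

lemma act_gen: "act A (gen x * p) = gen x * act A p + act (bracket A x) p"
proof -
  have "p \<in> alg UNIV" by (simp add: alg_iff)
  then show ?thesis
  proof (induction rule: alg_induct_words)
    case (word w)
    then show ?case by (simp add: act_def linear_extension_word flip: word_Cons)
  qed (simp_all add: act_add act_scalar distrib_left scalar_left_commute)
qed

lemma bracket_\<gg>_\<nn>: "A \<in> \<gg> \<Longrightarrow> x \<in> \<nn> \<Longrightarrow> bracket A x \<in> \<gg>"
  by (intro current_sl_bracket) (auto intro: \<nn>_\<gg>)

lemma act_closed: "p \<in> alg \<nn> \<Longrightarrow> A \<in> \<gg> \<Longrightarrow> act A p \<in> alg \<nn>"
proof (induction arbitrary: A rule: alg_induct)
  case (gen x p)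
  then show ?case by (simp add: act_gen bracket_\<gg>_\<nn>)
qed (simp_all add: act_one act_add act_scalar lower_nil_neg)

lemma act_add_letter:
  "p \<in> alg \<nn> \<Longrightarrow> A \<in> \<gg> \<Longrightarrow> B \<in> \<gg> \<Longrightarrow> act (A + B) p - act A p - act B p \<in> uea_ideal \<nn>"
proof (induction arbitrary: A B rule: alg_induct)
  case one
  then show ?case using nm.uea_rel_add[OF lower_nil_neg[of n A] lower_nil_neg[of n B]]
    by (simp add: act_one entries_where_add[OF \<gg>_gl \<gg>_gl] diag_value_add scalar_simps algebra_simps)
next
  case (add p q)
  have "act (A + B) (p + q) - act A (p + q) - act B (p + q) =
    (act (A + B) p - act A p - act B p) + (act (A + B) q - act A q - act B q)"
    by (simp add: act_add)
  then show ?case using add by (simp add: nm.uea_ideal_add)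
next
  case (scalar c p)
  have "act (A + B) (scalar c * p) - act A (scalar c * p) - act B (scalar c * p) =
    scalar c * (act (A + B) p - act A p - act B p)"
    by (simp add: act_scalar right_diff_distrib)
  then show ?case using scalar by (simp add: nm.uea_ideal_left)
next
  case (gen x p)
  have "bracket (A + B) x = bracket A x + bracket B x"
    using gen.prems gen.hyps by (intro bracket_add_left[of _ n]) (auto intro: \<gg>_gl \<nn>_\<gg>)
  then have "act (A + B) (gen x * p) - act A (gen x * p) - act B (gen x * p) =
    gen x * (act (A + B) p - act A p - act B p) +
    (act (bracket A x + bracket B x) p - act (bracket A x) p - act (bracket B x) p)"
    by (simp add: act_gen algebra_simps)
  then show ?case using gen by (simp add: nm.uea_ideal_left nm.uea_ideal_add bracket_\<gg>_\<nn>)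
qed

lemma act_smult_letter:
  "p \<in> alg \<nn> \<Longrightarrow> A \<in> \<gg> \<Longrightarrow> act ([:c:] \<cdot>\<^sub>m A) p - scalar c * act A p \<in> uea_ideal \<nn>"
proof (induction arbitrary: A rule: alg_induct)
  case one
  then show ?case using nm.uea_rel_smult[OF lower_nil_neg[of n A], of c]
    by (simp add: act_one entries_where_smult[OF \<gg>_gl] diag_value_smult scalar_simps algebra_simps)
next
  case (add p q)
  have "act ([:c:] \<cdot>\<^sub>m A) (p + q) - scalar c * act A (p + q) =
    (act ([:c:] \<cdot>\<^sub>m A) p - scalar c * act A p) + (act ([:c:] \<cdot>\<^sub>m A) q - scalar c * act A q)"
    by (simp add: act_add distrib_left)
  then show ?case using add by (simp add: nm.uea_ideal_add)
next
  case (scalar d p)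
  have "act ([:c:] \<cdot>\<^sub>m A) (scalar d * p) - scalar c * act A (scalar d * p) =
    scalar d * (act ([:c:] \<cdot>\<^sub>m A) p - scalar c * act A p)"
    by (simp add: act_scalar right_diff_distrib scalar_left_commute[of "scalar d" c])
  then show ?case using scalar by (simp add: nm.uea_ideal_left)
next
  case (gen x p)
  have "bracket ([:c:] \<cdot>\<^sub>m A) x = [:c:] \<cdot>\<^sub>m bracket A x"
    using gen.prems gen.hyps by (intro bracket_smult_left[of _ n]) (auto intro: \<gg>_gl \<nn>_\<gg>)
  then have "act ([:c:] \<cdot>\<^sub>m A) (gen x * p) - scalar c * act A (gen x * p) =
    gen x * (act ([:c:] \<cdot>\<^sub>m A) p - scalar c * act A p) +
    (act ([:c:] \<cdot>\<^sub>m bracket A x) p - scalar c * act (bracket A x) p)"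
    by (simp only: act_gen distrib_left right_diff_distrib scalar_left_commute[of "gen x"]) simp
  then show ?case using gen by (simp add: nm.uea_ideal_left nm.uea_ideal_add bracket_\<gg>_\<nn>)
qed

text \<open>Letters on the left are harmless, because the recursion passes to brackets with \<open>A\<close>, which are again
  in \<open>\<gg>\<close>.\<close>

lemma act_left_ideal:
  assumes "\<And>A. A \<in> \<gg> \<Longrightarrow> act A q \<in> uea_ideal \<nn>"
  shows "v \<in> alg \<nn> \<Longrightarrow> A \<in> \<gg> \<Longrightarrow> act A (v * q) \<in> uea_ideal \<nn>"
proof (induction arbitrary: A rule: alg_induct)
  case (gen x p)
  then show ?case
    by (simp add: act_gen mult.assoc bracket_\<gg>_\<nn> nm.uea_ideal_left nm.uea_ideal_add)
qed (simp_all add: assms act_add act_scalar distrib_right nm.uea_ideal_add nm.uea_ideal_left mult.assoc)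

text \<open>The action is well defined on \<open>U\<^sup>-\<close>. Relations occur inside words, so the induction has to be over
  all right multiples \<open>r u\<close>. For the bracket relation the terms in which \<open>A\<close> meets one letter cancel, and
  those in which it meets both letters cancel by the Jacobi identity.\<close>

lemma act_uea_ideal:
  assumes "r \<in> uea_ideal \<nn>" "A \<in> \<gg>"
  shows "act A r \<in> uea_ideal \<nn>"
proof -
  have "\<forall>u\<in>alg \<nn>. \<forall>A\<in>\<gg>. act A (r * u) \<in> uea_ideal \<nn>"
    using assms(1)
  proof (induction rule: nm.uea_ideal_induct)
    case zero
    have "act A 0 = 0" for A using act_scalar[of A 0 0] by (simp add: scalar_simps)
    then show ?case by (simp add: nm.uea_ideal_0)
  next
    case (add p q)
    then show ?case by (simp add: distrib_right act_add nm.uea_ideal_add)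
  next
    case (left u p)
    then show ?case by (simp add: mult.assoc act_left_ideal)
  next
    case (right u p)
    then show ?case by (simp add: mult.assoc)
  next
    case (rel_add x y)
    show ?case
    proof (intro ballI)
      fix u A assume u: "u \<in> alg \<nn>" and A: "A \<in> \<gg>"
      have "bracket A (x + y) = bracket A x + bracket A y"
        using A rel_add by (intro bracket_add_right[of _ n]) (auto intro: \<gg>_gl \<nn>_\<gg>)
      then have "act A ((gen (x + y) - gen x - gen y) * u) = (gen (x + y) - gen x - gen y) * act A u +
        (act (bracket A x + bracket A y) u - act (bracket A x) u - act (bracket A y) u)"
        by (simp only: left_diff_distrib act_diff act_gen) (simp add: algebra_simps)
      also have "\<dots> \<in> uea_ideal \<nn>"
        using rel_add u A
        by (intro nm.uea_ideal_add nm.uea_ideal_right nm.uea_rel_add act_add_letter act_closed bracket_\<gg>_\<nn>)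
      finally show "act A ((gen (x + y) - gen x - gen y) * u) \<in> uea_ideal \<nn>" .
    qed
  next
    case (rel_smult c x)
    show ?case
    proof (intro ballI)
      fix u A assume u: "u \<in> alg \<nn>" and A: "A \<in> \<gg>"
      have "bracket A ([:c:] \<cdot>\<^sub>m x) = [:c:] \<cdot>\<^sub>m bracket A x"
        using A rel_smult by (intro bracket_smult_right[of _ n]) (auto intro: \<gg>_gl \<nn>_\<gg>)
      then have "act A ((gen ([:c:] \<cdot>\<^sub>m x) - scalar c * gen x) * u) =
        (gen ([:c:] \<cdot>\<^sub>m x) - scalar c * gen x) * act A u +
        (act ([:c:] \<cdot>\<^sub>m bracket A x) u - scalar c * act (bracket A x) u)"
        by (simp only: left_diff_distrib act_diff act_gen act_scalar mult.assoc) (simp add: algebra_simps)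
      also have "\<dots> \<in> uea_ideal \<nn>"
        using rel_smult u A
        by (intro nm.uea_ideal_add nm.uea_ideal_right nm.uea_rel_smult act_smult_letter act_closed bracket_\<gg>_\<nn>)
      finally show "act A ((gen ([:c:] \<cdot>\<^sub>m x) - scalar c * gen x) * u) \<in> uea_ideal \<nn>" .
    qed
  next
    case (rel_bracket x y)
    show ?case
    proof (intro ballI)
      fix u A assume u: "u \<in> alg \<nn>" and A: "A \<in> \<gg>"
      have gl: "A \<in> gl n" "x \<in> gl n" "y \<in> gl n" using A rel_bracket by (auto intro: \<gg>_gl \<nn>_\<gg>)
      let ?axy = "bracket (bracket A x) y" and ?ayx = "bracket (bracket A y) x"
        and ?a_xy = "bracket A (bracket x y)"
      have J: "?axy = ?ayx + ?a_xy" using gl by (rule bracket_Jacobi)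
      have "act A ((gen x * gen y - gen y * gen x - gen (bracket x y)) * u) =
        (gen x * gen y - gen y * gen x - gen (bracket x y)) * act A u +
        (act (?ayx + ?a_xy) u - act ?ayx u - act ?a_xy u)"
        unfolding J[symmetric]
        by (simp only: left_diff_distrib act_diff act_gen mult.assoc) (simp add: algebra_simps)
      also have "\<dots> \<in> uea_ideal \<nn>"
        using rel_bracket u A
        by (intro nm.uea_ideal_add nm.uea_ideal_right nm.uea_rel_bracket act_add_letter act_closed
            bracket_\<gg>_\<nn> current_nil_neg_bracket)
      finally show "act A ((gen x * gen y - gen y * gen x - gen (bracket x y)) * u) \<in> uea_ideal \<nn>" .
    qed
  qed
  from this[rule_format, of 1 A] assms(2) show ?thesis by simp
qed

text \<open>The action is a representation. At the cyclic vector this is the identity for the triangular parts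
  of a bracket; for longer words it follows from the Jacobi identity.\<close>

lemma act_bracket:
  "p \<in> alg \<nn> \<Longrightarrow> A \<in> \<gg> \<Longrightarrow> B \<in> \<gg> \<Longrightarrow>
    act A (act B p) - act B (act A p) - act (bracket A B) p \<in> uea_ideal \<nn>"
proof (induction arbitrary: A B rule: alg_induct)
  case one
  let ?a = "lower n A" and ?b = "lower n B"
  let ?ab = "lower n (bracket A B)" and ?ba = "lower n (bracket B (lower n A))"
  have ab: "act A (act B 1) = gen (lower n B) * gen (lower n A) + scalar (top_value A) * gen (lower n B) +
    (gen (lower n (bracket A (lower n B))) + scalar (top_value (bracket A (lower n B)))) +
    (scalar (top_value B) * gen (lower n A) + scalar (top_value B * top_value A))" for A B
    using act_gen[of A "lower n B" 1] act_scalar[of A "top_value B" 1]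
    by (simp add: act_one act_add distrib_left scalar_simps
        scalar_commute[of "top_value A" "gen (lower n B)"])
  have v: "top_value (bracket A ?b) = top_value (bracket A B) + top_value (bracket B ?a)"
    using diag_value_bracket[OF one] by simp
  have g: "?ab + bracket ?a ?b + ?ba = lower n (bracket A ?b)"
    by (rule lower_bracket) (use one \<gg>_gl in auto)
  have "gen (lower n (bracket A ?b)) - gen (?ab + bracket ?a ?b) - gen ?ba \<in> uea_ideal \<nn>"
    unfolding g[symmetric]
    by (intro nm.uea_rel_add nm.L_add lower_nil_neg current_nil_neg_bracket)
  from nm.uea_ideal_diff[OF nm.uea_ideal_add[OF this
      nm.uea_rel_add[OF lower_nil_neg[of n "bracket A B"] current_nil_neg_bracket]]
      nm.uea_rel_bracket[OF lower_nil_neg[of n A] lower_nil_neg[of n B]],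
      OF lower_nil_neg[of n A] lower_nil_neg[of n B]]
  show ?case
    unfolding ab unfolding v act_one by (simp add: algebra_simps scalar_simps(3))
next
  case (add p q)
  have "act A (act B (p + q)) - act B (act A (p + q)) - act (bracket A B) (p + q) =
    (act A (act B p) - act B (act A p) - act (bracket A B) p) +
    (act A (act B q) - act B (act A q) - act (bracket A B) q)"
    by (simp add: act_add)
  then show ?case using add by (simp add: nm.uea_ideal_add)
next
  case (scalar c p)
  have "act A (act B (scalar c * p)) - act B (act A (scalar c * p)) - act (bracket A B) (scalar c * p) =
    scalar c * (act A (act B p) - act B (act A p) - act (bracket A B) p)"
    by (simp add: act_scalar right_diff_distrib)
  then show ?case using scalar by (simp add: nm.uea_ideal_left)
next
  case (gen x p)
  let ?d = "\<lambda>A B. act A (act B p) - act B (act A p) - act (bracket A B) p"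
  let ?u = "bracket (bracket A x) B" and ?v = "bracket A (bracket B x)"
  have J: "bracket (bracket A B) x = ?u + ?v"
    by (rule bracket_Jacobi) (use gen \<gg>_gl \<nn>_\<gg> in auto)
  have "act A (act B (gen x * p)) - act B (act A (gen x * p)) - act (bracket A B) (gen x * p) =
    gen x * ?d A B + ?d (bracket A x) B + ?d A (bracket B x) -
    (act (?u + ?v) p - act ?u p - act ?v p)"
    by (simp add: act_gen act_add J algebra_simps)
  also have "\<dots> \<in> uea_ideal \<nn>"
    using gen by (intro nm.uea_ideal_add nm.uea_ideal_diff nm.uea_ideal_left gen.IH alg_gen
        act_add_letter bracket_\<gg>_\<nn> current_sl_bracket)
  finally show ?case .
qed

lemma act_lower:
  "p \<in> alg \<nn> \<Longrightarrow> x \<in> \<nn> \<Longrightarrow> act x p - gen x * p \<in> uea_ideal \<nn>"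
proof (induction arbitrary: x rule: alg_induct)
  case one
  then show ?case by (simp add: act_one lower_nil_neg_id diag_value_\<nn> scalar_simps nm.uea_ideal_0)
next
  case (add p q)
  have "act x (p + q) - gen x * (p + q) = (act x p - gen x * p) + (act x q - gen x * q)"
    by (simp add: act_add distrib_left)
  then show ?case using add by (simp add: nm.uea_ideal_add)
next
  case (scalar c p)
  have "act x (scalar c * p) - gen x * (scalar c * p) = scalar c * (act x p - gen x * p)"
    by (simp add: act_scalar right_diff_distrib scalar_left_commute)
  then show ?case using scalar by (simp add: nm.uea_ideal_left)
next
  case (gen y p)
  have "act x (gen y * p) - gen x * (gen y * p) = gen y * (act x p - gen x * p) +
    (act (bracket x y) p - gen (bracket x y) * p) - (gen x * gen y - gen y * gen x - gen (bracket x y)) * p"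
    by (simp add: act_gen algebra_simps)
  also have "\<dots> \<in> uea_ideal \<nn>"
    using gen by (intro nm.uea_ideal_add nm.uea_ideal_diff nm.uea_ideal_left nm.uea_ideal_right
        nm.uea_rel_bracket gen.IH alg_gen current_nil_neg_bracket)
  finally show ?case .
qed

text \<open>The action of the free algebra on all of \<open>\<gg>\<close>, letter by letter.\<close>

definition Act :: "complex poly mat free_alg \<Rightarrow> complex poly mat free_alg \<Rightarrow> complex poly mat free_alg" where
  "Act p q = linear_extension (\<lambda>w. foldr act w q) p"

lemma Act_add: "Act (p + p') q = Act p q + Act p' q"
  and Act_scalar: "Act (scalar c * p) q = scalar c * Act p q"
  and Act_diff: "Act (p - p') q = Act p q - Act p' q"
  by (simp_all add: Act_def linear_extension_add linear_extension_scalar linear_extension_diff)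

lemma Act_one: "Act 1 q = q"
  by (simp add: Act_def linear_extension_word flip: word_Nil)

lemma Act_gen: "Act (gen A * p) q = act A (Act p q)"
proof -
  have "p \<in> alg UNIV" by (simp add: alg_iff)
  then show ?thesis
  proof (induction rule: alg_induct_words)
    case (word w)
    then show ?case by (simp add: Act_def linear_extension_word flip: word_Cons)
  qed (simp_all add: Act_add Act_scalar act_add act_scalar distrib_left scalar_left_commute)
qed

lemma Act_letter: "Act (gen A) q = act A q"
  using Act_gen[of A 1 q] by (simp add: Act_one)

lemma Act_mult: "Act (p * p') q = Act p (Act p' q)"
proof -
  have "p \<in> alg UNIV" by (simp add: alg_iff)
  then show ?thesis
    by (induction rule: alg_induct)
       (simp_all add: Act_add Act_scalar Act_gen Act_one distrib_right mult.assoc)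
qed

lemma Act_closed: "p \<in> alg \<gg> \<Longrightarrow> q \<in> alg \<nn> \<Longrightarrow> Act p q \<in> alg \<nn>"
  by (induction rule: alg_induct)
     (simp_all add: Act_add Act_scalar Act_gen Act_one act_closed)

lemma Act_ideal: "p \<in> alg \<gg> \<Longrightarrow> q \<in> uea_ideal \<nn> \<Longrightarrow> Act p q \<in> uea_ideal \<nn>"
  by (induction rule: alg_induct)
     (simp_all add: Act_add Act_scalar Act_gen Act_one act_uea_ideal nm.uea_ideal_add nm.uea_ideal_left)

lemma Act_relations:
  assumes "r \<in> uea_ideal \<gg>" "q \<in> alg \<nn>"
  shows "Act r q \<in> uea_ideal \<nn>"
  using assms
proof (induction arbitrary: q rule: sl.uea_ideal_induct)
  case zero
  then show ?case using Act_scalar[of 0 0 q] by (simp add: scalar_simps nm.uea_ideal_0)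
next
  case (rel_add x y)
  then show ?case by (simp add: Act_diff Act_letter act_add_letter)
next
  case (rel_smult c x)
  then show ?case by (simp add: Act_diff Act_scalar Act_letter act_smult_letter)
next
  case (rel_bracket x y)
  then show ?case by (simp add: Act_diff Act_gen Act_letter act_bracket)
qed (simp_all add: Act_add Act_mult Act_ideal Act_closed nm.uea_ideal_add)

lemma Act_lower: "p \<in> alg \<nn> \<Longrightarrow> Act p 1 - p \<in> uea_ideal \<nn>"
proof (induction rule: alg_induct)
  case (add p q)
  then show ?case using nm.uea_ideal_add[OF add.IH] by (simp add: Act_add algebra_simps)
next
  case (scalar c p)
  then show ?case using nm.uea_ideal_left[OF alg_scalar scalar.IH]
    by (simp add: Act_scalar right_diff_distrib)
next
  case (gen x p)
  have A: "Act p 1 \<in> alg \<nn>"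
    using gen by (intro Act_closed) (auto intro: alg_mono[OF _ gen.hyps(2)] \<nn>_\<gg>)
  have "Act (gen x * p) 1 - gen x * p = (act x (Act p 1) - gen x * Act p 1) + gen x * (Act p 1 - p)"
    by (simp add: Act_gen right_diff_distrib)
  also have "\<dots> \<in> uea_ideal \<nn>"
    using gen A by (intro nm.uea_ideal_add nm.uea_ideal_left act_lower) auto
  finally show ?case .
qed (simp add: Act_one nm.uea_ideal_0)

text \<open>The diagonal elements include the \<open>h \<otimes> t\<^sup>r\<close> with \<open>r \<ge> 1\<close>, on which \<open>top_value\<close> is zero.\<close>

definition verma_rels :: "complex poly mat free_alg set" where
  "verma_rels = {gen x |x. x \<in> current (nil_pos n)} \<union>
     {gen d - scalar (top_value d) |d. d \<in> \<gg> \<and> diag n d = d}"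

definition verma_ideal :: "complex poly mat free_alg set" where
  "verma_ideal = left_span (alg \<gg>) (verma_rels \<union> uea_ideal \<gg>)"

lemma verma_rels_subset: "verma_rels \<union> uea_ideal \<gg> \<subseteq> alg \<gg>"
  using sl.uea_ideal_alg by (auto simp: verma_rels_def current_nil_subset)

text \<open>Acting on \<open>1\<close> sends the Verma ideal to zero, because its generators act by zero, but is the identity
  on \<open>U\<^sup>-\<close>. Since the defining relations of \<open>U(\<gg>[t])\<close> are among the generators, this also contains the
  injectivity of \<open>U(\<nn>\<^sup>-[t]) \<rightarrow> U(\<gg>[t])\<close>.\<close>

theorem verma_ideal_Int_lower:
  assumes "p \<in> verma_ideal" "p \<in> alg \<nn>"
  shows "p \<in> uea_ideal \<nn>"
proof -
  have gen0: "gen (0\<^sub>m (Suc n) (Suc n)) \<in> uea_ideal \<nn>"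
  proof -
    have "0\<^sub>m (Suc n) (Suc n) \<in> \<nn>" by (simp add: current_nil_neg_iff)
    from nm.uea_rel_smult[OF this, of 0] show ?thesis
      by (simp add: scalar_simps smult_zero_mat)
  qed
  have "p \<in> alg \<gg> \<and> Act p 1 \<in> uea_ideal \<nn>"
    using assms(1) unfolding verma_ideal_def
  proof (induction rule: left_span.induct)
    case zero
    then show ?case using Act_scalar[of 0 0 1] by (simp add: scalar_simps nm.uea_ideal_0)
  next
    case (base w)
    then consider x where "x \<in> current (nil_pos n)" "w = gen x"
      | d where "d \<in> \<gg>" "diag n d = d" "w = gen d - scalar (top_value d)"
      | "w \<in> uea_ideal \<gg>" by (auto simp: verma_rels_def)
    then show ?case
    proof cases
      case 1
      have "lower n x = 0\<^sub>m (Suc n) (Suc n)"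
        using 1 by (intro gl_eqI[of _ n]) (auto simp: current_nil_pos_iff)
      moreover have "top_value x = 0"
        using 1 by (intro diag_value_nilpotent) (auto simp: current_nil_pos_iff)
      ultimately show ?thesis
        using 1 gen0 by (simp add: Act_letter act_one scalar_simps current_nil_subset)
    next
      case 2
      have "lower n (diag n d) = 0\<^sub>m (Suc n) (Suc n)" by (intro gl_eqI[of _ n]) auto
      then show ?thesis using 2 gen0 Act_scalar[of "top_value d" 1 1]
        by (simp add: Act_diff Act_one Act_letter act_one)
    next
      case 3
      then show ?thesis by (simp add: sl.uea_ideal_alg Act_relations)
    qed
  qed (simp_all add: Act_add Act_mult Act_ideal nm.uea_ideal_add)
  with nm.uea_ideal_diff[OF _ Act_lower[OF assms(2)], of "Act p 1"] show ?thesis by simp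
qed

end

section \<open>Roots and root vectors\<close>

text \<open>The root \<open>\<epsilon>\<^sub>a - \<epsilon>\<^sub>b\<close>, with \<open>\<epsilon>\<^sub>a\<close> the \<open>a\<close>-th diagonal entry; it is positive for \<open>a < b\<close>.\<close>

definition eps_root :: "nat \<Rightarrow> nat \<Rightarrow> weight" where
  "eps_root a b = (\<lambda>H. H $$ (a, a) - H $$ (b, b))"

definition single_entry :: "nat \<Rightarrow> nat \<Rightarrow> nat \<Rightarrow> 'a::zero \<Rightarrow> 'a mat" where
  "single_entry n p q c = mat (Suc n) (Suc n) (\<lambda>(i, j). if i = p \<and> j = q then c else 0)"

text \<open>The \<open>i\<close>-th fundamental coweight, dual to the simple roots; it reads off the coefficient of the \<open>i\<close>-th
  simple root.\<close>

definition coweight :: "nat \<Rightarrow> nat \<Rightarrow> complex mat" where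
  "coweight n i = mat (Suc n) (Suc n)
     (\<lambda>(p, q). if p = q then of_bool (p < i) - of_nat i / of_nat (Suc n) else 0)"

lemma simple_root_eq_root: "simple_root i = eps_root (i - 1) i"
  by (simp add: simple_root_def eps_root_def)

lemma root_eq_sum_simple_roots:
  assumes "a \<le> b" "b \<le> n"
  shows "eps_root a b = (\<lambda>H. \<Sum>i = 1..n. of_nat (of_bool (a < i \<and> i \<le> b)) * simple_root i H)"
proof
  fix H :: "complex mat"
  have "(\<Sum>i = 1..n. of_nat (of_bool (a < i \<and> i \<le> b)) * simple_root i H) =
    (\<Sum>i \<in> {a<..b}. simple_root i H)"
    by (rule sum.mono_neutral_cong_right) (use assms in auto)
  also have "\<dots> = eps_root a b H"
    using assms(1)
  proof (induction rule: dec_induct)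
    case (step m)
    then have "{a<..Suc m} = insert (Suc m) {a<..m}" by auto
    then show ?case using step by (simp add: simple_root_def eps_root_def)
  qed (simp add: eps_root_def)
  finally show "eps_root a b H = (\<Sum>i = 1..n. of_nat (of_bool (a < i \<and> i \<le> b)) * simple_root i H)" ..
qed

lemma QplusI: "(\<lambda>H. \<Sum>i = 1..n. of_nat (m i) * simple_root i H) \<in> Qplus n"
  unfolding Qplus_def by (rule CollectI, rule exI[of _ m]) simp

lemma root_Qplus: "a \<le> b \<Longrightarrow> b \<le> n \<Longrightarrow> eps_root a b \<in> Qplus n"
  using QplusI[of "\<lambda>i. of_bool (a < i \<and> i \<le> b)" n] by (simp only: root_eq_sum_simple_roots)

lemma Qplus_add:
  assumes "\<alpha> \<in> Qplus n" "\<beta> \<in> Qplus n"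
  shows "(\<lambda>H. \<alpha> H + \<beta> H) \<in> Qplus n"
proof -
  from assms obtain k l :: "nat \<Rightarrow> nat"
    where "\<alpha> = (\<lambda>H. \<Sum>i = 1..n. of_nat (k i) * simple_root i H)"
      "\<beta> = (\<lambda>H. \<Sum>i = 1..n. of_nat (l i) * simple_root i H)" unfolding Qplus_def by blast
  then have "(\<lambda>H. \<alpha> H + \<beta> H) = (\<lambda>H. \<Sum>i = 1..n. of_nat (k i + l i) * simple_root i H)"
    by (simp add: sum.distrib distrib_right)
  then show ?thesis using QplusI[of "\<lambda>i. k i + l i" n] by simp
qed

lemma root_ge_root:
  assumes "a \<le> c" "c \<le> d" "d \<le> b" "b \<le> n"
  shows "root_ge n (eps_root a b) (eps_root c d)"
proof -
  have "(\<lambda>H. eps_root a b H - eps_root c d H) = (\<lambda>H. eps_root a c H + eps_root d b H)"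
    by (simp add: eps_root_def fun_eq_iff)
  then show ?thesis using assms by (simp add: root_ge_def Qplus_add root_Qplus)
qed

lemma coweight_cartan: "i \<le> n \<Longrightarrow> coweight n i \<in> cartan n"
proof -
  assume i: "i \<le> n"
  have "(\<Sum>p\<le>n. coweight n i $$ (p, p)) =
    (\<Sum>p\<le>n. of_bool (p < i)) - (\<Sum>p\<le>n. of_nat i / of_nat (Suc n))"
    unfolding sum_subtractf[symmetric] by (rule sum.cong) (auto simp: coweight_def)
  also have "(\<Sum>p\<le>n. of_bool (p < i)) = (\<Sum>p<i. 1 :: complex)"
    by (rule sum.mono_neutral_cong_right) (use i in auto)
  also have "\<dots> - (\<Sum>p\<le>n. of_nat i / of_nat (Suc n)) = 0"
    by (simp add: field_simps del: of_nat_Suc)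
  finally show ?thesis by (auto simp: cartan_def sl_def diagonal_mat_def coweight_def)
qed

lemma root_coweight:
  "p \<le> n \<Longrightarrow> q \<le> n \<Longrightarrow> eps_root p q (coweight n i) = of_bool (p < i) - of_bool (q < i)"
  by (simp add: eps_root_def coweight_def)

lemma index_bracket_diagonal:
  fixes A :: "'r::comm_ring_1 mat"
  assumes "A \<in> gl n" "B \<in> gl n" "p \<le> n" "q \<le> n"
    and diag: "\<And>i j. i \<le> n \<Longrightarrow> j \<le> n \<Longrightarrow> i \<noteq> j \<Longrightarrow> A $$ (i, j) = 0"
  shows "bracket A B $$ (p, q) = (A $$ (p, p) - A $$ (q, q)) * B $$ (p, q)"
proof -
  have "(\<Sum>k\<le>n. A $$ (p, k) * B $$ (k, q)) = (\<Sum>k\<in>{p}. A $$ (p, k) * B $$ (k, q))"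
    by (rule sum.mono_neutral_right) (use assms in auto)
  moreover have "(\<Sum>k\<le>n. B $$ (p, k) * A $$ (k, q)) = (\<Sum>k\<in>{q}. B $$ (p, k) * A $$ (k, q))"
    by (rule sum.mono_neutral_right) (use assms in auto)
  ultimately show ?thesis using assms by (simp add: index_bracket sum_subtractf algebra_simps)
qed

lemma cartan_gl: "H \<in> cartan n \<Longrightarrow> H \<in> gl n"
  and cartan_offdiag: "H \<in> cartan n \<Longrightarrow> i \<le> n \<Longrightarrow> j \<le> n \<Longrightarrow> i \<noteq> j \<Longrightarrow> H $$ (i, j) = 0"
  by (auto simp: cartan_def sl_def diagonal_mat_def)

lemma root_space_entry:
  assumes x: "x \<in> root_space n \<alpha>" and pq: "p \<le> n" "q \<le> n" "x $$ (p, q) \<noteq> 0" and H: "H \<in> cartan n"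
  shows "\<alpha> H = eps_root p q H"
proof -
  have "x \<in> gl n" using x by (simp add: root_space_def sl_def)
  then have "bracket H x $$ (p, q) = eps_root p q H * x $$ (p, q)"
    using index_bracket_diagonal[OF cartan_gl[OF H] _ pq(1,2) cartan_offdiag[OF H]]
    by (simp add: eps_root_def)
  moreover have "bracket H x = \<alpha> H \<cdot>\<^sub>m x" using x H by (simp add: root_space_def)
  ultimately show ?thesis using pq \<open>x \<in> gl n\<close> by simp
qed

lemma single_entry_gl [simp]: "single_entry n p q c \<in> gl n"
  and dim_single_entry [simp]: "dim_row (single_entry n p q c) = Suc n"
    "dim_col (single_entry n p q c) = Suc n"
  and index_single_entry [simp]: "i \<le> n \<Longrightarrow> j \<le> n \<Longrightarrow>
    single_entry n p q c $$ (i, j) = (if i = p \<and> j = q then c else 0)"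
  by (simp_all add: single_entry_def)

lemma sl_if_offdiag:
  "x \<in> gl n \<Longrightarrow> (\<And>i. i \<le> n \<Longrightarrow> x $$ (i, i) = 0) \<Longrightarrow> x \<in> sl n"
  by (simp add: sl_def)

lemma single_entry_root_space:
  assumes "p \<noteq> q"
  shows "single_entry n p q c \<in> root_space n (eps_root p q)"
proof -
  have "bracket H (single_entry n p q c) = eps_root p q H \<cdot>\<^sub>m single_entry n p q c" if H: "H \<in> cartan n" for H
  proof (rule gl_eqI[of _ n])
    fix i j assume ij: "i \<le> n" "j \<le> n"
    show "bracket H (single_entry n p q c) $$ (i, j) = (eps_root p q H \<cdot>\<^sub>m single_entry n p q c) $$ (i, j)"
      using index_bracket_diagonal[OF cartan_gl[OF H] single_entry_gl ij cartan_offdiag[OF H]] ij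
      by (simp add: eps_root_def)
  qed (use cartan_gl[OF H] in simp_all)
  then show ?thesis using assms by (auto simp: root_space_def intro: sl_if_offdiag)
qed

lemma root_pos_roots:
  assumes "a < b" "b \<le> n"
  shows "eps_root a b \<in> pos_roots n"
proof -
  have "eps_root a b (coweight n b) = 1" using assms by (simp add: root_coweight)
  then have "eps_root a b \<noteq> (\<lambda>H. 0)" by (metis zero_neq_one)
  moreover have "single_entry n a b 1 \<noteq> (0\<^sub>m (Suc n) (Suc n) :: complex mat)"
  proof
    assume "single_entry n a b 1 = (0\<^sub>m (Suc n) (Suc n) :: complex mat)"
    then have "single_entry n a b 1 $$ (a, b) = (0\<^sub>m (Suc n) (Suc n) :: complex mat) $$ (a, b)" by simp
    then show False using assms by simp
  qed
  moreover have "single_entry n a b 1 \<in> root_space n (eps_root a b)" "eps_root a b \<in> Qplus n"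
    using assms root_Qplus[of a b n] single_entry_root_space[of a b n 1] by auto
  ultimately show ?thesis unfolding pos_roots_def by blast
qed

text \<open>A nonzero entry \<open>(p, q)\<close> of a root vector forces \<open>\<alpha> = \<epsilon>\<^sub>p - \<epsilon>\<^sub>q\<close> on the Cartan subalgebra. Evaluation at the
  coweights compares the coefficients of the simple roots, which are non-negative for \<open>\<alpha>\<close>; this forces
  \<open>p < q\<close>.\<close>

lemma pos_rootsE:
  assumes "\<alpha> \<in> pos_roots n"
  obtains a b where "a < b" "b \<le> n" "\<alpha> = eps_root a b"
proof -
  from assms obtain m :: "nat \<Rightarrow> nat" where m: "\<alpha> = (\<lambda>H. \<Sum>i = 1..n. of_nat (m i) * simple_root i H)"
    unfolding pos_roots_def Qplus_def by blast
  have "0\<^sub>m (Suc n) (Suc n) \<in> root_space n \<alpha>"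
    by (auto simp: root_space_def sl_def bracket_def cartan_def)
  with assms obtain x where x: "x \<in> root_space n \<alpha>" "x \<noteq> 0\<^sub>m (Suc n) (Suc n)"
    unfolding pos_roots_def by blast
  then have "x \<in> gl n" by (simp add: root_space_def sl_def)
  with x(2) obtain p q where pq: "p \<le> n" "q \<le> n" "x $$ (p, q) \<noteq> 0"
    using gl_eqI[of x n "0\<^sub>m (Suc n) (Suc n)"] by auto
  have mi: "of_nat (m i) = (of_bool (p < i) - of_bool (q < i) :: complex)" if i: "i \<in> {1..n}" for i
  proof -
    \<comment> \<open>Only \<open>j = i\<close> satisfies \<open>j - 1 < i \<le> j\<close>.\<close>
    have "\<alpha> (coweight n i) = (\<Sum>j = 1..n. if j = i then of_nat (m i) else 0)"
      unfolding m by (rule sum.cong) (auto simp: simple_root_eq_root root_coweight of_bool_def split: if_splits)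
    then have "\<alpha> (coweight n i) = of_nat (m i)" using i by simp
    moreover have "\<alpha> (coweight n i) = eps_root p q (coweight n i)"
      using i by (intro root_space_entry[OF x(1) pq] coweight_cartan) simp
    ultimately show ?thesis using pq by (simp add: root_coweight)
  qed
  have *: "\<not> (q < i \<and> i \<le> p)" if "i \<in> {1..n}" for i
  proof
    assume "q < i \<and> i \<le> p"
    with mi[OF that] have "of_nat (m i + 1) = (0 :: complex)" by simp
    then show False by (simp only: of_nat_eq_0_iff)
  qed
  have "p \<le> q" using *[of p] pq by (cases "p \<le> q") auto
  have "m i = of_bool (p < i \<and> i \<le> q)" if "i \<in> {1..n}" for i
  proof -
    have "of_nat (m i) = (of_nat (of_bool (p < i \<and> i \<le> q)) :: complex)"
      using mi[OF that] \<open>p \<le> q\<close> by (auto simp: not_less)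
    then show ?thesis by (simp only: of_nat_eq_iff)
  qed
  then have "\<alpha> = eps_root p q"
    unfolding m root_eq_sum_simple_roots[OF \<open>p \<le> q\<close> pq(2)] by (intro ext sum.cong) auto
  moreover have "p \<noteq> q" using assms \<open>\<alpha> = eps_root p q\<close> by (auto simp: pos_roots_def eps_root_def)
  ultimately show ?thesis using that[of p q] pq \<open>p \<le> q\<close> by linarith
qed

lemma finite_pos_roots: "finite (pos_roots n)"
proof (rule finite_subset)
  show "pos_roots n \<subseteq> (\<lambda>(a, b). eps_root a b) ` ({..n} \<times> {..n})"
  proof
    fix \<alpha> assume "\<alpha> \<in> pos_roots n"
    then obtain a b where "a < b" "b \<le> n" "\<alpha> = eps_root a b" by (rule pos_rootsE)
    then show "\<alpha> \<in> (\<lambda>(a, b). eps_root a b) ` ({..n} \<times> {..n})"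
      by (intro image_eqI[of _ _ "(a, b)"]) auto
  qed
qed simp

lemma xi_min_le:
  assumes "\<beta> \<in> pos_roots n" "root_ge n \<beta> \<alpha>"
  shows "xi_min n \<xi> \<alpha> \<le> \<xi> \<beta>"
proof -
  have "finite {\<xi> \<beta> |\<beta>. \<beta> \<in> pos_roots n \<and> root_ge n \<beta> \<alpha>}" using finite_pos_roots by simp
  then show ?thesis unfolding xi_min_def by (rule Min_le) (use assms in blast)
qed

text \<open>The root spaces are lines: the root determines the positions of the nonzero entries, as one sees by
  evaluation at the coweights where the two sides can jump.\<close>

lemma neg_root_vectorE:
  assumes xm: "neg_root_vectors n xm" and ab: "a < b" "b \<le> n"
  obtains c where "c \<noteq> 0" "xm (eps_root a b) = single_entry n b a c"
proof -
  let ?x = "xm (eps_root a b)"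
  have x: "?x \<in> root_space n (\<lambda>H. - eps_root a b H)" "?x \<noteq> 0\<^sub>m (Suc n) (Suc n)"
    using xm root_pos_roots[OF ab] by (auto simp: neg_root_vectors_def)
  then have g: "?x \<in> gl n" by (simp add: root_space_def sl_def)
  have entry: "p = b \<and> q = a" if pq: "p \<le> n" "q \<le> n" "?x $$ (p, q) \<noteq> 0" for p q
  proof -
    have eq: "of_bool (b < i) - of_bool (a < i) = (of_bool (p < i) - of_bool (q < i) :: complex)"
      if "i \<le> n" for i
      using root_space_entry[OF x(1) pq coweight_cartan[OF that]] pq ab
      by (simp add: root_coweight)
    have "q < b" "b \<le> p" using eq[of b] ab by (auto simp: of_bool_def split: if_splits)
    moreover have "p \<le> b" using eq[of "Suc b"] ab pq \<open>q < b\<close>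
      by (cases "b = n") (auto simp: of_bool_def split: if_splits)
    moreover have "q \<le> a" using eq[of "Suc a"] ab \<open>b \<le> p\<close>
      by (auto simp: of_bool_def split: if_splits)
    moreover have "a \<le> q" using eq[of a] ab \<open>b \<le> p\<close> by (auto simp: of_bool_def split: if_splits)
    ultimately show ?thesis by simp
  qed
  have "?x = single_entry n b a (?x $$ (b, a))"
    using g entry by (intro gl_eqI[of _ n]) auto
  moreover have "?x $$ (b, a) \<noteq> 0"
  proof
    assume 0: "?x $$ (b, a) = 0"
    have "?x = 0\<^sub>m (Suc n) (Suc n)" using g entry 0 by (intro gl_eqI[of _ n]) force+
    with x(2) show False by blast
  qed
  ultimately show ?thesis using that by blast
qed

section \<open>Monomial currents\<close>

lemma tens_gl [simp]: "tens A k \<in> gl n \<longleftrightarrow> A \<in> gl n"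
  by (simp add: tens_def)

lemma dim_tens [simp]: "dim_row (tens A k) = dim_row A" "dim_col (tens A k) = dim_col A"
  by (simp_all add: tens_def)

lemma index_tens [simp]:
  "i < dim_row A \<Longrightarrow> j < dim_col A \<Longrightarrow> tens A k $$ (i, j) = monom (A $$ (i, j)) k"
  by (simp add: tens_def)

lemma tens_add: "A \<in> gl n \<Longrightarrow> B \<in> gl n \<Longrightarrow> tens (A + B) k = tens A k + tens B k"
  by (rule gl_eqI[of _ n]) (auto simp: add_monom)

lemma tens_smult: "tens (c \<cdot>\<^sub>m A) k = [:c:] \<cdot>\<^sub>m tens A k"
  by (rule eq_matI) (auto simp: smult_monom)

lemma sum_monom: "(\<Sum>i\<in>I. monom (f i) k) = monom (\<Sum>i\<in>I. f i) k"
  by (induction I rule: infinite_finite_induct) (auto simp: add_monom)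

lemma bracket_tens:
  "A \<in> gl n \<Longrightarrow> B \<in> gl n \<Longrightarrow> bracket (tens A j) (tens B k) = tens (bracket A B) (j + k)"
  by (rule gl_eqI[of _ n])
     (auto simp: index_bracket[of _ n] mult_monom sum_monom diff_monom add.commute intro!: sum.cong)

lemma tens_sl: "A \<in> sl n \<Longrightarrow> tens A k \<in> current (sl n)"
proof -
  assume A: "A \<in> sl n"
  then have g: "A \<in> gl n" and t: "(\<Sum>i\<le>n. A $$ (i, i)) = 0" by (auto simp: sl_def)
  have "(\<Sum>i\<le>n. tens A k $$ (i, i)) = (\<Sum>i\<le>n. monom (A $$ (i, i)) k)"
    using g by (intro sum.cong) auto
  with g t show ?thesis by (simp add: current_sl_iff sum_monom)
qed

lemma tens_nil_neg: "A \<in> gl n \<Longrightarrow> (\<And>i j. i \<le> n \<Longrightarrow> j \<le> n \<Longrightarrow> i \<le> j \<Longrightarrow> A $$ (i, j) = 0) \<Longrightarrow>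
    tens A k \<in> current (nil_neg n)"
  by (simp add: current_nil_neg_iff)

lemma tens_nil_pos: "A \<in> gl n \<Longrightarrow> (\<And>i j. i \<le> n \<Longrightarrow> j \<le> n \<Longrightarrow> j \<le> i \<Longrightarrow> A $$ (i, j) = 0) \<Longrightarrow>
    tens A k \<in> current (nil_pos n)"
  by (simp add: current_nil_pos_iff)

text \<open>A current is the sum of its homogeneous components \<open>A\<^sub>k \<otimes> t\<^sup>k\<close>, so a predicate that is closed under adding
  one of them holds for the current.\<close>

lemma current_induct [consumes 1, case_names zero add tens]:
  assumes A: "A \<in> gl n"
    and zero: "P (0\<^sub>m (Suc n) (Suc n))"
    and add: "\<And>B k. B \<in> gl n \<Longrightarrow> P B \<Longrightarrow> P (B + tens (map_mat (\<lambda>p. coeff p k) A) k)"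
  shows "P A"
proof -
  define trunc where "trunc m = map_mat (\<lambda>p. \<Sum>k<m. monom (coeff p k) k) A" for m
  have trunc: "P (trunc m)" for m
  proof (induction m)
    case 0
    have "trunc 0 = 0\<^sub>m (Suc n) (Suc n)" unfolding trunc_def using A by (intro gl_eqI[of _ n]) auto
    then show ?case using zero by simp
  next
    case (Suc m)
    have "trunc (Suc m) = trunc m + tens (map_mat (\<lambda>p. coeff p m) A) m"
      unfolding trunc_def using A by (intro gl_eqI[of _ n]) auto
    then show ?case using add[OF _ Suc] A by (simp add: trunc_def)
  qed
  define D where "D = (\<Sum>i\<le>n. \<Sum>j\<le>n. degree (A $$ (i, j)))"
  have D: "degree (A $$ (i, j)) \<le> D" if "i \<le> n" "j \<le> n" for i j
  proof -
    have "degree (A $$ (i, j)) \<le> (\<Sum>j\<le>n. degree (A $$ (i, j)))"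
      by (rule member_le_sum) (use that in auto)
    also have "\<dots> \<le> D" unfolding D_def
      by (rule member_le_sum[where f = "\<lambda>i. \<Sum>j\<le>n. degree (A $$ (i, j))"]) (use that in auto)
    finally show ?thesis .
  qed
  have "trunc (Suc D) = A"
    unfolding trunc_def lessThan_Suc_atMost
    using A D by (intro gl_eqI[of _ n]) (auto simp: poly_as_sum_of_monoms')
  then show ?thesis using trunc by metis
qed

lemma entries_induct [consumes 1, case_names zero add]:
  assumes A: "(A :: 'a::comm_monoid_add mat) \<in> gl n"
    and zero: "P (0\<^sub>m (Suc n) (Suc n))"
    and add: "\<And>B p q. p \<le> n \<Longrightarrow> q \<le> n \<Longrightarrow> A $$ (p, q) \<noteq> 0 \<Longrightarrow> B \<in> gl n \<Longrightarrow>
        P B \<Longrightarrow> P (B + single_entry n p q (A $$ (p, q)))"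
  shows "P A"
proof -
  have "I \<subseteq> {..n} \<times> {..n} \<Longrightarrow> P (entries_where n (\<lambda>i j. (i, j) \<in> I) A)" if "finite I" for I
    using that
  proof (induction I)
    case empty
    have "entries_where n (\<lambda>i j. (i, j) \<in> {}) A = 0\<^sub>m (Suc n) (Suc n)"
      by (intro gl_eqI[of _ n]) auto
    then show ?case using zero by simp
  next
    case (insert z I)
    obtain p q where z: "z = (p, q)" by force
    have pq: "p \<le> n" "q \<le> n" using insert.prems z by auto
    show ?case
    proof (cases "A $$ (p, q) = 0")
      case True
      have "entries_where n (\<lambda>i j. (i, j) \<in> insert z I) A = entries_where n (\<lambda>i j. (i, j) \<in> I) A"
        using True by (intro gl_eqI[of _ n]) (auto simp: z)
      then show ?thesis using insert by simp
    next
      case False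
      have "entries_where n (\<lambda>i j. (i, j) \<in> insert z I) A =
        entries_where n (\<lambda>i j. (i, j) \<in> I) A + single_entry n p q (A $$ (p, q))"
        using insert.hyps by (intro gl_eqI[of _ n]) (auto simp: z)
      then show ?thesis using insert add[OF pq False] by simp
    qed
  qed
  from this[of "{..n} \<times> {..n}"] have "P (entries_where n (\<lambda>i j. (i, j) \<in> {..n} \<times> {..n}) A)" by simp
  moreover have "entries_where n (\<lambda>i j. (i, j) \<in> {..n} \<times> {..n}) A = A"
    using A by (intro gl_eqI[of _ n]) auto
  ultimately show ?thesis by simp
qed

section \<open>Garlands modulo a left ideal\<close>

lemma cartan_sl: "H \<in> cartan n \<Longrightarrow> H \<in> sl n"
  by (simp add: cartan_def)

lemma sl_gl: "A \<in> sl n \<Longrightarrow> A \<in> gl n"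
  by (simp add: sl_def)

lemma coroot_cartan: "i \<in> {1..n} \<Longrightarrow> coroot n i \<in> cartan n"
proof -
  assume i: "i \<in> {1..n}"
  have "(\<Sum>a\<le>n. coroot n i $$ (a, a)) = (\<Sum>a\<in>{i - 1, i}. coroot n i $$ (a, a))"
    by (rule sum.mono_neutral_right) (use i in \<open>auto simp: coroot_def\<close>)
  also have "\<dots> = 0" using i by (cases i) (auto simp: coroot_def)
  finally show ?thesis by (auto simp: cartan_def sl_def diagonal_mat_def coroot_def)
qed

lemma gen_zero_mat: "gen (0\<^sub>m (Suc n) (Suc n)) \<in> uea_ideal (current (sl n))"
proof -
  have "0\<^sub>m (Suc n) (Suc n) \<in> current (sl n)" by (simp add: current_sl_iff)
  from sl.uea_rel_smult[OF this, of 0] show ?thesis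
    by (simp add: scalar_simps smult_zero_mat)
qed

lemma garland_zero_deg: "garland y 0 s = (if s = 0 then 1 else 0)"
  by (simp add: garland_eq_partial partial_garland_zero_deg)

text \<open>In weight zero only the tuple \<open>[r]\<close> remains.\<close>

lemma garland_zero_weight: "garland y r 0 = divpow (gen (tens y 0)) r"
proof -
  let ?x = "\<lambda>k. gen (tens y k)"
  have "garland y r 0 = (\<Sum>c\<le>r. partial_garland ?x 0 (int r - int c) 0 * divpow (?x 0) c)"
    using partial_garland_Suc[of "int r" r ?x 0 0] by (simp add: garland_eq_partial)
  also have "\<dots> = (\<Sum>c\<le>r. if c = r then divpow (?x 0) c else 0)"
    by (rule sum.cong) (auto simp: partial_garland_0)
  finally show ?thesis by simp
qed

text \<open>A left ideal of the free algebra on \<open>\<gg>\<close> that contains the relations, i.e. a left ideal of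
  \<open>U(\<gg>[t])\<close>. The calculus of garlands is needed for two of them, the Verma ideal and the ideal
  in the statement.\<close>

locale sl_left_ideal =
  fixes n :: nat and W P :: "complex poly mat free_alg set"
  defines "P \<equiv> left_span (alg (current (sl n))) (W \<union> uea_ideal (current (sl n)))"
  assumes W: "W \<subseteq> alg (current (sl n))"
begin

abbreviation "\<gg> \<equiv> current (sl n)"

lemma P_alg: "p \<in> P \<Longrightarrow> p \<in> alg \<gg>"
proof -
  have "W \<union> uea_ideal \<gg> \<subseteq> alg \<gg>" using W sl.uea_ideal_alg by blast
  then show "p \<in> P \<Longrightarrow> p \<in> alg \<gg>" unfolding P_def by (rule left_span_alg)
qed

lemma P_W: "p \<in> W \<Longrightarrow> p \<in> P" and P_rels: "p \<in> uea_ideal \<gg> \<Longrightarrow> p \<in> P"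
  and P_zero: "0 \<in> P" and P_add: "p \<in> P \<Longrightarrow> q \<in> P \<Longrightarrow> p + q \<in> P"
  and P_mult: "u \<in> alg \<gg> \<Longrightarrow> p \<in> P \<Longrightarrow> u * p \<in> P"
  unfolding P_def by (auto intro: left_span.intros)

lemma P_uminus: "p \<in> P \<Longrightarrow> - p \<in> P" and P_diff: "p \<in> P \<Longrightarrow> q \<in> P \<Longrightarrow> p - q \<in> P"
  and P_scalar: "p \<in> P \<Longrightarrow> scalar c * p \<in> P"
  unfolding P_def by (auto intro: left_span_uminus left_span_diff left_span_scalar)

lemma P_scalar_cancel: "scalar c * p \<in> P \<Longrightarrow> c \<noteq> 0 \<Longrightarrow> p \<in> P"
  using P_scalar[of "scalar c * p" "1 / c"]
  by (simp add: mult.assoc[symmetric] scalar_simps(4)[symmetric] scalar_simps(2))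

lemma commutator_mult:
  assumes "A \<in> \<gg>" "B \<in> \<gg>" "q \<in> alg \<gg>"
  shows "gen A * (gen B * q) - gen B * (gen A * q) - gen (bracket A B) * q \<in> uea_ideal \<gg>"
  using sl.uea_ideal_right[OF sl.uea_rel_bracket[OF assms(1,2)] assms(3)]
  by (simp add: left_diff_distrib mult.assoc)

lemma smult_mult:
  assumes "A \<in> \<gg>" "q \<in> alg \<gg>"
  shows "gen ([:c:] \<cdot>\<^sub>m A) * q - scalar c * (gen A * q) \<in> uea_ideal \<gg>"
  using sl.uea_ideal_right[OF sl.uea_rel_smult[OF assms(1)] assms(2)]
  by (simp add: left_diff_distrib mult.assoc)

context
  fixes y assumes y: "y \<in> sl n"
begin

lemma commute_tens:
  "gen (tens y j) * gen (tens y k) - gen (tens y k) * gen (tens y j) \<in> uea_ideal \<gg>"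
proof -
  have "bracket y y = 0\<^sub>m (Suc n) (Suc n)"
    by (rule gl_eqI[of _ n]) (use sl_gl[OF y] in \<open>auto simp: index_bracket mult.commute\<close>)
  then have "bracket (tens y j) (tens y k) = 0\<^sub>m (Suc n) (Suc n)"
    using sl_gl[OF y] by (simp add: bracket_tens) (auto intro!: gl_eqI[of _ n])
  then show ?thesis
    using sl.uea_ideal_add[OF sl.uea_rel_bracket[OF tens_sl[OF y] tens_sl[OF y], of j k] gen_zero_mat[of n]] by simp
qed

lemma garland_alg: "garland y r s \<in> alg \<gg>"
  unfolding garland_eq_partial by (rule partial_garland_alg) (simp add: tens_sl y)

lemma garland_module_P: "garland_module P (\<lambda>k. gen (tens y k)) (garland y)"
proof
  show "p \<in> P" if "of_nat (Suc r) * p \<in> P" for r p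
    using that by (rule_tac P_scalar_cancel[of "of_nat (Suc r)"])
      (simp_all add: scalar_of_nat of_nat_neq_0 del: of_nat_Suc)
  show "garland y 0 s = (if s = 0 then 1 else 0)" for s by (rule garland_zero_deg)
  have x: "gen (tens y k) \<in> alg \<gg>" for k by (simp add: tens_sl y)
  show "of_nat (Suc r) * garland y (Suc r) s - (\<Sum>j\<le>s. gen (tens y j) * garland y r (s - j)) \<in> P" for r s
    unfolding garland_eq_partial by (intro P_rels sl.garland_rec x commute_tens)
  show "gen (tens y j) * (gen (tens y k) * garland y r s) -
      gen (tens y k) * (gen (tens y j) * garland y r s) \<in> P" for j k r s
    using sl.uea_ideal_right[OF commute_tens[of j k] garland_alg[of r s]]
    by (intro P_rels) (simp add: left_diff_distrib mult.assoc)
qed (auto intro: P_zero P_add P_uminus P_mult simp: tens_sl y)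

lemma cartan_garland_shifted:
  assumes H: "H \<in> cartan n" "bracket H y = (- \<kappa>) \<cdot>\<^sub>m y" and \<mu>: "gen (tens H m) - scalar \<mu> \<in> P"
  shows "gen (tens H m) * garland y r s - (scalar \<mu> * garland y r s -
    scalar \<kappa> * garland_module.shifted (\<lambda>k. gen (tens y k)) (garland y) (\<lambda>_. 1) m r s) \<in> P"
proof -
  interpret garland_module P "\<lambda>k. gen (tens y k)" "garland y" by (rule garland_module_P)
  have Hg: "tens H m \<in> \<gg>" using H by (simp add: tens_sl cartan_sl)
  have "cong (gen (tens H m) * garland y r s)
    (scalar \<mu> * garland y r s - scalar \<kappa> * shifted (\<lambda>_. 1) m r s)"
  proof (rule cartan_garland)
    fix j r s
    have b: "bracket (tens H m) (tens y j) = [:- \<kappa>:] \<cdot>\<^sub>m tens y (j + m)"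
      using H(2) bracket_tens[OF cartan_gl[OF H(1)] sl_gl[OF y], of m j]
      by (simp add: tens_smult add.commute)
    have "gen (tens H m) * (gen (tens y j) * garland y r s) - gen (tens y j) * (gen (tens H m) * garland y r s)
        - gen (bracket (tens H m) (tens y j)) * garland y r s \<in> uea_ideal \<gg>"
      by (intro commutator_mult Hg garland_alg tens_sl y)
    moreover have "gen (bracket (tens H m) (tens y j)) * garland y r s -
        scalar (- \<kappa>) * (gen (tens y (j + m)) * garland y r s) \<in> uea_ideal \<gg>"
      unfolding b by (intro smult_mult garland_alg tens_sl y)
    ultimately show "gen (tens H m) * (gen (tens y j) * garland y r s) - gen (tens y j) * (gen (tens H m) * garland y r s)
        + scalar \<kappa> * (gen (tens y (j + m)) * garland y r s) \<in> P"
      using P_rels[OF sl.uea_ideal_add] by (force simp: scalar_simps)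
  qed (use Hg \<mu> in \<open>auto intro: P_mult P_scalar scalar_commute[symmetric]\<close>)
  then show ?thesis by (simp only: cong_def)
qed

lemma cartan_garland_eval:
  assumes H: "H \<in> cartan n" "bracket H y = (- \<kappa>) \<cdot>\<^sub>m y" and \<mu>: "gen (tens H m) - scalar \<mu> \<in> P"
  shows "gen (tens H m) * garland y r s - (scalar \<mu> * garland y r s - scalar \<kappa> *
    (of_nat r * garland y r (s + m) -
      (\<Sum>j<m. gen (tens y j) * (if r = 0 then 0 else garland y (r - 1) (s + m - j))))) \<in> P"
proof -
  interpret garland_module P "\<lambda>k. gen (tens y k)" "garland y" by (rule garland_module_P)
  have "shifted (\<lambda>_. 1) m r s - (of_nat r * garland y r (s + m) -
      (\<Sum>j<m. gen (tens y j) * Gpred r (s + m - j))) \<in> P"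
    using shifted_one_eval by (simp only: cong_def)
  from P_diff[OF cartan_garland_shifted[OF assms, of r s] P_scalar[OF this, of \<kappa>]]
  show ?thesis unfolding Gpred_def by (simp add: right_diff_distrib algebra_simps)
qed

lemma raise_garland_eval:
  assumes E: "E \<in> sl n" "bracket E y = H" and H: "H \<in> cartan n" "bracket H y = (- 2) \<cdot>\<^sub>m y"
    and E_P: "\<And>m. gen (tens E m) \<in> P"
    and H_P: "\<And>m. gen (tens H m) - scalar (if m = 0 then of_nat l else 0) \<in> P"
  shows "gen (tens E m) * garland y (Suc r) s - (of_int (if m = 0 then int l else 0) * garland y r s -
    (of_int (int (s + m) + (1 - int m) * int r) * garland y r (s + m) -
      (\<Sum>j<m. of_int (int j + 1 - int m) * (gen (tens y j) *
         (if r = 0 then 0 else garland y (r - 1) (s + m - j)))))) \<in> P"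
proof -
  interpret garland_module P "\<lambda>k. gen (tens y k)" "garland y" by (rule garland_module_P)
  have Eg: "tens E m \<in> \<gg>" for m using E by (simp add: tens_sl)
  have "cong (gen (tens E m) * garland y (Suc r) s)
    (of_int (if m = 0 then int l else 0) * garland y r s - shifted (\<lambda>l. int l + 1) m r s)"
  proof (rule raise_garland)
    fix j r s
    have b: "bracket (tens E m) (tens y j) = tens H (j + m)"
      using E(2) bracket_tens[OF sl_gl[OF E(1)] sl_gl[OF y], of m j] by (simp add: add.commute)
    show "gen (tens E m) * (gen (tens y j) * garland y r s) - gen (tens y j) * (gen (tens E m) * garland y r s)
        - gen (tens H (j + m)) * garland y r s \<in> P"
      unfolding b[symmetric] by (intro P_rels commutator_mult Eg garland_alg tens_sl y)
  next
    fix m r s :: nat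
    have "scalar 2 = (2 :: complex poly mat free_alg)" using scalar_of_nat[of 2] by simp
    moreover have "scalar (if m = 0 then of_nat l else 0) = (of_int (if m = 0 then int l else 0) :: complex poly mat free_alg)"
      by (simp add: scalar_of_nat scalar_simps)
    ultimately show "cong (gen (tens H m) * garland y r s)
        (of_int (if m = 0 then int l else 0) * garland y r s - 2 * shifted (\<lambda>_. 1) m r s)"
      using cartan_garland_shifted[OF H H_P, of m r s] by (simp only: cong_def)
  qed (use Eg E_P in \<open>auto intro: P_mult\<close>)
  then have "cong (gen (tens E m) * garland y (Suc r) s)
    (of_int (if m = 0 then int l else 0) * garland y r s -
    (of_int (int (s + m) + (1 - int m) * int r) * garland y r (s + m) -
      (\<Sum>j<m. of_int (int j + 1 - int m) * (gen (tens y j) * Gpred r (s + m - j)))))"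
    using cong_trans[OF _ cong_diff[OF cong_refl shifted_Suc_eval]] by blast
  then show ?thesis by (simp only: cong_def Gpred_def)
qed

text \<open>The case \<open>m = 1\<close> of the formula for \<open>x\<^sup>+ \<otimes> t\<^sup>m\<close> reads
  \<open>(x\<^sup>+ \<otimes> t) x(r + 1, s) \<equiv> - (s + 1) x(r, s + 1)\<close>. Starting with the powers of \<open>x\<^sup>- \<otimes> 1\<close>, it gives all
  garlands of the same total degree.\<close>

lemma garland_in_left_ideal:
  assumes E: "E \<in> sl n" "bracket E y = H" and H: "H \<in> cartan n" "bracket H y = (- 2) \<cdot>\<^sub>m y"
    and E_P: "\<And>m. gen (tens E m) \<in> P"
    and H_P: "\<And>m. gen (tens H m) - scalar (if m = 0 then of_nat l else 0) \<in> P"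
    and top: "gen (tens y 0) ^ (l + 1) \<in> P"
  shows "1 + l \<le> r + s \<Longrightarrow> garland y r s \<in> P"
proof (induction s arbitrary: r)
  case 0
  have x: "gen (tens y 0) \<in> alg \<gg>" by (simp add: tens_sl y)
  have "gen (tens y 0) ^ (r - (l + 1)) * gen (tens y 0) ^ (l + 1) \<in> P"
    by (rule P_mult[OF _ top]) (use x in simp)
  then have "gen (tens y 0) ^ r \<in> P" using 0 by (simp only: power_add[symmetric]) simp
  then show ?case by (simp add: garland_zero_weight divpow_def P_scalar)
next
  case (Suc s)
  interpret garland_module P "\<lambda>k. gen (tens y k)" "garland y" by (rule garland_module_P)
  have "gen (tens E 1) * garland y (Suc r) s \<in> P"
    using Suc E by (intro P_mult Suc.IH) (auto simp: tens_sl)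
  moreover have "gen (tens E 1) * garland y (Suc r) s + of_nat (Suc s) * garland y r (Suc s) \<in> P"
    using raise_garland_eval[OF E H E_P H_P, of 1 r s] by (simp add: algebra_simps)
  ultimately have "of_nat (Suc s) * garland y r (Suc s) \<in> P" using P_diff by fastforce
  then show ?case by (rule K_cancel)
qed

end

end

section \<open>The sum of the proposed ideal and the Verma ideal\<close>

lemma index_bracket_single_entry:
  fixes B :: "'r::comm_ring_1 mat"
  assumes "B \<in> gl n" "p \<le> n" "q \<le> n" "a \<le> n" "b \<le> n"
  shows "bracket B (single_entry n p q c) $$ (a, b) =
    (if b = q then B $$ (a, p) * c else 0) - (if a = p then c * B $$ (q, b) else 0)"
proof -
  have "(\<Sum>k\<le>n. B $$ (a, k) * single_entry n p q c $$ (k, b)) =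
    (\<Sum>k\<le>n. if k = p then (if b = q then B $$ (a, p) * c else 0) else 0)"
    by (rule sum.cong) (use assms in auto)
  moreover have "(\<Sum>k\<le>n. single_entry n p q c $$ (a, k) * B $$ (k, b)) =
    (\<Sum>k\<le>n. if k = q then (if a = p then c * B $$ (q, b) else 0) else 0)"
    by (rule sum.cong) (use assms in auto)
  ultimately show ?thesis using assms by (simp add: index_bracket sum_subtractf del: index_single_entry)
qed

lemma bracket_cartan_single_entry:
  "H \<in> cartan n \<Longrightarrow> p \<noteq> q \<Longrightarrow>
    bracket H (single_entry n p q c) = eps_root p q H \<cdot>\<^sub>m single_entry n p q c"
  using single_entry_root_space[of p q n c] by (simp add: root_space_def)

lemma nil_posD:
  assumes "E \<in> nil_pos n"
  shows "E \<in> gl n" "i \<le> n \<Longrightarrow> j \<le> i \<Longrightarrow> E $$ (i, j) = 0"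
proof -
  show "E \<in> gl n" using assms by (simp add: nil_pos_def sl_def)
  assume "i \<le> n" "j \<le> i"
  moreover from this have "E $$ (i, j) \<noteq> 0 \<longrightarrow> i < j" using assms by (simp add: nil_pos_def)
  ultimately show "E $$ (i, j) = 0" by auto
qed

lemma nil_pos_sl: "E \<in> nil_pos n \<Longrightarrow> E \<in> sl n"
  by (simp add: nil_pos_def)

text \<open>The hypotheses of the theorem, with \<open>coord n \<Lambda> i\<close> freed of its definite description: it is the eigenvalue
  of \<open>h\<^sub>i\<close> on the cyclic vector.\<close>

locale weyl_data = linear_weight n \<Lambda> for n \<Lambda> +
  fixes xm :: "weight \<Rightarrow> complex mat" and \<xi> :: "weight \<Rightarrow> nat"
  assumes xm: "neg_root_vectors n xm"
    and coord: "\<And>i. i \<in> {1..n} \<Longrightarrow> \<Lambda> (coroot n i) = of_nat (coord n \<Lambda> i)"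
    and \<xi>_pos: "\<And>\<alpha>. \<alpha> \<in> pos_roots n \<Longrightarrow> 1 \<le> \<xi> \<alpha>"
    and \<xi>_norm: "\<And>\<alpha>. \<alpha> \<in> pos_roots n \<Longrightarrow> xi_min n \<xi> \<alpha> = \<xi> \<alpha>"
begin

definition lower_gens :: "complex poly mat free_alg set" where
  "lower_gens = {garland (xm (simple_root i)) r s | i r s.
           i \<in> {1..n} \<and> 1 \<le> r \<and> 1 + coord n \<Lambda> i \<le> r + s} \<union>
        {gen (tens (xm \<alpha>) k) | \<alpha> k. \<alpha> \<in> pos_roots n \<and> xi_min n \<xi> \<alpha> \<le> k}"

definition full_gens :: "complex poly mat free_alg set" where
  "full_gens = {gen x | x. x \<in> current (nil_pos n)} \<union>
        {gen (tens (coroot n i) r) | i r. i \<in> {1..n} \<and> 1 \<le> r} \<union>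
        {gen (tens (coroot n i) 0) - scalar (\<Lambda> (coroot n i)) | i. i \<in> {1..n}} \<union>
        {gen (tens (xm (simple_root i)) 0) ^ (coord n \<Lambda> i + 1) | i. i \<in> {1..n}} \<union>
        {gen (tens (xm \<alpha>) (\<xi> \<alpha>)) | \<alpha>. \<alpha> \<in> pos_roots n}"

definition lower_ideal :: "complex poly mat free_alg set" where
  "lower_ideal = left_span (alg \<nn>) (lower_gens \<union> (uea_ideal \<gg> \<inter> alg \<nn>))"

definition full_ideal :: "complex poly mat free_alg set" where
  "full_ideal = left_span (alg \<gg>) (full_gens \<union> uea_ideal \<gg>)"

lemma xmE:
  assumes "a < b" "b \<le> n"
  obtains c where "c \<noteq> 0" "xm (eps_root a b) = single_entry n b a c"
  using neg_root_vectorE[OF xm assms] by blast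

lemma xm_simpleE:
  assumes "i \<in> {1..n}"
  obtains c where "c \<noteq> 0" "xm (simple_root i) = single_entry n i (i - 1) c"
  using xmE[of "i - 1" i] assms by (auto simp: simple_root_eq_root)

lemma simple_root_pos: "i \<in> {1..n} \<Longrightarrow> simple_root i \<in> pos_roots n"
  by (auto simp: simple_root_eq_root intro: root_pos_roots)

lemma xm_nn:
  assumes "\<alpha> \<in> pos_roots n"
  shows "tens (xm \<alpha>) k \<in> \<nn>" "xm \<alpha> \<in> sl n"
proof -
  from assms obtain a b where ab: "a < b" "b \<le> n" "\<alpha> = eps_root a b" by (rule pos_rootsE)
  from xmE[OF ab(1,2)] obtain c where "xm \<alpha> = single_entry n b a c" using ab by blast
  then show "tens (xm \<alpha>) k \<in> \<nn>" "xm \<alpha> \<in> sl n"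
    using ab by (auto intro!: tens_nil_neg sl_if_offdiag)
qed

lemma garland_nn: "i \<in> {1..n} \<Longrightarrow> garland (xm (simple_root i)) r s \<in> alg \<nn>"
  unfolding garland_eq_partial by (rule partial_garland_alg) (simp add: xm_nn simple_root_pos)

lemma lower_gens_alg: "lower_gens \<subseteq> alg \<nn>"
  by (auto simp: lower_gens_def garland_nn xm_nn)

lemma full_gens_alg: "full_gens \<subseteq> alg \<gg>"
  by (auto simp: full_gens_def tens_sl coroot_cartan cartan_sl xm_nn simple_root_pos
      current_nil_subset simp del: power_Suc intro!: alg_power)

lemma alg_\<nn>_\<gg>: "p \<in> alg \<nn> \<Longrightarrow> p \<in> alg \<gg>"
  by (erule alg_mono[rotated]) (auto intro: \<nn>_\<gg>)

lemma lower_ideal_alg: "p \<in> lower_ideal \<Longrightarrow> p \<in> alg \<nn>"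
proof -
  have "lower_gens \<union> (uea_ideal \<gg> \<inter> alg \<nn>) \<subseteq> alg \<nn>" using lower_gens_alg by blast
  then show "p \<in> lower_ideal \<Longrightarrow> p \<in> alg \<nn>" unfolding lower_ideal_def by (rule left_span_alg)
qed

lemma lower_ideal_base: "p \<in> lower_gens \<Longrightarrow> p \<in> lower_ideal"
  and lower_ideal_rels: "p \<in> uea_ideal \<gg> \<Longrightarrow> p \<in> alg \<nn> \<Longrightarrow> p \<in> lower_ideal"
  and lower_ideal_zero: "0 \<in> lower_ideal"
  and lower_ideal_add: "p \<in> lower_ideal \<Longrightarrow> q \<in> lower_ideal \<Longrightarrow> p + q \<in> lower_ideal"
  and lower_ideal_mult: "u \<in> alg \<nn> \<Longrightarrow> p \<in> lower_ideal \<Longrightarrow> u * p \<in> lower_ideal"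
  unfolding lower_ideal_def by (auto intro: left_span.intros)

lemma uea_ideal_\<nn>_\<gg>: "p \<in> uea_ideal \<nn> \<Longrightarrow> p \<in> uea_ideal \<gg>"
  using uea_ideal_mono[OF lie_algebra_nil_neg lie_algebra_sl] \<nn>_\<gg> by blast

lemma lower_ideal_rels_lower: "p \<in> uea_ideal \<nn> \<Longrightarrow> p \<in> lower_ideal"
  by (simp add: lower_ideal_rels uea_ideal_\<nn>_\<gg> nm.uea_ideal_alg)

sublocale K: sl_left_ideal n verma_rels verma_ideal
  using verma_rels_subset by (simp_all only: sl_left_ideal_def verma_ideal_def) simp

text \<open>The preimage in the free algebra of \<open>N + K\<close>, where \<open>N\<close> is the proposed left ideal of \<open>U\<^sup>-\<close> and \<open>K\<close> the Verma
  ideal.\<close>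

definition sum_ideal :: "complex poly mat free_alg set" where
  "sum_ideal = {p \<in> alg \<gg>. \<exists>q\<in>lower_ideal. p - q \<in> verma_ideal}"

lemma sum_ideal_lower_ideal: "p \<in> lower_ideal \<Longrightarrow> p \<in> sum_ideal"
  using K.P_zero by (force simp: sum_ideal_def alg_\<nn>_\<gg> lower_ideal_alg)

lemma sum_ideal_verma: "p \<in> verma_ideal \<Longrightarrow> p \<in> sum_ideal"
  using lower_ideal_zero by (force simp: sum_ideal_def K.P_alg)

lemma sum_ideal_add: "p \<in> sum_ideal \<Longrightarrow> q \<in> sum_ideal \<Longrightarrow> p + q \<in> sum_ideal"
proof -
  assume "p \<in> sum_ideal" "q \<in> sum_ideal"
  then obtain p' q' where *: "p' \<in> lower_ideal" "q' \<in> lower_ideal"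
    "p - p' \<in> verma_ideal" "q - q' \<in> verma_ideal" "p \<in> alg \<gg>" "q \<in> alg \<gg>"
    unfolding sum_ideal_def by blast
  have "p + q - (p' + q') \<in> verma_ideal" using K.P_add[OF *(3,4)] by (simp add: algebra_simps)
  then show ?thesis using * lower_ideal_add unfolding sum_ideal_def by (auto intro: alg_add)
qed

lemma sum_ideal_mult_lower: "u \<in> alg \<nn> \<Longrightarrow> p \<in> sum_ideal \<Longrightarrow> u * p \<in> sum_ideal"
proof -
  assume u: "u \<in> alg \<nn>" and "p \<in> sum_ideal"
  then obtain q where *: "q \<in> lower_ideal" "p - q \<in> verma_ideal" "p \<in> alg \<gg>"
    unfolding sum_ideal_def by blast
  have "u * p - u * q \<in> verma_ideal"
    using K.P_mult[OF alg_\<nn>_\<gg>[OF u] *(2)] by (simp add: right_diff_distrib)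
  then show ?thesis using * lower_ideal_mult[OF u] u unfolding sum_ideal_def by (auto intro: alg_mult alg_\<nn>_\<gg>)
qed

lemma sum_ideal_scalar: "p \<in> sum_ideal \<Longrightarrow> scalar c * p \<in> sum_ideal"
  by (rule sum_ideal_mult_lower) auto

lemma sum_ideal_uminus: "p \<in> sum_ideal \<Longrightarrow> - p \<in> sum_ideal"
  using sum_ideal_scalar[of p "-1"] by (simp add: scalar_simps)

lemma sum_ideal_diff: "p \<in> sum_ideal \<Longrightarrow> q \<in> sum_ideal \<Longrightarrow> p - q \<in> sum_ideal"
  using sum_ideal_add[OF _ sum_ideal_uminus, of p q] by simp

lemma sum_ideal_sum: "(\<And>i. i \<in> I \<Longrightarrow> f i \<in> sum_ideal) \<Longrightarrow> sum f I \<in> sum_ideal"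
  by (induction I rule: infinite_finite_induct) (auto intro: sum_ideal_add sum_ideal_lower_ideal lower_ideal_zero)

lemma sum_ideal_of_nat: "p \<in> sum_ideal \<Longrightarrow> of_nat k * p \<in> sum_ideal"
  using sum_ideal_scalar[of p "of_nat k"] by (simp add: scalar_of_nat)

lemma sum_ideal_of_int: "p \<in> sum_ideal \<Longrightarrow> of_int k * p \<in> sum_ideal"
  by (cases k rule: int_cases2) (auto intro: sum_ideal_of_nat sum_ideal_uminus)

lemma sum_ideal_rels: "p \<in> uea_ideal \<gg> \<Longrightarrow> p \<in> sum_ideal"
  by (intro sum_ideal_verma K.P_rels)

lemma sum_ideal_cong: "p - q \<in> sum_ideal \<Longrightarrow> q \<in> sum_ideal \<Longrightarrow> p \<in> sum_ideal"
  using sum_ideal_add[of "p - q" q] by simp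

lemma sum_ideal_gen_add:
  assumes "A \<in> \<gg>" "B \<in> \<gg>" "y \<in> alg \<gg>" "gen A * y \<in> sum_ideal" "gen B * y \<in> sum_ideal"
  shows "gen (A + B) * y \<in> sum_ideal"
proof (rule sum_ideal_cong)
  have "(gen (A + B) - gen A - gen B) * y \<in> sum_ideal"
    by (intro sum_ideal_rels sl.uea_ideal_right sl.uea_rel_add assms)
  then show "gen (A + B) * y - (gen A * y + gen B * y) \<in> sum_ideal" by (simp add: algebra_simps)
qed (use assms sum_ideal_add in auto)

lemma sum_ideal_gen_smult:
  assumes "A \<in> \<gg>" "y \<in> alg \<gg>" "gen A * y \<in> sum_ideal"
  shows "gen ([:c:] \<cdot>\<^sub>m A) * y \<in> sum_ideal"
  by (rule sum_ideal_cong[OF sum_ideal_rels[OF K.smult_mult[OF assms(1,2)]]]) (use assms sum_ideal_scalar in auto)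

text \<open>Stability under \<open>\<nn>\<^sup>-[t]\<close> is clear, so it has to be tested only for homogeneous elements of \<open>\<hh>[t]\<close> and
  \<open>\<nn>\<^sup>+[t]\<close>.\<close>

lemma sum_ideal_from_monomials:
  assumes y: "y \<in> lower_ideal"
    and cartan: "\<And>H m. H \<in> cartan n \<Longrightarrow> gen (tens H m) * y \<in> sum_ideal"
    and nil: "\<And>E m. E \<in> nil_pos n \<Longrightarrow> gen (tens E m) * y \<in> sum_ideal"
    and A: "A \<in> \<gg>"
  shows "gen A * y \<in> sum_ideal"
proof -
  have yg: "y \<in> alg \<gg>" using y lower_ideal_alg alg_\<nn>_\<gg> by blast
  have gl: "A \<in> gl n" using A \<gg>_gl by blast
  have zero: "0\<^sub>m (Suc n) (Suc n) \<in> \<gg> \<and> gen (0\<^sub>m (Suc n) (Suc n)) * y \<in> sum_ideal"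
    using gen_zero_mat[of n] yg by (auto simp: current_sl_iff intro: sum_ideal_rels sl.uea_ideal_right)
  have "diag n A \<in> \<gg> \<and> gen (diag n A) * y \<in> sum_ideal"
  proof (rule current_induct[of "diag n A" n])
    fix B k assume B: "B \<in> \<gg> \<and> gen B * y \<in> sum_ideal"
    have "map_mat (\<lambda>p. coeff p k) (diag n A) \<in> sl n"
      using diag_sl[OF A] by (simp add: current_def)
    then have "map_mat (\<lambda>p. coeff p k) (diag n A) \<in> cartan n"
      by (auto simp: cartan_def diagonal_mat_def)
    then have "tens (map_mat (\<lambda>p. coeff p k) (diag n A)) k \<in> \<gg>"
      "gen (tens (map_mat (\<lambda>p. coeff p k) (diag n A)) k) * y \<in> sum_ideal"
      by (auto intro: tens_sl cartan_sl cartan)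
    with B show "B + tens (map_mat (\<lambda>p. coeff p k) (diag n A)) k \<in> \<gg> \<and>
      gen (B + tens (map_mat (\<lambda>p. coeff p k) (diag n A)) k) * y \<in> sum_ideal"
      by (auto intro: sum_ideal_gen_add sl.L_add yg)
  qed (use zero in auto)
  moreover have "upper n A \<in> \<gg> \<and> gen (upper n A) * y \<in> sum_ideal"
  proof (rule current_induct[of "upper n A" n])
    fix B k assume B: "B \<in> \<gg> \<and> gen B * y \<in> sum_ideal"
    have "map_mat (\<lambda>p. coeff p k) (upper n A) \<in> nil_pos n"
      using upper_nil_pos[of n A] by (simp add: current_def)
    then have "tens (map_mat (\<lambda>p. coeff p k) (upper n A)) k \<in> \<gg>"
      "gen (tens (map_mat (\<lambda>p. coeff p k) (upper n A)) k) * y \<in> sum_ideal"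
      by (auto intro: tens_sl nil_pos_sl nil)
    with B show "B + tens (map_mat (\<lambda>p. coeff p k) (upper n A)) k \<in> \<gg> \<and>
      gen (B + tens (map_mat (\<lambda>p. coeff p k) (upper n A)) k) * y \<in> sum_ideal"
      by (auto intro: sum_ideal_gen_add sl.L_add yg)
  qed (use zero in auto)
  moreover have "gen (lower n A) * y \<in> sum_ideal"
    by (intro sum_ideal_lower_ideal lower_ideal_mult y alg_gen lower_nil_neg)
  moreover have "lower n A \<in> \<gg>" using lower_nil_neg \<nn>_\<gg> by blast
  ultimately show ?thesis
    by (subst triangular_sum[OF gl]) (auto intro!: sum_ideal_gen_add sl.L_add yg)
qed

lemma tens_cartan_verma:
  assumes H: "H \<in> cartan n"
  shows "gen (tens H m) - scalar (if m = 0 then \<Lambda> H else 0) \<in> verma_ideal"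
proof -
  have "diag n (tens H m) = tens H m"
    using cartan_gl[OF H] cartan_offdiag[OF H] by (intro gl_eqI[of _ n]) auto
  moreover have "top_value (tens H m) = (if m = 0 then \<Lambda> H else 0)"
  proof (cases "m = 0")
    case True
    have "map_mat (\<lambda>p. coeff p 0) (diag n (tens H m)) = H"
      using cartan_gl[OF H] cartan_offdiag[OF H] True by (intro gl_eqI[of _ n]) auto
    then show ?thesis using True by (simp add: diag_value_def)
  next
    case False
    have "map_mat (\<lambda>p. coeff p 0) (diag n (tens H m)) =
        map_mat (\<lambda>p. coeff p 0) (diag n (0\<^sub>m (Suc n) (Suc n)))"
      using cartan_gl[OF H] False by (intro gl_eqI[of _ n]) auto
    moreover have "top_value (0\<^sub>m (Suc n) (Suc n)) = 0" by (rule diag_value_nilpotent) auto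
    ultimately show ?thesis using False by (simp add: diag_value_def)
  qed
  ultimately have "gen (tens H m) - scalar (if m = 0 then \<Lambda> H else 0) \<in> verma_rels"
    using tens_sl[OF cartan_sl[OF H], of m] unfolding verma_rels_def by force
  then show ?thesis by (rule K.P_W)
qed

lemma nil_pos_verma: "x \<in> current (nil_pos n) \<Longrightarrow> gen x \<in> verma_ideal"
  by (rule K.P_W) (auto simp: verma_rels_def)

lemma tens_nil_verma: "E \<in> nil_pos n \<Longrightarrow> gen (tens E m) \<in> verma_ideal"
  by (intro nil_pos_verma tens_nil_pos) (auto dest: nil_posD)

section \<open>Stability: root vectors\<close>

text \<open>The root of an entry \<open>(c, d)\<close> is below that of \<open>(a, b)\<close> if the interval from \<open>c\<close> to \<open>d\<close> is contained in the one
  from \<open>a\<close> to \<open>b\<close>.\<close>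

lemma xi_min_mono:
  assumes "a \<le> c" "c < d" "d \<le> b" "b \<le> n"
  shows "xi_min n \<xi> (eps_root c d) \<le> \<xi> (eps_root a b)"
  using assms by (intro xi_min_le root_pos_roots root_ge_root) auto

lemma lower_monomial_ideal:
  assumes L: "L \<in> gl n"
    and deep: "\<And>p q. p \<le> n \<Longrightarrow> q \<le> n \<Longrightarrow> L $$ (p, q) \<noteq> 0 \<Longrightarrow> q < p \<and> xi_min n \<xi> (eps_root q p) \<le> k"
  shows "gen (tens L k) \<in> lower_ideal"
proof -
  have "tens L k \<in> \<nn> \<and> gen (tens L k) \<in> lower_ideal"
    using L
  proof (induction rule: entries_induct)
    case zero
    have "tens (0\<^sub>m (Suc n) (Suc n)) k = 0\<^sub>m (Suc n) (Suc n)" by (rule gl_eqI[of _ n]) auto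
    then show ?case using gen_zero_mat[of n] by (auto simp: current_nil_neg_iff intro!: lower_ideal_rels)
  next
    case (add B p q)
    from deep[OF add(1-3)] have qp: "q < p" and k: "xi_min n \<xi> (eps_root q p) \<le> k" by auto
    from xmE[OF qp add(1)] obtain c where c: "c \<noteq> 0" "xm (eps_root q p) = single_entry n p q c" .
    let ?d = "L $$ (p, q) / c"
    have "single_entry n p q (L $$ (p, q)) = ?d \<cdot>\<^sub>m xm (eps_root q p)"
      unfolding c by (rule gl_eqI[of _ n]) (use c in auto)
    then have e: "tens (single_entry n p q (L $$ (p, q))) k = [:?d:] \<cdot>\<^sub>m tens (xm (eps_root q p)) k"
      by (simp add: tens_smult)
    have pos: "eps_root q p \<in> pos_roots n" using qp add(1) by (rule root_pos_roots)
    have "gen (tens (xm (eps_root q p)) k) \<in> lower_gens"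
      using pos k unfolding lower_gens_def by blast
    then have "scalar ?d * gen (tens (xm (eps_root q p)) k) \<in> lower_ideal"
      by (intro lower_ideal_mult lower_ideal_base) auto
    moreover have "gen ([:?d:] \<cdot>\<^sub>m tens (xm (eps_root q p)) k) - scalar ?d * gen (tens (xm (eps_root q p)) k) \<in> lower_ideal"
      by (intro lower_ideal_rels_lower nm.uea_rel_smult xm_nn pos)
    ultimately have g: "gen (tens (single_entry n p q (L $$ (p, q))) k) \<in> lower_ideal"
      using lower_ideal_add unfolding e by fastforce
    have n: "tens (single_entry n p q (L $$ (p, q))) k \<in> \<nn>"
      unfolding e by (intro nm.L_smult xm_nn pos)
    let ?s = "tens (single_entry n p q (L $$ (p, q))) k"
    have t: "tens (B + single_entry n p q (L $$ (p, q))) k = tens B k + ?s"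
      using add by (simp add: tens_add[of _ n])
    have "gen (tens B k + ?s) - gen (tens B k) - gen ?s \<in> lower_ideal"
      using add n by (intro lower_ideal_rels_lower nm.uea_rel_add) auto
    from lower_ideal_add[OF lower_ideal_add[OF this] g, of "gen (tens B k)"] show ?case
      using add n unfolding t by (auto intro: nm.L_add)
  qed
  then show ?thesis by blast
qed

lemma sum_ideal_commutator:
  assumes "A \<in> \<gg>" "B \<in> \<gg>" "gen B * gen A \<in> sum_ideal" "gen (bracket A B) \<in> sum_ideal"
  shows "gen A * gen B \<in> sum_ideal"
proof (rule sum_ideal_cong)
  show "gen A * gen B - (gen B * gen A + gen (bracket A B)) \<in> sum_ideal"
    using sum_ideal_rels[OF sl.uea_rel_bracket[OF assms(1,2)]] by (simp add: algebra_simps)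
qed (use assms sum_ideal_add in auto)

text \<open>The bracket of \<open>E \<otimes> t\<^sup>m\<close> with \<open>x\<^sup>-\<^sub>\<alpha> \<otimes> t\<^sup>k\<close> is split into triangular parts. The upper part is in the Verma
  ideal, and so is the diagonal part, because its exponent of \<open>t\<close> is positive. The lower part consists of
  root vectors for roots below \<open>\<alpha>\<close>, on which \<open>\<xi>\<close> is at most \<open>\<xi> \<alpha>\<close>.\<close>

lemma root_vector_stable:
  assumes \<alpha>: "\<alpha> \<in> pos_roots n" and k: "xi_min n \<xi> \<alpha> \<le> k" and A: "A \<in> \<gg>"
  shows "gen A * gen (tens (xm \<alpha>) k) \<in> sum_ideal"
proof -
  from \<alpha> obtain a b where ab: "a < b" "b \<le> n" "\<alpha> = eps_root a b" by (rule pos_rootsE)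
  from xmE[OF ab(1,2)] obtain c where c: "c \<noteq> 0" "xm \<alpha> = single_entry n b a c" using ab(3) by blast
  have \<xi>k: "\<xi> \<alpha> \<le> k" "1 \<le> k" using k \<xi>_norm[OF \<alpha>] \<xi>_pos[OF \<alpha>] by auto
  have N: "gen (tens (xm \<alpha>) j) \<in> lower_ideal" if "k \<le> j" for j
    using \<alpha> k that unfolding lower_gens_def
    by (intro lower_ideal_base[unfolded lower_gens_def] UnI2 CollectI exI[of _ \<alpha>] exI[of _ j]) auto
  have yg: "tens (xm \<alpha>) j \<in> \<gg>" for j using xm_nn[OF \<alpha>] \<nn>_\<gg> by blast
  have ygl: "xm \<alpha> \<in> gl n" using xm_nn[OF \<alpha>] sl_gl by blast
  show ?thesis
  proof (rule sum_ideal_from_monomials[OF N[OF order.refl] _ _ A])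
    fix H m assume H: "H \<in> cartan n"
    have Hg: "tens H m \<in> \<gg>" using H by (intro tens_sl cartan_sl)
    show "gen (tens H m) * gen (tens (xm \<alpha>) k) \<in> sum_ideal"
    proof (rule sum_ideal_commutator[OF Hg yg])
      let ?\<mu> = "if m = 0 then \<Lambda> H else 0"
      have "gen (tens (xm \<alpha>) k) * (gen (tens H m) - scalar ?\<mu>) \<in> sum_ideal"
        by (intro sum_ideal_verma K.P_mult tens_cartan_verma H alg_gen yg)
      moreover have "scalar ?\<mu> * gen (tens (xm \<alpha>) k) \<in> sum_ideal" by (intro sum_ideal_scalar sum_ideal_lower_ideal N) simp
      ultimately show "gen (tens (xm \<alpha>) k) * gen (tens H m) \<in> sum_ideal"
        using sum_ideal_add by (fastforce simp: right_diff_distrib scalar_commute)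
      have "bracket H (xm \<alpha>) = eps_root b a H \<cdot>\<^sub>m xm \<alpha>"
        unfolding c by (rule bracket_cartan_single_entry[OF H]) (use ab in simp)
      then have "bracket (tens H m) (tens (xm \<alpha>) k) = [:eps_root b a H:] \<cdot>\<^sub>m tens (xm \<alpha>) (m + k)"
        by (simp only: bracket_tens[OF cartan_gl[OF H] ygl] tens_smult)
      moreover have "scalar (eps_root b a H) * gen (tens (xm \<alpha>) (m + k)) \<in> sum_ideal"
        by (intro sum_ideal_scalar sum_ideal_lower_ideal N) simp
      ultimately show "gen (bracket (tens H m) (tens (xm \<alpha>) k)) \<in> sum_ideal"
        using sum_ideal_cong[OF sum_ideal_rels[OF sl.uea_rel_smult[OF yg]]] by simp
    qed
  next
    fix E m assume E: "E \<in> nil_pos n"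
    have Eg: "tens E m \<in> \<gg>" using E by (intro tens_sl nil_pos_sl)
    show "gen (tens E m) * gen (tens (xm \<alpha>) k) \<in> sum_ideal"
    proof (rule sum_ideal_commutator[OF Eg yg])
      show "gen (tens (xm \<alpha>) k) * gen (tens E m) \<in> sum_ideal"
        by (intro sum_ideal_verma K.P_mult tens_nil_verma E alg_gen yg)
      define B where "B = bracket E (xm \<alpha>)"
      have Bgl: "B \<in> gl n" unfolding B_def using nil_posD(1)[OF E] ygl by (rule bracket_gl)
      have B: "B $$ (p, q) = (if q = a then E $$ (p, b) * c else 0) - (if p = b then c * E $$ (a, q) else 0)"
        if "p \<le> n" "q \<le> n" for p q
        unfolding B_def c by (rule index_bracket_single_entry) (use that ab nil_posD(1)[OF E] in auto)
      let ?t = "tens B (m + k)"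
      have Bt: "bracket (tens E m) (tens (xm \<alpha>) k) = ?t"
        unfolding B_def by (rule bracket_tens[OF nil_posD(1)[OF E] ygl])
      have tg: "?t \<in> \<gg>" using current_sl_bracket[OF Eg yg, of k] by (simp only: Bt)
      have low: "lower n ?t = tens (lower n B) (m + k)"
        using Bgl by (intro gl_eqI[of _ n]) auto
      have "gen (lower n ?t) \<in> lower_ideal"
        unfolding low
      proof (rule lower_monomial_ideal)
        fix p q assume pq: "p \<le> n" "q \<le> n" "lower n B $$ (p, q) \<noteq> 0"
        then have "q < p" "B $$ (p, q) \<noteq> 0" by (auto split: if_splits)
        then have "q = a \<and> E $$ (p, b) \<noteq> 0 \<or> p = b \<and> E $$ (a, q) \<noteq> 0"
          using B[OF pq(1,2)] by (auto split: if_splits)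
        then consider "q = a" "E $$ (p, b) \<noteq> 0" | "p = b" "E $$ (a, q) \<noteq> 0" by blast
        then have "a \<le> q \<and> p \<le> b"
        proof cases
          case 1
          then show ?thesis using nil_posD(2)[OF E, of p b] pq ab by fastforce
        next
          case 2
          then show ?thesis using nil_posD(2)[OF E, of a q] pq ab by fastforce
        qed
        then have "xi_min n \<xi> (eps_root q p) \<le> \<xi> (eps_root a b)"
          using \<open>q < p\<close> ab by (intro xi_min_mono) auto
        with \<open>q < p\<close> \<xi>k ab show "q < p \<and> xi_min n \<xi> (eps_root q p) \<le> m + k" by simp
      qed simp
      then have "gen (lower n ?t) * 1 \<in> sum_ideal" by (simp add: sum_ideal_lower_ideal)
      moreover have "gen (upper n ?t) * 1 \<in> sum_ideal"
        by (simp add: sum_ideal_verma nil_pos_verma upper_nil_pos)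
      moreover have "gen (diag n ?t) * 1 \<in> sum_ideal"
      proof -
        have "top_value (diag n ?t) = top_value (0\<^sub>m (Suc n) (Suc n))"
          unfolding diag_value_def
          by (rule arg_cong[where f = \<Lambda>], rule gl_eqI[of _ n]) (use \<xi>k Bgl in auto)
        also have "\<dots> = 0" by (rule diag_value_nilpotent) auto
        finally have "gen (diag n ?t) - scalar 0 \<in> verma_rels"
          using diag_sl[OF tg] unfolding verma_rels_def
          by (intro UnI2 CollectI exI[of _ "diag n ?t"]) (auto intro!: gl_eqI[of _ n])
        from K.P_W[OF this] show ?thesis by (simp add: scalar_simps sum_ideal_verma)
      qed
      ultimately have "gen (lower n ?t + (diag n ?t + upper n ?t)) * 1 \<in> sum_ideal"
        using lower_nil_neg[of n ?t] upper_nil_pos[of n ?t] diag_sl[OF tg] \<nn>_\<gg> current_nil_subset(2)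
        by (intro sum_ideal_gen_add sl.L_add) auto
      then show "gen (bracket (tens E m) (tens (xm \<alpha>) k)) \<in> sum_ideal"
        using triangular_sum[of ?t n] \<gg>_gl[OF tg] by (simp add: Bt)
    qed
  qed
qed

end

section \<open>Stability: garlands\<close>

context weyl_data
begin

lemma sl2_data:
  assumes i: "i \<in> {1..n}" and c: "c \<noteq> 0" "xm (simple_root i) = single_entry n i (i - 1) c"
  shows "bracket (single_entry n (i - 1) i (1 / c)) (xm (simple_root i)) = coroot n i"
    and "bracket (coroot n i) (xm (simple_root i)) = (- 2) \<cdot>\<^sub>m xm (simple_root i)"
    and "single_entry n (i - 1) i d \<in> nil_pos n"
proof -
  show "bracket (single_entry n (i - 1) i (1 / c)) (xm (simple_root i)) = coroot n i"
    unfolding c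
    by (rule gl_eqI[of _ n]) (use i c in \<open>auto simp: index_bracket_single_entry coroot_def\<close>)
  have "eps_root i (i - 1) (coroot n i) = - 2" using i by (auto simp: eps_root_def coroot_def)
  then show "bracket (coroot n i) (xm (simple_root i)) = (- 2) \<cdot>\<^sub>m xm (simple_root i)"
    unfolding c using bracket_cartan_single_entry[OF coroot_cartan[OF i], of i "i - 1" c] i by auto
  show "single_entry n (i - 1) i d \<in> nil_pos n"
    using i by (auto simp: nil_pos_def intro!: sl_if_offdiag)
qed

text \<open>The positive currents without the root vector of \<open>\<alpha>\<^sub>i\<close>: the nilradical of the minimal parabolic
  subalgebra for \<open>\<alpha>\<^sub>i\<close>, tensored with \<open>\<complex>[t]\<close>.\<close>

definition nilradical :: "nat \<Rightarrow> complex poly mat set" where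
  "nilradical i = {A \<in> current (nil_pos n). A $$ (i - 1, i) = 0}"

lemma nilradical_bracket:
  assumes i: "i \<in> {1..n}" and A: "A \<in> nilradical i"
  shows "bracket A (tens (xm (simple_root i)) k) \<in> nilradical i"
proof -
  from xm_simpleE[OF i] obtain c where c: "xm (simple_root i) = single_entry n i (i - 1) c" by blast
  have A': "A \<in> gl n" "\<And>p q. p \<le> n \<Longrightarrow> q \<le> n \<Longrightarrow> q \<le> p \<Longrightarrow> A $$ (p, q) = 0" "A $$ (i - 1, i) = 0"
    using A by (auto simp: nilradical_def current_nil_pos_iff)
  have t: "tens (xm (simple_root i)) k = single_entry n i (i - 1) (monom c k)"
    unfolding c by (rule gl_eqI[of _ n]) auto
  have e: "bracket A (tens (xm (simple_root i)) k) $$ (p, q) =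
    (if q = i - 1 then A $$ (p, i) * monom c k else 0) - (if p = i then monom c k * A $$ (i - 1, q) else 0)"
    if "p \<le> n" "q \<le> n" for p q
    unfolding t by (rule index_bracket_single_entry) (use A' i that in auto)
  have "bracket A (tens (xm (simple_root i)) k) $$ (p, q) = 0" if pq: "p \<le> n" "q \<le> p" for p q
  proof -
    have "A $$ (p, i) = 0" if "q = i - 1"
    proof (cases "p = i - 1")
      case True then show ?thesis using A'(3) by simp
    next
      case False
      then have "i \<le> p" using \<open>q \<le> p\<close> \<open>q = i - 1\<close> by simp
      then show ?thesis using A'(2)[of p i] pq by simp
    qed
    moreover have "A $$ (i - 1, q) = 0" if "p = i"
    proof (cases "q = i")
      case True then show ?thesis using A'(3) by simp
    next
      case False
      then have "q \<le> i - 1" using \<open>q \<le> p\<close> \<open>p = i\<close> by simp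
      then show ?thesis using i by (intro A'(2)) auto
    qed
    ultimately show ?thesis using e[of p q] pq by simp
  qed
  moreover have "bracket A (tens (xm (simple_root i)) k) $$ (i - 1, i) = 0"
    using e[of "i - 1" i] i by auto
  moreover have "bracket A (tens (xm (simple_root i)) k) \<in> gl n"
    using A'(1) by (simp add: t)
  ultimately show ?thesis by (simp add: nilradical_def current_nil_pos_iff)
qed

text \<open>The bracket with \<open>x\<^sub>i\<^sup>- \<otimes> t\<^sup>k\<close> preserves the nilradical, so its elements can be moved through
  polynomials in these root vectors to the cyclic vector, which they annihilate.\<close>

lemma nilradical_garland:
  assumes i: "i \<in> {1..n}" and A: "A \<in> nilradical i"
  shows "gen A * garland (xm (simple_root i)) r s \<in> verma_ideal"
proof -
  let ?X = "range (tens (xm (simple_root i)))"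
  have X: "?X \<subseteq> \<gg>" using xm_nn[OF simple_root_pos[OF i]] \<nn>_\<gg> by blast
  have "garland (xm (simple_root i)) r s \<in> alg ?X"
    unfolding garland_eq_partial by (rule partial_garland_alg) simp
  then show ?thesis
    using A
  proof (induction arbitrary: A rule: alg_induct)
    case one
    then show ?case by (simp add: nilradical_def nil_pos_verma)
  next
    case (add p q)
    then show ?case by (simp add: distrib_left K.P_add)
  next
    case (scalar c p)
    then show ?case by (simp add: scalar_left_commute[of "gen A"] K.P_scalar)
  next
    case (gen x p)
    then obtain k where x: "x = tens (xm (simple_root i)) k" by blast
    have g: "A \<in> \<gg>" "x \<in> \<gg>" using gen X current_nil_subset(2) by (auto simp: nilradical_def)
    have "gen A * (gen x * p) - gen x * (gen A * p) - gen (bracket A x) * p \<in> verma_ideal"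
      using g alg_mono[OF X gen.hyps(2)] by (intro K.P_rels K.commutator_mult)
    moreover have "gen x * (gen A * p) \<in> verma_ideal"
      by (rule K.P_mult[OF alg_gen[OF g(2)] gen.IH[OF gen.prems]])
    moreover have "gen (bracket A x) * p \<in> verma_ideal"
      unfolding x by (intro gen.IH nilradical_bracket i gen.prems)
    ultimately have "(gen A * (gen x * p) - gen x * (gen A * p) - gen (bracket A x) * p) +
      gen x * (gen A * p) + gen (bracket A x) * p \<in> verma_ideal" by (intro K.P_add)
    then show ?case by simp
  qed
qed

text \<open>For \<open>r = 0\<close> the garland vanishes, because then \<open>s > 0\<close>. Including this case avoids distinctions in the
  formulas where \<open>r\<close> is lowered.\<close>

lemma garland_lower_ideal:
  assumes i: "i \<in> {1..n}" and "1 + coord n \<Lambda> i \<le> r + s"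
  shows "garland (xm (simple_root i)) r s \<in> lower_ideal"
proof (cases "r = 0")
  case True
  then show ?thesis using assms by (simp add: garland_zero_deg lower_ideal_zero)
next
  case False
  then have "garland (xm (simple_root i)) r s \<in> lower_gens"
    using assms unfolding lower_gens_def by (intro UnI1 CollectI exI[of _ i] exI[of _ r] exI[of _ s]) auto
  then show ?thesis by (rule lower_ideal_base)
qed

text \<open>In the formulas for \<open>h \<otimes> t\<^sup>m\<close> and \<open>x\<^sub>i\<^sup>+ \<otimes> t\<^sup>m\<close> each garland has total degree at least \<open>1 + \<Lambda>\<^sub>i\<close> or the
  coefficient zero.\<close>

lemma garland_stable:
  assumes i: "i \<in> {1..n}" and r: "1 \<le> r" and rs: "1 + coord n \<Lambda> i \<le> r + s" and A: "A \<in> \<gg>"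
  shows "gen A * garland (xm (simple_root i)) r s \<in> sum_ideal"
proof -
  let ?y = "xm (simple_root i)" and ?l = "coord n \<Lambda> i"
  from xm_simpleE[OF i] obtain c where c: "c \<noteq> 0" "?y = single_entry n i (i - 1) c" by blast
  have y: "?y \<in> sl n" using xm_nn[OF simple_root_pos[OF i]] by blast
  have x: "gen (tens ?y j) \<in> alg \<nn>" for j using xm_nn[OF simple_root_pos[OF i]] by simp
  have G: "1 + ?l \<le> r + s \<Longrightarrow> garland ?y r s \<in> sum_ideal" for r s
    by (intro sum_ideal_lower_ideal garland_lower_ideal i)
  have yg: "garland ?y r s \<in> alg \<gg>" by (rule K.garland_alg[OF y])
  show ?thesis
  proof (rule sum_ideal_from_monomials[OF garland_lower_ideal[OF i rs] _ _ A])
    fix H and m :: nat assume H: "H \<in> cartan n"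
    define \<kappa> where "\<kappa> = - eps_root i (i - 1) H"
    have b: "bracket H ?y = (- \<kappa>) \<cdot>\<^sub>m ?y"
      unfolding c \<kappa>_def using bracket_cartan_single_entry[OF H, of i "i - 1" c] i by auto
    let ?\<mu> = "if m = 0 then \<Lambda> H else 0"
    note K.cartan_garland_eval[OF y H b tens_cartan_verma[OF H], of m r s]
    moreover have "scalar ?\<mu> * garland ?y r s - scalar \<kappa> * (of_nat r * garland ?y r (s + m) -
      (\<Sum>j<m. gen (tens ?y j) * (if r = 0 then 0 else garland ?y (r - 1) (s + m - j)))) \<in> sum_ideal"
      using r rs by (intro sum_ideal_diff sum_ideal_scalar sum_ideal_of_nat sum_ideal_sum sum_ideal_mult_lower[OF x])
        (auto intro!: G)
    ultimately show "gen (tens H m) * garland ?y r s \<in> sum_ideal"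
      using sum_ideal_cong sum_ideal_verma by blast
  next
    fix E and m :: nat assume E: "E \<in> nil_pos n"
    define F where "F = single_entry n (i - 1) i (1 / c)"
    define d where "d = E $$ (i - 1, i) * c"
    define E' where "E' = entries_where n (\<lambda>p q. \<not> (p = i - 1 \<and> q = i)) E"
    have F: "F \<in> nil_pos n" unfolding F_def by (rule sl2_data[OF i c])
    have Fg: "tens F m \<in> \<gg>" for m using F by (intro tens_sl nil_pos_sl)
    have E': "tens E' m \<in> nilradical i"
    proof -
      have "tens E' m \<in> current (nil_pos n)"
        by (rule tens_nil_pos) (simp_all add: E'_def nil_posD(2)[OF E])
      moreover have "tens E' m $$ (i - 1, i) = 0" using i by (auto simp: E'_def)
      ultimately show ?thesis by (simp add: nilradical_def)
    qed
    have "E = d \<cdot>\<^sub>m F + E'"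
      using nil_posD(1)[OF E] c(1) unfolding F_def d_def E'_def by (intro gl_eqI[of _ n]) auto
    then have split: "tens E m = [:d:] \<cdot>\<^sub>m tens F m + tens E' m"
      using tens_add[of "d \<cdot>\<^sub>m F" n E' m] by (simp add: F_def E'_def tens_smult)
    obtain r' where r': "r = Suc r'" using r by (cases r) auto
    have FH: "gen (tens (coroot n i) m) - scalar (if m = 0 then of_nat ?l else 0) \<in> verma_ideal" for m :: nat
      using tens_cartan_verma[OF coroot_cartan[OF i], of m] by (simp only: coord[OF i])
    have "gen (tens F m) * garland ?y (Suc r') s \<in> sum_ideal"
    proof (rule sum_ideal_cong[OF sum_ideal_verma[OF K.raise_garland_eval[OF y nil_pos_sl[OF F] _ coroot_cartan[OF i]
            sl2_data(2)[OF i c] tens_nil_verma[OF F] FH]]])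
      show "bracket F ?y = coroot n i" unfolding F_def by (rule sl2_data(1)[OF i c])
      let ?S = "\<Sum>j<m. of_int (int j + 1 - int m) * (gen (tens ?y j) *
          (if r' = 0 then 0 else garland ?y (r' - 1) (s + m - j)))"
      have S: "?S \<in> sum_ideal"
      proof (rule sum_ideal_sum)
        fix j assume j: "j \<in> {..<m}"
        show "of_int (int j + 1 - int m) * (gen (tens ?y j) *
          (if r' = 0 then 0 else garland ?y (r' - 1) (s + m - j))) \<in> sum_ideal"
        \<comment> \<open>The coefficient is zero for \<open>j = m - 1\<close>; for smaller \<open>j\<close> the degree does not drop.\<close>
        proof (cases "Suc j = m \<or> r' = 0")
          case True
          then show ?thesis by (auto intro!: sum_ideal_lower_ideal lower_ideal_zero)
        next
          case False
          then show ?thesis using j rs unfolding r'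
            by (intro sum_ideal_of_int sum_ideal_mult_lower[OF x]) (auto intro!: G)
        qed
      qed
      show "of_int (if m = 0 then int ?l else 0) * garland ?y r' s -
        (of_int (int (s + m) + (1 - int m) * int r') * garland ?y r' (s + m) - ?S) \<in> sum_ideal"
      proof (cases "m = 0")
        case True
        \<comment> \<open>On the boundary \<open>r + s = 1 + \<Lambda>\<^sub>i\<close> the coefficient is zero; otherwise the degree is still large enough.\<close>
        have "(of_int (int ?l) - of_int (int s + int r')) * garland ?y r' s \<in> sum_ideal"
        proof (cases "?l = s + r'")
          case True
          then show ?thesis by (simp add: sum_ideal_lower_ideal lower_ideal_zero)
        next
          case False
          then have "garland ?y r' s \<in> sum_ideal" using rs unfolding r' by (intro G) simp
          then show ?thesis using sum_ideal_of_int[of _ "int ?l - (int s + int r')"] by simp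
        qed
        then show ?thesis using True by (simp add: left_diff_distrib)
      next
        case False
        then have "garland ?y r' (s + m) \<in> sum_ideal" using rs unfolding r' by (intro G) simp
        then have "of_int (int (s + m) + (1 - int m) * int r') * garland ?y r' (s + m) - ?S \<in> sum_ideal"
          by (intro sum_ideal_diff sum_ideal_of_int S)
        from sum_ideal_uminus[OF this] False show ?thesis by (simp only: if_False of_int_0 mult_zero_left diff_0)
      qed
    qed
    then have F_sat: "gen ([:d:] \<cdot>\<^sub>m tens F m) * garland ?y r s \<in> sum_ideal"
      unfolding r' by (intro sum_ideal_gen_smult Fg K.garland_alg[OF y])
    have E'_sat: "gen (tens E' m) * garland ?y r s \<in> sum_ideal"
      by (intro sum_ideal_verma nilradical_garland i E')
    show "gen (tens E m) * garland ?y r s \<in> sum_ideal"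
      unfolding split
      by (rule sum_ideal_gen_add[OF _ _ yg F_sat E'_sat])
         (use Fg E' current_nil_subset(2) in \<open>auto simp: nilradical_def intro: sl.L_smult\<close>)
  qed
qed

section \<open>Stability of the proposed ideal\<close>

text \<open>Stability passes from the generators to the left ideal: \<open>A\<close> is moved past a letter \<open>x\<close> of
  \<open>\<nn>\<^sup>-[t]\<close> at the cost of \<open>[A, x]\<close>, to which the induction hypothesis applies as well.\<close>

lemma lower_ideal_stable:
  assumes "p \<in> lower_ideal" "A \<in> \<gg>"
  shows "gen A * p \<in> sum_ideal"
proof -
  have "p \<in> lower_ideal \<and> (\<forall>A\<in>\<gg>. gen A * p \<in> sum_ideal)"
    using assms(1) unfolding lower_ideal_def
  proof (induction rule: left_span.induct)
    case zero
    then show ?case using left_span.zero sum_ideal_lower_ideal lower_ideal_zero by simp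
  next
    case (base w)
    then have "w \<in> lower_ideal" unfolding lower_ideal_def by (rule left_span.base)
    moreover have "gen A * w \<in> sum_ideal" if A: "A \<in> \<gg>" for A
    proof (cases "w \<in> lower_gens")
      case True
      then consider i r s where "w = garland (xm (simple_root i)) r s" "i \<in> {1..n}" "1 \<le> r"
          "1 + coord n \<Lambda> i \<le> r + s"
        | \<alpha> k where "w = gen (tens (xm \<alpha>) k)" "\<alpha> \<in> pos_roots n" "xi_min n \<xi> \<alpha> \<le> k"
        unfolding lower_gens_def by blast
      then show ?thesis using A by cases (simp_all add: garland_stable root_vector_stable)
    next
      case False
      then have "w \<in> uea_ideal \<gg>" using base by blast
      then show ?thesis using A by (intro sum_ideal_rels sl.uea_ideal_left alg_gen)
    qed
    ultimately show ?case unfolding lower_ideal_def by blast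
  next
    case (add p q)
    then show ?case by (simp add: left_span.add distrib_left sum_ideal_add)
  next
    case (mult u p)
    note pN = mult.IH[THEN conjunct1, folded lower_ideal_def]
    have "gen A * (u * p) \<in> sum_ideal" if "A \<in> \<gg>" for A
      using mult.hyps(1) that
    proof (induction arbitrary: A rule: alg_induct)
      case one
      then show ?case using mult.IH by simp
    next
      case (add u v)
      then show ?case by (simp add: distrib_left distrib_right sum_ideal_add)
    next
      case (scalar c u)
      then show ?case by (simp add: mult.assoc scalar_left_commute[of "gen A"] sum_ideal_scalar)
    next
      case (gen x u)
      have up: "u * p \<in> alg \<gg>" using gen.hyps pN lower_ideal_alg alg_\<nn>_\<gg> by (intro alg_mult) auto
      have xg: "x \<in> \<gg>" using gen.hyps \<nn>_\<gg> by blast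
      have "gen A * (gen x * (u * p)) \<in> sum_ideal"
      proof (rule sum_ideal_cong)
        show "gen A * (gen x * (u * p)) - (gen x * (gen A * (u * p)) + gen (bracket A x) * (u * p)) \<in> sum_ideal"
          using sum_ideal_rels[OF K.commutator_mult[OF gen.prems xg up]] by (simp add: algebra_simps)
        show "gen x * (gen A * (u * p)) + gen (bracket A x) * (u * p) \<in> sum_ideal"
          using gen xg by (intro sum_ideal_add sum_ideal_mult_lower gen.IH alg_gen current_sl_bracket)
      qed
      then show ?case by (simp add: mult.assoc)
    qed
    then show ?case using mult left_span.mult by blast
  qed
  then show ?thesis using assms(2) by blast
qed

lemma sum_ideal_mult:
  assumes "u \<in> alg \<gg>" "p \<in> sum_ideal"
  shows "u * p \<in> sum_ideal"
  using assms(1)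
proof (induction rule: alg_induct)
  case (gen A u)
  then obtain q where q: "q \<in> lower_ideal" "u * p - q \<in> verma_ideal" unfolding sum_ideal_def by blast
  have "gen A * (u * p) - gen A * q \<in> sum_ideal"
    using sum_ideal_verma[OF K.P_mult[OF alg_gen[OF gen.hyps(1)] q(2)]] by (simp add: right_diff_distrib)
  then show ?case using sum_ideal_cong lower_ideal_stable[OF q(1) gen.hyps(1)] by (simp add: mult.assoc)
qed (use assms in \<open>simp_all add: distrib_right sum_ideal_add mult.assoc sum_ideal_scalar\<close>)

lemma full_gens_sum_ideal: "full_gens \<subseteq> sum_ideal"
proof
  fix w assume "w \<in> full_gens"
  then consider x where "w = gen x" "x \<in> current (nil_pos n)"
    | i r where "w = gen (tens (coroot n i) r)" "i \<in> {1..n}" "1 \<le> r"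
    | i where "w = gen (tens (coroot n i) 0) - scalar (\<Lambda> (coroot n i))" "i \<in> {1..n}"
    | i where "w = gen (tens (xm (simple_root i)) 0) ^ (coord n \<Lambda> i + 1)" "i \<in> {1..n}"
    | \<alpha> where "w = gen (tens (xm \<alpha>) (\<xi> \<alpha>))" "\<alpha> \<in> pos_roots n"
    unfolding full_gens_def by blast
  then show "w \<in> sum_ideal"
  proof cases
    case 1
    then show ?thesis by (simp add: sum_ideal_verma nil_pos_verma)
  next
    case 2
    then show ?thesis
      using sum_ideal_verma[OF tens_cartan_verma[OF coroot_cartan[OF 2(2)], of r]] by (simp add: scalar_simps)
  next
    case 3
    then show ?thesis using sum_ideal_verma[OF tens_cartan_verma[OF coroot_cartan[OF 3(2)], of 0]] by simp
  next
    case 4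
    let ?m = "coord n \<Lambda> i + 1"
    have "garland (xm (simple_root i)) ?m 0 \<in> sum_ideal"
      using 4 by (intro sum_ideal_lower_ideal garland_lower_ideal) auto
    then have "scalar (fact ?m) * divpow (gen (tens (xm (simple_root i)) 0)) ?m \<in> sum_ideal"
      by (intro sum_ideal_scalar) (simp only: garland_zero_weight)
    then show ?thesis
      by (simp add: 4 divpow_def mult.assoc[symmetric] scalar_simps(4)[symmetric] scalar_simps(2)
          del: power_Suc fact_Suc)
  next
    case 5
    then have "w \<in> lower_gens" using \<xi>_norm[OF 5(2)] unfolding lower_gens_def
      by (intro UnI2 CollectI exI[of _ \<alpha>] exI[of _ "\<xi> \<alpha>"]) auto
    then show ?thesis by (intro sum_ideal_lower_ideal lower_ideal_base)
  qed
qed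

lemma full_ideal_sum_ideal: "p \<in> full_ideal \<Longrightarrow> p \<in> sum_ideal"
  unfolding full_ideal_def
proof (induction rule: left_span.induct)
  case (base w)
  then show ?case using full_gens_sum_ideal sum_ideal_rels by blast
qed (auto intro: sum_ideal_lower_ideal lower_ideal_zero sum_ideal_add sum_ideal_mult)

lemma full_Int_lower: "p \<in> full_ideal \<Longrightarrow> p \<in> alg \<nn> \<Longrightarrow> p \<in> lower_ideal"
proof -
  assume p: "p \<in> full_ideal" "p \<in> alg \<nn>"
  from full_ideal_sum_ideal[OF p(1)] obtain q where q: "q \<in> lower_ideal" "p - q \<in> verma_ideal"
    unfolding sum_ideal_def by blast
  have "p - q \<in> uea_ideal \<nn>"
    by (rule verma_ideal_Int_lower[OF q(2)]) (use p q lower_ideal_alg in auto)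
  from lower_ideal_add[OF lower_ideal_rels_lower[OF this] q(1)] show ?thesis by simp
qed

section \<open>Comparison of the ideals\<close>

sublocale I: sl_left_ideal n full_gens full_ideal
  using full_gens_alg by (simp_all only: sl_left_ideal_def full_ideal_def)

text \<open>Both \<open>h \<otimes> t\<^sup>m\<close>, \<open>m \<ge> 1\<close>, and \<open>x\<^sup>-\<^sub>\<alpha> \<otimes> t\<^bsup>\<xi>(\<alpha>)\<^esup>\<close> are in the left ideal, hence so is their bracket. For
  \<open>\<alpha> = \<epsilon>\<^sub>a - \<epsilon>\<^sub>b\<close> the simple coroot \<open>h = h\<^sub>b\<close> is one with \<open>\<alpha>(h) \<noteq> 0\<close>.\<close>

lemma root_vector_full_ideal:
  assumes \<alpha>: "\<alpha> \<in> pos_roots n" and k: "\<xi> \<alpha> \<le> k"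
  shows "gen (tens (xm \<alpha>) k) \<in> full_ideal"
proof (cases "k = \<xi> \<alpha>")
  case True
  then show ?thesis using \<alpha> by (intro I.P_W) (auto simp: full_gens_def)
next
  case False
  define m where "m = k - \<xi> \<alpha>"
  have m: "1 \<le> m" "k = m + \<xi> \<alpha>" using False k by (auto simp: m_def)
  from \<alpha> obtain a b where ab: "a < b" "b \<le> n" "\<alpha> = eps_root a b" by (rule pos_rootsE)
  from xmE[OF ab(1,2)] obtain c where c: "xm \<alpha> = single_entry n b a c" using ab(3) by blast
  let ?h = "coroot n b" and ?y = "xm \<alpha>"
  have b: "b \<in> {1..n}" using ab by auto
  define \<kappa> where "\<kappa> = eps_root b a ?h"
  have "\<kappa> \<noteq> 0" unfolding \<kappa>_def using ab by (cases b) (auto simp: eps_root_def coroot_def)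
  have hg: "tens ?h m \<in> \<gg>" by (intro tens_sl cartan_sl coroot_cartan b)
  have yg: "tens ?y j \<in> \<gg>" for j by (intro tens_sl xm_nn \<alpha>)
  have y: "gen (tens ?y (\<xi> \<alpha>)) \<in> full_ideal" using \<alpha> by (intro I.P_W) (auto simp: full_gens_def)
  have h: "gen (tens ?h m) \<in> full_ideal"
    using b m by (intro I.P_W) (auto simp: full_gens_def simp del: atLeastAtMost_iff)
  have "bracket ?h ?y = \<kappa> \<cdot>\<^sub>m ?y"
    unfolding c \<kappa>_def by (rule bracket_cartan_single_entry[OF coroot_cartan[OF b]]) (use ab in simp)
  then have "bracket (tens ?h m) (tens ?y (\<xi> \<alpha>)) = [:\<kappa>:] \<cdot>\<^sub>m tens ?y k"
    using bracket_tens[OF cartan_gl[OF coroot_cartan[OF b]] sl_gl[OF xm_nn(2)[OF \<alpha>]], of m "\<xi> \<alpha>"] m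
    by (simp only: tens_smult)
  then have "gen (tens ?h m) * gen (tens ?y (\<xi> \<alpha>)) - gen (tens ?y (\<xi> \<alpha>)) * gen (tens ?h m) -
      gen ([:\<kappa>:] \<cdot>\<^sub>m tens ?y k) \<in> full_ideal"
    using I.P_rels[OF sl.uea_rel_bracket[OF hg yg]] by metis
  moreover have "gen (tens ?h m) * gen (tens ?y (\<xi> \<alpha>)) - gen (tens ?y (\<xi> \<alpha>)) * gen (tens ?h m) \<in> full_ideal"
    by (intro I.P_diff I.P_mult y h alg_gen hg yg)
  ultimately have "gen ([:\<kappa>:] \<cdot>\<^sub>m tens ?y k) \<in> full_ideal" using I.P_diff by fastforce
  moreover have "gen ([:\<kappa>:] \<cdot>\<^sub>m tens ?y k) - scalar \<kappa> * gen (tens ?y k) \<in> full_ideal"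
    by (intro I.P_rels sl.uea_rel_smult yg)
  ultimately have "scalar \<kappa> * gen (tens ?y k) \<in> full_ideal" using I.P_diff by fastforce
  then show ?thesis using \<open>\<kappa> \<noteq> 0\<close> by (rule I.P_scalar_cancel)
qed

lemma garland_full_ideal:
  assumes i: "i \<in> {1..n}" and "1 + coord n \<Lambda> i \<le> r + s"
  shows "garland (xm (simple_root i)) r s \<in> full_ideal"
proof -
  let ?y = "xm (simple_root i)" and ?l = "coord n \<Lambda> i"
  from xm_simpleE[OF i] obtain c where c: "c \<noteq> 0" "?y = single_entry n i (i - 1) c" by blast
  let ?F = "single_entry n (i - 1) i (1 / c)"
  have F: "?F \<in> nil_pos n" by (rule sl2_data[OF i c])
  show ?thesis
  proof (rule I.garland_in_left_ideal[OF _ nil_pos_sl[OF F] sl2_data(1)[OF i c] coroot_cartan[OF i]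
        sl2_data(2)[OF i c] _ _ _ assms(2)])
    show "?y \<in> sl n" by (rule xm_nn[OF simple_root_pos[OF i]])
    show "gen (tens ?F m) \<in> full_ideal" for m
    proof -
      have "tens ?F m \<in> current (nil_pos n)" by (rule tens_nil_pos) (use nil_posD[OF F] in blast)+
      then show ?thesis by (intro I.P_W) (auto simp: full_gens_def)
    qed
    show "gen (tens (coroot n i) m) - scalar (if m = 0 then of_nat ?l else 0) \<in> full_ideal" for m
    proof (cases "m = 0")
      case True
      have "gen (tens (coroot n i) 0) - scalar (\<Lambda> (coroot n i)) \<in> full_gens"
        using i unfolding full_gens_def by blast
      from I.P_W[OF this] show ?thesis using True by (simp add: coord[OF i])
    next
      case False
      then have "gen (tens (coroot n i) m) \<in> full_gens"
        using i unfolding full_gens_def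
        by (intro UnI1[OF UnI1[OF UnI1[OF UnI2]]] CollectI exI[of _ i] exI[of _ m]) auto
      from I.P_W[OF this] show ?thesis using False by (simp add: scalar_simps)
    qed
    have "gen (tens ?y 0) ^ (?l + 1) \<in> full_gens" using i unfolding full_gens_def by blast
    then show "gen (tens ?y 0) ^ (?l + 1) \<in> full_ideal" by (rule I.P_W)
  qed
qed

lemma lower_ideal_subset: "p \<in> lower_ideal \<Longrightarrow> p \<in> full_ideal"
  unfolding lower_ideal_def
proof (induction rule: left_span.induct)
  case (base w)
  then consider i r s where "w = garland (xm (simple_root i)) r s" "i \<in> {1..n}"
      "1 + coord n \<Lambda> i \<le> r + s"
    | \<alpha> k where "w = gen (tens (xm \<alpha>) k)" "\<alpha> \<in> pos_roots n" "xi_min n \<xi> \<alpha> \<le> k"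
    | "w \<in> uea_ideal \<gg>"
    unfolding lower_gens_def by blast
  then show ?case
    by cases (simp_all add: garland_full_ideal root_vector_full_ideal \<xi>_norm I.P_rels)
qed (auto intro: I.P_zero I.P_add I.P_mult alg_\<nn>_\<gg>)

theorem J_ideal_eq: "J_ideal n xm \<xi> \<Lambda> = gen_left_ideal (Uminus n) (in_U n ` lower_gens)"
proof -
  have U: "UU n = uea_image \<gg> \<gg>" by (simp only: UU_def uea_eq_uea_image)
  have Um: "Uminus n = uea_image \<nn> \<gg>" by (simp only: Uminus_def slnm.uea_sub_eq_uea_image)
  have I: "I_ideal n xm \<xi> \<Lambda> = uea_class \<gg> ` full_ideal"
  proof -
    have "uea_ideal \<gg> \<inter> alg \<gg> = uea_ideal \<gg>" using sl.uea_ideal_alg by blast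
    then show ?thesis
      unfolding I_ideal_def full_gens_def[symmetric] U in_U_def full_ideal_def
      using slsl.gen_left_ideal_uea_image[OF full_gens_alg] by simp
  qed
  have N: "gen_left_ideal (Uminus n) (in_U n ` lower_gens) = uea_class \<gg> ` lower_ideal"
    unfolding Um in_U_def lower_ideal_def by (rule slnm.gen_left_ideal_uea_image[OF lower_gens_alg])
  have car: "carrier (Uminus n) = uea_class \<gg> ` alg \<nn>" by (simp add: Um uea_image_def)
  show ?thesis
    unfolding J_ideal_def I N car
  proof (intro equalityI subsetI)
    fix C assume "C \<in> uea_class \<gg> ` full_ideal \<inter> uea_class \<gg> ` alg \<nn>"
    then obtain p q where p: "p \<in> full_ideal" "C = uea_class \<gg> p" and q: "q \<in> alg \<nn>" "C = uea_class \<gg> q"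
      by blast
    have "q - p \<in> uea_ideal \<gg>" using p q slsl.uea_class_eq_iff by metis
    from I.P_add[OF I.P_rels[OF this] p(1)] have "q \<in> full_ideal" by simp
    with q show "C \<in> uea_class \<gg> ` lower_ideal" using full_Int_lower by blast
  next
    fix C assume "C \<in> uea_class \<gg> ` lower_ideal"
    then show "C \<in> uea_class \<gg> ` full_ideal \<inter> uea_class \<gg> ` alg \<nn>"
      using lower_ideal_subset lower_ideal_alg by blast
  qed
qed

end

theorem proposition4p2:
  fixes n :: nat
    and xm :: "weight \<Rightarrow> complex mat"
    and \<xi> :: "weight \<Rightarrow> nat"
    and \<Lambda> :: weight
  assumes "neg_root_vectors n xm"
    and "dominant_integral n \<Lambda>"
    and "\<forall>\<alpha>\<in>pos_roots n. 1 \<le> \<xi> \<alpha>"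
    and "normalized n \<xi>"
  shows "J_ideal n xm \<xi> \<Lambda> = gen_left_ideal (Uminus n)
     (in_U n `
       ({garland (xm (simple_root i)) r s | i r s.
           i \<in> {1..n} \<and> 1 \<le> r \<and> 1 + coord n \<Lambda> i \<le> r + s} \<union>
        {gen (tens (xm \<alpha>) k) | \<alpha> k. \<alpha> \<in> pos_roots n \<and> xi_min n \<xi> \<alpha> \<le> k}))"
proof -
  interpret weyl_data n \<Lambda> xm \<xi>
  proof
    fix i assume "i \<in> {1..n}"
    then have "\<Lambda> (coroot n i) \<in> \<nat>" using assms(2) by (simp add: dominant_integral_def)
    then obtain l where l: "\<Lambda> (coroot n i) = of_nat l" by (auto elim: Nats_cases)
    then have "coord n \<Lambda> i = l" unfolding coord_def by (intro the_equality) auto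
    then show "\<Lambda> (coroot n i) = of_nat (coord n \<Lambda> i)" using l by simp
  qed (use assms in \<open>auto simp: dominant_integral_def normalized_def\<close>)
  show ?thesis using J_ideal_eq unfolding lower_gens_def .
qed

end
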